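(* Let $M$ be a finite von Neumann algebra and let $A\subset M$ be a diffuse abelian von Neumann subalgebra. Assume that the inclusion $A\subset M$ has the strong asymptotic orthogonality property. Then $A$ is singular in $M$, i.e. every unitary $w\in M$ with $wAw^*=A$ belongs to $A$.
   Context: Fix a faithful normal tracial state $\tau$ on $M$ and a free ultrafilter $\omega\in\beta(\mathbb N)\setminus\mathbb N$. $M^\omega$ denotes the tracial ultrapower, $M$ is embedded in $M^\omega$ as constant sequences, and $M\ominus A$ (resp. $M^\omega\ominus A^\omega$) is the set of elements whose trace-preserving conditional expectation onto $A$ (resp. $A^\omega$) vanishes. The inclusion $A\subset M$ has the strong asymptotic orthogonality property if for every diffuse von Neumann subalgebra $C\subset A$, all $a,b\in M\ominus A$ and all $x\in (M^\omega\ominus A^\omega)\cap C'$, one has $ax\perp xb$ in $L^2(M^\omega)$. *)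

theory Defs
  imports "HOL-Analysis.Analysis" "HOL-Algebra.QuotRing" "HOL-Algebra.Module"
begin

class scaleC =
  fixes scaleC :: "complex \<Rightarrow> 'a \<Rightarrow> 'a" (infixr "*\<^sub>C" 75)

text \<open>The norm and the topology are those of the underlying real Hilbert space, whose inner
  product is the real part of the complex one. The complex inner product is linear in its first
  argument.\<close>

class complex_hilbert_space = real_inner + complete_space + scaleC +
  fixes cinner :: "'a \<Rightarrow> 'a \<Rightarrow> complex"
  assumes scaleC_add_right: "c *\<^sub>C (x + y) = c *\<^sub>C x + c *\<^sub>C y"
    and scaleC_add_left: "(c + d) *\<^sub>C x = c *\<^sub>C x + d *\<^sub>C x"
    and scaleC_scaleC: "c *\<^sub>C d *\<^sub>C x = (c * d) *\<^sub>C x"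
    and scaleC_of_real: "complex_of_real r *\<^sub>C x = r *\<^sub>R x"
    and cinner_commute: "cinner x y = cnj (cinner y x)"
    and cinner_add_left: "cinner (x + y) z = cinner x z + cinner y z"
    and cinner_scaleC_left: "cinner (c *\<^sub>C x) y = c * cinner x y"
    and Re_cinner: "Re (cinner x y) = inner x y"
begin

subclass banach ..

end

lemma cinner_scaleC_right:
  "cinner x (c *\<^sub>C y) = cnj c * cinner x (y :: 'h::complex_hilbert_space)"
proof -
  have "cinner x (c *\<^sub>C y) = cnj (cinner (c *\<^sub>C y) x)"
    by (rule cinner_commute)
  also have "\<dots> = cnj c * cnj (cinner y x)"
    by (simp add: cinner_scaleC_left)
  also have "cnj (cinner y x) = cinner x y"
    by (rule cinner_commute[symmetric])
  finally show ?thesis .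
qed

lemma norm_scaleC: "norm (c *\<^sub>C x) = cmod c * norm (x :: 'h::complex_hilbert_space)"
proof -
  have "cinner (c *\<^sub>C x) (c *\<^sub>C x) = complex_of_real ((cmod c)\<^sup>2) * cinner x x"
    by (simp only: cinner_scaleC_left cinner_scaleC_right complex_norm_square ac_simps)
  hence "Re (cinner (c *\<^sub>C x) (c *\<^sub>C x)) = (cmod c)\<^sup>2 * Re (cinner x x)"
    by (simp only: Re_complex_of_real Im_complex_of_real mult_zero_left diff_zero times_complex.sel)
  hence "(norm (c *\<^sub>C x))\<^sup>2 = (cmod c * norm x)\<^sup>2"
    by (simp add: Re_cinner power2_norm_eq_inner power_mult_distrib)
  thus ?thesis
    by simp
qed

lemma bounded_linear_scaleC: "bounded_linear (\<lambda>x :: 'h::complex_hilbert_space. c *\<^sub>C x)"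
proof (rule bounded_linear_intro[where K = "cmod c"])
  fix r and x :: 'h
  show "c *\<^sub>C (r *\<^sub>R x) = r *\<^sub>R (c *\<^sub>C x)"
    by (metis mult.commute scaleC_of_real scaleC_scaleC)
qed (simp_all add: scaleC_add_right norm_scaleC mult.commute)

lemma cinner_eqI:
  fixes x y :: "'h::complex_hilbert_space"
  assumes "\<And>z. cinner x z = cinner y z"
  shows "x = y"
proof -
  have "inner (x - y) (x - y) = 0"
    by (metis Re_cinner assms inner_diff_left right_minus_eq)
  thus ?thesis
    by simp
qed

typedef (overloaded) 'h bounded_op =
  "{T :: 'h::complex_hilbert_space \<Rightarrow>\<^sub>L 'h. \<forall>c x. T (c *\<^sub>C x) = c *\<^sub>C T x}"
  by (rule exI[of _ id_blinfun]) simp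

setup_lifting type_definition_bounded_op

lift_definition op_apply :: "'h::complex_hilbert_space bounded_op \<Rightarrow> 'h \<Rightarrow> 'h" is blinfun_apply .

lemma op_eqI: "(\<And>x. op_apply S x = op_apply T x) \<Longrightarrow> S = T"
  by transfer (rule blinfun_eqI)

instantiation bounded_op :: (complex_hilbert_space) "{real_normed_algebra, monoid_mult, scaleC}"
begin

lift_definition zero_bounded_op :: "'a bounded_op" is 0
  by (metis add_cancel_left_right blinfun.zero_left scaleC_add_right)
lift_definition one_bounded_op :: "'a bounded_op" is id_blinfun
  by simp
lift_definition plus_bounded_op :: "'a bounded_op \<Rightarrow> 'a bounded_op \<Rightarrow> 'a bounded_op" is "(+)"
  by (simp add: blinfun.add_left scaleC_add_right)
lift_definition uminus_bounded_op :: "'a bounded_op \<Rightarrow> 'a bounded_op" is uminus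
  by (simp add: blinfun.minus_left linear_neg[OF bounded_linear.linear[OF bounded_linear_scaleC]])
lift_definition minus_bounded_op :: "'a bounded_op \<Rightarrow> 'a bounded_op \<Rightarrow> 'a bounded_op" is "(-)"
  by (simp add: blinfun.diff_left linear_diff[OF bounded_linear.linear[OF bounded_linear_scaleC]])
lift_definition times_bounded_op :: "'a bounded_op \<Rightarrow> 'a bounded_op \<Rightarrow> 'a bounded_op" is "(o\<^sub>L)"
  by simp
lift_definition scaleR_bounded_op :: "real \<Rightarrow> 'a bounded_op \<Rightarrow> 'a bounded_op" is scaleR
  by (simp add: blinfun.scaleR_left linear_scale[OF bounded_linear.linear[OF bounded_linear_scaleC]])
lift_definition scaleC_bounded_op :: "complex \<Rightarrow> 'a bounded_op \<Rightarrow> 'a bounded_op" is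
  "\<lambda>c (T :: 'a \<Rightarrow>\<^sub>L 'a). Blinfun (\<lambda>x. c *\<^sub>C T x)"
  by (simp add: bounded_linear_Blinfun_apply scaleC_scaleC mult.commute
      bounded_linear_compose[OF bounded_linear_scaleC blinfun.bounded_linear_right])
lift_definition norm_bounded_op :: "'a bounded_op \<Rightarrow> real" is norm .

definition dist_bounded_op :: "'a bounded_op \<Rightarrow> 'a bounded_op \<Rightarrow> real" where
  "dist_bounded_op S T = norm (S - T)"
definition sgn_bounded_op :: "'a bounded_op \<Rightarrow> 'a bounded_op" where
  "sgn_bounded_op T = inverse (norm T) *\<^sub>R T"
definition uniformity_bounded_op :: "('a bounded_op \<times> 'a bounded_op) filter" where
  "uniformity_bounded_op = (INF e\<in>{0<..}. principal {(S, T). dist S T < e})"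
definition open_bounded_op :: "'a bounded_op set \<Rightarrow> bool" where
  "open_bounded_op U = (\<forall>S\<in>U. \<forall>\<^sub>F (S', T) in uniformity. S' = S \<longrightarrow> T \<in> U)"

instance
proof
  fix R S T :: "'a bounded_op" and a b :: real and U :: "'a bounded_op set"
  show "R + S + T = R + (S + T)" "R + S = S + R" "0 + R = R" "- R + R = 0" "R - S = R + - S"
    by (transfer; simp)+
  show "a *\<^sub>R (R + S) = a *\<^sub>R R + a *\<^sub>R S" "(a + b) *\<^sub>R R = a *\<^sub>R R + b *\<^sub>R R"
    "a *\<^sub>R b *\<^sub>R R = (a * b) *\<^sub>R R" "1 *\<^sub>R R = R"
    by (transfer; simp add: algebra_simps)+
  show "R * S * T = R * (S * T)" "1 * R = R" "R * 1 = R"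
    by (transfer; auto intro!: blinfun_eqI)+
  show "(R + S) * T = R * T + S * T" "R * (S + T) = R * S + R * T"
    by (transfer; auto intro!: blinfun_eqI simp: blinfun.bilinear_simps)+
  show "a *\<^sub>R R * S = a *\<^sub>R (R * S)" "R * a *\<^sub>R S = a *\<^sub>R (R * S)"
    by (transfer; auto intro!: blinfun_eqI simp: blinfun.bilinear_simps)+
  show "norm R = 0 \<longleftrightarrow> R = 0" "norm (R + S) \<le> norm R + norm S"
    "norm (a *\<^sub>R R) = \<bar>a\<bar> * norm R" "norm (R * S) \<le> norm R * norm S"
    by (transfer; simp add: norm_triangle_ineq norm_blinfun_compose)+
  show "dist R S = norm (R - S)" "sgn R = inverse (norm R) *\<^sub>R R"
    by (simp_all add: dist_bounded_op_def sgn_bounded_op_def)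
  show "uniformity = (INF e\<in>{0<..}. principal {(S :: 'a bounded_op, T). dist S T < e})"
    by (simp add: uniformity_bounded_op_def)
  show "open U = (\<forall>S\<in>U. \<forall>\<^sub>F (S', T) in uniformity. S' = S \<longrightarrow> T \<in> U)"
    by (simp add: open_bounded_op_def)
qed

end

lemma op_apply_simps [simp]:
  "op_apply 0 x = 0" "op_apply 1 x = x"
  "op_apply (S + T) x = op_apply S x + op_apply T x"
  "op_apply (- S) x = - op_apply S x"
  "op_apply (S - T) x = op_apply S x - op_apply T x"
  "op_apply (S * T) x = op_apply S (op_apply T x)"
  "op_apply (r *\<^sub>R T) x = r *\<^sub>R op_apply T x"
  "op_apply (c *\<^sub>C T) x = c *\<^sub>C op_apply T x"
  by (transfer; simp add: blinfun.bilinear_simps bounded_linear_Blinfun_apply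
      bounded_linear_compose[OF bounded_linear_scaleC blinfun.bounded_linear_right])+

lemma op_apply_scaleC: "op_apply T (c *\<^sub>C x) = c *\<^sub>C op_apply T x"
  by transfer simp

lemma riesz_representation:
  fixes f :: "'a::{real_inner,complete_space} \<Rightarrow> real"
  assumes "bounded_linear f"
  obtains v where "\<And>x. f x = inner v x"
proof -
  interpret f: bounded_linear f by fact
  define g where "g x = inner x x - 2 * f x" for x
  obtain K where K: "\<And>x. \<bar>f x\<bar> \<le> norm x * K"
    using f.bounded by (auto simp: real_norm_def)
  have lower: "- K\<^sup>2 \<le> g x" for x
  proof -
    have "0 \<le> (norm x - K)\<^sup>2" by simp
    also have "\<dots> = inner x x - 2 * (norm x * K) + K\<^sup>2"
      by (simp add: power2_diff power2_norm_eq_inner)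
    also have "\<dots> \<le> g x + K\<^sup>2"
      using K[of x] by (simp add: g_def)
    finally show ?thesis by simp
  qed
  define m where "m = Inf (range g)"
  have bdd: "bdd_below (range g)"
    using lower by (auto intro!: bdd_belowI)
  have m_le: "m \<le> g x" for x
    unfolding m_def by (intro cInf_lower bdd) simp
  have "\<exists>x. g x < m + inverse (real (Suc n))" for n
    using cInf_less_iff[of "range g" "m + inverse (real (Suc n))"] bdd by (auto simp: m_def)
  then obtain X where X: "\<And>n. g (X n) < m + inverse (real (Suc n))"
    by metis
  have par: "(norm (x - y))\<^sup>2 = 2 * (g x + g y) - 4 * g ((1/2) *\<^sub>R (x + y))" for x y
    by (simp add: g_def power2_norm_eq_inner inner_simps f.add f.scaleR inner_commute algebra_simps)
  have close: "(norm (X i - X j))\<^sup>2 \<le> 2 * (inverse (real (Suc i)) + inverse (real (Suc j)))" for i j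
    using X[of i] X[of j] m_le[of "(1/2) *\<^sub>R (X i + X j)"] par[of "X i" "X j"] by simp
  have "Cauchy X"
  proof (rule metric_CauchyI)
    fix e :: real assume "0 < e"
    then obtain N where N: "inverse (real (Suc N)) < e\<^sup>2 / 4"
      using reals_Archimedean[of "e\<^sup>2 / 4"] by auto
    have lin: "a < b" if "a \<le> 2 * (x + y)" "x \<le> z" "y \<le> z" "z < b / 4" for a b x y z :: real
      using that by (simp add: distrib_left)
    have "dist (X i) (X j) < e" if "i \<ge> N" "j \<ge> N" for i j
    proof -
      have "inverse (real (Suc i)) \<le> inverse (real (Suc N))"
        "inverse (real (Suc j)) \<le> inverse (real (Suc N))"
        using that by (auto intro!: le_imp_inverse_le)
      hence "(norm (X i - X j))\<^sup>2 < e\<^sup>2"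
        by (rule lin[OF close[of i j] _ _ N])
      thus ?thesis
        using \<open>0 < e\<close> by (simp add: dist_norm power_less_imp_less_base)
    qed
    thus "\<exists>N. \<forall>i\<ge>N. \<forall>j\<ge>N. dist (X i) (X j) < e" by blast
  qed
  then obtain v where v: "X \<longlonglongrightarrow> v"
    using Cauchy_convergent_iff convergent_def by blast
  have "(\<lambda>n. g (X n)) \<longlonglongrightarrow> g v"
    unfolding g_def by (intro tendsto_intros v f.tendsto)
  moreover have "(\<lambda>n. m + inverse (real (Suc n))) \<longlonglongrightarrow> m + 0"
    by (intro tendsto_intros LIMSEQ_inverse_real_of_nat)
  ultimately have "g v \<le> m"
    using LIMSEQ_le[of "\<lambda>n. g (X n)" "g v" "\<lambda>n. m + inverse (real (Suc n))" "m + 0"] X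
    by (simp add: less_imp_le)
  hence min: "g v \<le> g x" for x
    using m_le order_trans by blast
  have "f y = inner v y" for y
  proof (rule ccontr)
    assume "f y \<noteq> inner v y"
    define d where "d = f y - inner v y"
    define s where "s = inner y y"
    have "d \<noteq> 0" using \<open>f y \<noteq> inner v y\<close> by (simp add: d_def)
    have "s \<ge> 0" by (simp add: s_def)
    define t where "t = d / (s + 1)"
    have "g (v + t *\<^sub>R y) = g v - 2 * t * d + t\<^sup>2 * s"
      by (simp add: g_def d_def s_def inner_simps f.add f.scaleR inner_commute
          power2_eq_square algebra_simps)
    hence h1: "2 * (t * d) \<le> t\<^sup>2 * s"
      using min[of "v + t *\<^sub>R y"] by simp
    have h2: "t * d = t\<^sup>2 * (s + 1)"
      using \<open>s \<ge> 0\<close> by (simp add: t_def power2_eq_square)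
    have "t\<^sup>2 > 0"
      using \<open>d \<noteq> 0\<close> \<open>s \<ge> 0\<close> by (simp add: t_def)
    have "2 * (t\<^sup>2 * (s + 1)) \<le> t\<^sup>2 * s"
      using h1 unfolding h2 .
    hence "t\<^sup>2 * (s + 2) \<le> 0" by (simp add: algebra_simps)
    thus False
      using \<open>t\<^sup>2 > 0\<close> \<open>s \<ge> 0\<close> by (simp add: mult_le_0_iff)
  qed
  thus ?thesis using that by blast
qed

lemma cinner_eq_iff_inner:
  fixes x y z w :: "'h::complex_hilbert_space"
  assumes "\<And>c. inner (c *\<^sub>C x) y = inner (c *\<^sub>C z) w"
  shows "cinner x y = cinner z w"
proof (rule complex_eqI)
  have *: "Re (c * cinner x y) = Re (c * cinner z w)" for c
  proof -
    have "Re (cinner (c *\<^sub>C x) y) = Re (cinner (c *\<^sub>C z) w)"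
      by (simp only: Re_cinner assms)
    thus ?thesis by (simp only: cinner_scaleC_left)
  qed
  show "Re (cinner x y) = Re (cinner z w)" using *[of 1] by simp
  show "Im (cinner x y) = Im (cinner z w)" using *[of \<i>] by simp
qed

lemma ex_adjoint:
  "\<exists>S :: 'h::complex_hilbert_space bounded_op. \<forall>x y. cinner (op_apply S x) y = cinner x (op_apply T y)"
proof -
  have bl: "bounded_linear (op_apply T)"
    by transfer (rule blinfun.bounded_linear_right)
  have "\<exists>v. \<forall>y. inner x (op_apply T y) = inner v y" for x
    using riesz_representation[OF bounded_linear_compose[OF bounded_linear_inner_right bl]]
    by metis
  then obtain S where S: "\<And>x y. inner x (op_apply T y) = inner (S x) y"
    by metis
  have eqI: "a = b" if "\<And>y. inner a y = inner b y" for a b :: 'h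
  proof -
    have "inner (a - b) (a - b) = 0"
      using that[of "a - b"] by (simp add: inner_diff_left)
    thus ?thesis by simp
  qed
  have inner_scaleC: "inner (c *\<^sub>C x) y = inner x (cnj c *\<^sub>C y)" for c and x y :: 'h
    by (simp flip: Re_cinner add: cinner_scaleC_left cinner_scaleC_right)
  obtain K where K: "\<And>x. norm (op_apply T x) \<le> norm x * K"
    using bounded_linear.bounded[OF bl] by blast
  have S_scaleC: "S (c *\<^sub>C x) = c *\<^sub>C S x" for c x
    by (rule eqI) (simp flip: S add: inner_scaleC op_apply_scaleC)
  have "bounded_linear S"
  proof (rule bounded_linear_intro)
    show "S (x + y) = S x + S y" for x y
      by (rule eqI) (simp flip: S add: inner_add_left)
    show "S (r *\<^sub>R x) = r *\<^sub>R S x" for r x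
      by (rule eqI) (simp flip: S)
    show "norm (S x) \<le> norm x * K" for x
    proof (cases "S x = 0")
      case True
      have "0 \<le> norm x * K" using K[of x] norm_ge_zero order_trans by blast
      with True show ?thesis by simp
    next
      case False
      have "norm (S x) * norm (S x) = inner x (op_apply T (S x))"
        by (simp add: S flip: power2_norm_eq_inner power2_eq_square)
      also have "\<dots> \<le> norm x * norm (op_apply T (S x))"
        by (rule norm_cauchy_schwarz)
      also have "\<dots> \<le> norm x * (norm (S x) * K)"
        by (intro mult_left_mono K) simp
      finally have "norm (S x) * norm (S x) \<le> norm (S x) * (norm x * K)"
        by (simp add: algebra_simps)
      with False show ?thesis by simp
    qed
  qed
  hence S': "op_apply (Abs_bounded_op (Blinfun S)) = S"
    by (simp add: op_apply.rep_eq Abs_bounded_op_inverse bounded_linear_Blinfun_apply S_scaleC)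
  have "cinner (S x) y = cinner x (op_apply T y)" for x y
    by (rule cinner_eq_iff_inner) (simp flip: S_scaleC add: S)
  thus ?thesis
    by (intro exI[of _ "Abs_bounded_op (Blinfun S)"]) (simp add: S')
qed

definition adj :: "'h::complex_hilbert_space bounded_op \<Rightarrow> 'h bounded_op" where
  "adj T = (THE S. \<forall>x y. cinner (op_apply S x) y = cinner x (op_apply T y))"

lemma cinner_adj: "cinner (op_apply (adj T) x) y = cinner x (op_apply T y)"
proof -
  obtain S :: "'a bounded_op" where S: "\<forall>x y. cinner (op_apply S x) y = cinner x (op_apply T y)"
    using ex_adjoint by blast
  have "adj T = S"
    unfolding adj_def
  proof (rule the_equality)
    show "S' = S" if "\<forall>x y. cinner (op_apply S' x) y = cinner x (op_apply T y)" for S'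
      by (rule op_eqI, rule cinner_eqI) (simp add: that S)
  qed (rule S)
  with S show ?thesis by simp
qed

definition commutant :: "'h::complex_hilbert_space bounded_op set \<Rightarrow> 'h bounded_op set" where
  "commutant S = {T. \<forall>s\<in>S. s * T = T * s}"

definition von_neumann_algebra :: "'h::complex_hilbert_space bounded_op set \<Rightarrow> bool" where
  "von_neumann_algebra M \<longleftrightarrow> (\<forall>T\<in>M. adj T \<in> M) \<and> commutant (commutant M) = M"

text \<open>Subalgebras live on the same Hilbert space as the ambient algebra and hence share its unit.\<close>

definition von_neumann_subalgebra ::
  "'h::complex_hilbert_space bounded_op set \<Rightarrow> 'h bounded_op set \<Rightarrow> bool" where
  "von_neumann_subalgebra A M \<longleftrightarrow> von_neumann_algebra A \<and> A \<subseteq> M"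

definition unitary :: "'h::complex_hilbert_space bounded_op \<Rightarrow> bool" where
  "unitary w \<longleftrightarrow> adj w * w = 1 \<and> w * adj w = 1"

definition finite_vna :: "'h::complex_hilbert_space bounded_op set \<Rightarrow> bool" where
  "finite_vna M \<longleftrightarrow> von_neumann_algebra M \<and> (\<forall>v\<in>M. adj v * v = 1 \<longrightarrow> v * adj v = 1)"

definition abelian :: "'h::complex_hilbert_space bounded_op set \<Rightarrow> bool" where
  "abelian A \<longleftrightarrow> (\<forall>a\<in>A. \<forall>b\<in>A. a * b = b * a)"

definition projections :: "'h::complex_hilbert_space bounded_op set \<Rightarrow> 'h bounded_op set" where
  "projections A = {p \<in> A. adj p = p \<and> p * p = p}"

definition minimal_projection ::
  "'h::complex_hilbert_space bounded_op set \<Rightarrow> 'h bounded_op \<Rightarrow> bool" where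
  "minimal_projection A p \<longleftrightarrow> p \<in> projections A \<and> p \<noteq> 0 \<and>
     (\<forall>q\<in>projections A. p * q = q \<longrightarrow> q = 0 \<or> q = p)"

definition diffuse :: "'h::complex_hilbert_space bounded_op set \<Rightarrow> bool" where
  "diffuse A \<longleftrightarrow> (\<nexists>p. minimal_projection A p)"

definition singular_in ::
  "'h::complex_hilbert_space bounded_op set \<Rightarrow> 'h bounded_op set \<Rightarrow> bool" where
  "singular_in A M \<longleftrightarrow> (\<forall>w\<in>M. unitary w \<and> (\<lambda>a. w * a * adj w) ` A = A \<longrightarrow> w \<in> A)"

text \<open>The ultraweak (sigma-weak) topology on all bounded operators: the coarsest one for which
  every functional sending \<open>T\<close> to the sum of the \<open>\<langle>T \<xi>\<^sub>n, \<eta>\<^sub>n\<rangle>\<close>, with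
  \<open>\<xi>\<close> and \<open>\<eta>\<close> square-summable, is continuous.\<close>

definition ultraweak_topology :: "'h::complex_hilbert_space bounded_op topology" where
  "ultraweak_topology = topology_generated_by
     {{T. (\<Sum>n. cinner (op_apply T (\<xi> n)) (\<eta> n)) \<in> U} | (\<xi> :: nat \<Rightarrow> 'h) (\<eta> :: nat \<Rightarrow> 'h) U.
        summable (\<lambda>n. (norm (\<xi> n))\<^sup>2) \<and> summable (\<lambda>n. (norm (\<eta> n))\<^sup>2) \<and> open U}"

definition normal_functional ::
  "'h::complex_hilbert_space bounded_op set \<Rightarrow> ('h bounded_op \<Rightarrow> complex) \<Rightarrow> bool" where
  "normal_functional M \<phi> \<longleftrightarrow> continuous_map (subtopology ultraweak_topology M) euclidean \<phi>"

definition linear_functional_on ::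
  "'h::complex_hilbert_space bounded_op set \<Rightarrow> ('h bounded_op \<Rightarrow> complex) \<Rightarrow> bool" where
  "linear_functional_on M \<phi> \<longleftrightarrow>
     (\<forall>x\<in>M. \<forall>y\<in>M. \<phi> (x + y) = \<phi> x + \<phi> y) \<and> (\<forall>c. \<forall>x\<in>M. \<phi> (c *\<^sub>C x) = c * \<phi> x)"

definition state_on ::
  "'h::complex_hilbert_space bounded_op set \<Rightarrow> ('h bounded_op \<Rightarrow> complex) \<Rightarrow> bool" where
  "state_on M \<phi> \<longleftrightarrow> linear_functional_on M \<phi> \<and> (\<forall>x\<in>M. \<phi> (adj x * x) \<in> \<real>\<^sub>\<ge>\<^sub>0) \<and> \<phi> 1 = 1"

definition faithful_normal_tracial_state ::
  "'h::complex_hilbert_space bounded_op set \<Rightarrow> ('h bounded_op \<Rightarrow> complex) \<Rightarrow> bool" where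
  "faithful_normal_tracial_state M \<tau> \<longleftrightarrow> state_on M \<tau> \<and> normal_functional M \<tau> \<and>
     (\<forall>x\<in>M. \<forall>y\<in>M. \<tau> (x * y) = \<tau> (y * x)) \<and> (\<forall>x\<in>M. \<tau> (adj x * x) = 0 \<longrightarrow> x = 0)"

text \<open>A structure that accommodates both a von Neumann algebra with a trace and its ultrapower.\<close>

record 'b tracial_algebra = "(complex, 'b) module" +
  star :: "'b \<Rightarrow> 'b"
  tr :: "'b \<Rightarrow> complex"

definition tracial_vna ::
  "'h::complex_hilbert_space bounded_op set \<Rightarrow> ('h bounded_op \<Rightarrow> complex) \<Rightarrow>
    'h bounded_op tracial_algebra" where
  "tracial_vna M \<tau> = \<lparr>carrier = M, mult = (*), one = 1, zero = 0, add = (+), smult = (*\<^sub>C),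
     star = adj, tr = \<tau>\<rparr>"

definition positives :: "('b, 'm) tracial_algebra_scheme \<Rightarrow> 'b set" where
  "positives N = {star N y \<otimes>\<^bsub>N\<^esub> y | y. y \<in> carrier N}"

text \<open>\<open>\<langle>x, y\<rangle>\<close> in \<open>L\<^sup>2(N)\<close> for \<open>x\<close> and \<open>y\<close> in the algebra \<open>N\<close> itself.\<close>

definition L2_inner :: "('b, 'm) tracial_algebra_scheme \<Rightarrow> 'b \<Rightarrow> 'b \<Rightarrow> complex" where
  "L2_inner N x y = tr N (star N y \<otimes>\<^bsub>N\<^esub> x)"

text \<open>The extensional function space fixes the values outside \<open>N\<close>, so that the trace-preserving
  conditional expectation is unique as a function.\<close>

definition is_trace_preserving_cond_exp ::
  "('b, 'm) tracial_algebra_scheme \<Rightarrow> 'b set \<Rightarrow> ('b \<Rightarrow> 'b) \<Rightarrow> bool" where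
  "is_trace_preserving_cond_exp N B E \<longleftrightarrow>
     E \<in> carrier N \<rightarrow>\<^sub>E B \<and>
     (\<forall>x\<in>carrier N. \<forall>y\<in>carrier N. E (x \<oplus>\<^bsub>N\<^esub> y) = E x \<oplus>\<^bsub>N\<^esub> E y) \<and>
     (\<forall>c. \<forall>x\<in>carrier N. E (c \<odot>\<^bsub>N\<^esub> x) = c \<odot>\<^bsub>N\<^esub> E x) \<and>
     (\<forall>x\<in>positives N. E x \<in> positives N) \<and>
     (\<forall>b\<in>B. E b = b) \<and>
     (\<forall>b\<in>B. \<forall>b'\<in>B. \<forall>x\<in>carrier N. E (b \<otimes>\<^bsub>N\<^esub> x \<otimes>\<^bsub>N\<^esub> b') = b \<otimes>\<^bsub>N\<^esub> E x \<otimes>\<^bsub>N\<^esub> b') \<and>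
     (\<forall>x\<in>carrier N. tr N (E x) = tr N x)"

definition cond_exp :: "('b, 'm) tracial_algebra_scheme \<Rightarrow> 'b set \<Rightarrow> 'b \<Rightarrow> 'b" where
  "cond_exp N B = (THE E. is_trace_preserving_cond_exp N B E)"

definition ortho_minus :: "('b, 'm) tracial_algebra_scheme \<Rightarrow> 'b set \<Rightarrow> 'b set" where
  "ortho_minus N B = {x \<in> carrier N. cond_exp N B x = \<zero>\<^bsub>N\<^esub>}"

definition free_ultrafilter :: "nat filter \<Rightarrow> bool" where
  "free_ultrafilter \<omega> \<longleftrightarrow> \<omega> \<noteq> bot \<and> (\<forall>P. eventually P \<omega> \<or> eventually (\<lambda>n. \<not> P n) \<omega>) \<and>
     (\<forall>k. eventually (\<lambda>n. n \<noteq> k) \<omega>)"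

definition l_infinity ::
  "'h::complex_hilbert_space bounded_op set \<Rightarrow> (complex, nat \<Rightarrow> 'h bounded_op) module" where
  "l_infinity M = \<lparr>carrier = {x. range x \<subseteq> M \<and> bounded (range x)},
     mult = (\<lambda>x y n. x n * y n), one = (\<lambda>n. 1), zero = (\<lambda>n. 0), add = (\<lambda>x y n. x n + y n),
     smult = (\<lambda>c x n. c *\<^sub>C x n)\<rparr>"

definition norm_2 :: "('h::complex_hilbert_space bounded_op \<Rightarrow> complex) \<Rightarrow> 'h bounded_op \<Rightarrow> real" where
  "norm_2 \<tau> x = sqrt (Re (\<tau> (adj x * x)))"

definition null_sequences ::
  "nat filter \<Rightarrow> 'h::complex_hilbert_space bounded_op set \<Rightarrow> ('h bounded_op \<Rightarrow> complex) \<Rightarrow>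
    (nat \<Rightarrow> 'h bounded_op) set" where
  "null_sequences \<omega> M \<tau> = {x \<in> carrier (l_infinity M). ((\<lambda>n. norm_2 \<tau> (x n)) \<longlongrightarrow> 0) \<omega>}"

text \<open>The elements are cosets of the ideal of null sequences. As in the library's multiplication
  of cosets, the remaining operations are unions over all representatives; each of these unions
  is a single coset because the operations respect the ideal.\<close>

definition ultrapower ::
  "nat filter \<Rightarrow> 'h::complex_hilbert_space bounded_op set \<Rightarrow> ('h bounded_op \<Rightarrow> complex) \<Rightarrow>
    (nat \<Rightarrow> 'h bounded_op) set tracial_algebra" where
  "ultrapower \<omega> M \<tau> =
     (let R = l_infinity M; I = null_sequences \<omega> M \<tau>; Q = R Quot I
      in \<lparr>carrier = carrier Q, mult = mult Q, one = one Q, zero = zero Q, add = add Q,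
          smult = (\<lambda>c X. \<Union>x\<in>X. I +>\<^bsub>R\<^esub> (c \<odot>\<^bsub>R\<^esub> x)),
          star = (\<lambda>X. \<Union>x\<in>X. I +>\<^bsub>R\<^esub> (\<lambda>n. adj (x n))),
          tr = (\<lambda>X. THE t. \<forall>x\<in>X. ((\<lambda>n. \<tau> (x n)) \<longlongrightarrow> t) \<omega>)\<rparr>)"

definition ultrapower_class ::
  "nat filter \<Rightarrow> 'h::complex_hilbert_space bounded_op set \<Rightarrow> ('h bounded_op \<Rightarrow> complex) \<Rightarrow>
    (nat \<Rightarrow> 'h bounded_op) \<Rightarrow> (nat \<Rightarrow> 'h bounded_op) set" where
  "ultrapower_class \<omega> M \<tau> x = null_sequences \<omega> M \<tau> +>\<^bsub>l_infinity M\<^esub> x"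

definition const_embedding ::
  "nat filter \<Rightarrow> 'h::complex_hilbert_space bounded_op set \<Rightarrow> ('h bounded_op \<Rightarrow> complex) \<Rightarrow>
    'h bounded_op \<Rightarrow> (nat \<Rightarrow> 'h bounded_op) set" where
  "const_embedding \<omega> M \<tau> a = ultrapower_class \<omega> M \<tau> (\<lambda>n. a)"

definition sub_ultrapower ::
  "nat filter \<Rightarrow> 'h::complex_hilbert_space bounded_op set \<Rightarrow> ('h bounded_op \<Rightarrow> complex) \<Rightarrow>
    'h bounded_op set \<Rightarrow> (nat \<Rightarrow> 'h bounded_op) set set" where
  "sub_ultrapower \<omega> M \<tau> A = ultrapower_class \<omega> M \<tau> ` carrier (l_infinity A)"

definition strong_asymptotic_orthogonality ::
  "nat filter \<Rightarrow> 'h::complex_hilbert_space bounded_op set \<Rightarrow> ('h bounded_op \<Rightarrow> complex) \<Rightarrow>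
    'h bounded_op set \<Rightarrow> bool" where
  "strong_asymptotic_orthogonality \<omega> M \<tau> A \<longleftrightarrow>
     (let N = ultrapower \<omega> M \<tau>; \<iota> = const_embedding \<omega> M \<tau>
      in \<forall>C. von_neumann_subalgebra C A \<and> diffuse C \<longrightarrow>
           (\<forall>a\<in>ortho_minus (tracial_vna M \<tau>) A. \<forall>b\<in>ortho_minus (tracial_vna M \<tau>) A.
            \<forall>x\<in>ortho_minus N (sub_ultrapower \<omega> M \<tau> A).
              (\<forall>c\<in>C. \<iota> c \<otimes>\<^bsub>N\<^esub> x = x \<otimes>\<^bsub>N\<^esub> \<iota> c) \<longrightarrow>
              L2_inner N (\<iota> a \<otimes>\<^bsub>N\<^esub> x) (x \<otimes>\<^bsub>N\<^esub> \<iota> b) = 0))"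

end

(* A constant sequence x in M with vanishing expectation onto A is orthogonal to A^omega, so strong
   asymptotic orthogonality with a = b = x = x^* gives tau(x^4) = 0: a self-adjoint x orthogonal to A
   is zero as soon as its relative commutant in A is diffuse. Let the unitary w normalise A. If w
   commutes with A, this applies to the real and imaginary parts of w - E(w), and w = E(w). Otherwise
   some projection of A is moved by w, which yields a nonzero projection q of A with q w q w^* = 0;
   then x = w q + q w^* is a nonzero counterexample.

   The conditional expectations onto A and A^omega have to be constructed. For 0 <= x <= 1 the
   expectation E(x) is the point of the weakly compact unit interval of A nearest to x in the 2-norm,
   and on the ultrapower the expectation is applied termwise. Projections of A are obtained as weak
   limits of the powers of 1 - y with 0 <= y <= 1, which replaces the spectral theorem. *)

theory Submission
  imports Defs
begin

text \<open>Both conditional expectations enter the hypothesis through a \<open>THE\<close>, so the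
  vanishing of an expectation carries no information until existence and uniqueness are proved, for
  \<open>M\<close> and for the ultrapower. Uniqueness is a pairing argument: a trace-preserving
  bimodule map E satisfies tr(E(x) b) = tr(x b) for all b in the subalgebra, and these pairings
  separate its points. The same pairing defines \<open>expect\<close>, so the nearest point is
  needed only for existence and positivity. The ultrafilter \<omega> of the statement doubles as the
  compactness device: norm-bounded sequences have weak limits along it. Normality carries \<tau>
  through these limits, and faithfulness turns vanishing traces into operator identities. That a
  unitary commuting with the projections of \<open>A\<close> commutes with \<open>A\<close> is shown
  by binary digits: each h with 0 <= h <= 1 in \<open>A\<close> has a first digit p, a projection of
  \<open>A\<close>, such that 2h - p again lies between 0 and 1.\<close>

section \<open>Completeness in the operator norm, and a discriminant inequality\<close>

instance bounded_op :: (complex_hilbert_space) banach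
proof
  fix X :: "nat \<Rightarrow> 'a bounded_op"
  assume X: "Cauchy X"
  have nrm: "norm (Rep_bounded_op S - Rep_bounded_op T) = norm (S - T)" for S T :: "'a bounded_op"
    by transfer simp
  have "Cauchy (\<lambda>n. Rep_bounded_op (X n))"
    using X by (simp add: Cauchy_def dist_norm nrm)
  then obtain L where L: "(\<lambda>n. Rep_bounded_op (X n)) \<longlonglongrightarrow> L"
    using Cauchy_convergent convergent_def by blast
  have "L (c *\<^sub>C x) = c *\<^sub>C L x" for c x
  proof (rule LIMSEQ_unique)
    show "(\<lambda>n. Rep_bounded_op (X n) (c *\<^sub>C x)) \<longlonglongrightarrow> L (c *\<^sub>C x)"
      by (intro tendsto_intros L)
    have "(\<lambda>n. c *\<^sub>C Rep_bounded_op (X n) x) \<longlonglongrightarrow> c *\<^sub>C L x"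
      by (intro bounded_linear.tendsto[OF bounded_linear_scaleC] tendsto_intros L)
    then show "(\<lambda>n. Rep_bounded_op (X n) (c *\<^sub>C x)) \<longlonglongrightarrow> c *\<^sub>C L x"
      using Rep_bounded_op[of "X _"] by simp
  qed
  then have "Rep_bounded_op (Abs_bounded_op L) = L"
    by (simp add: Abs_bounded_op_inverse)
  then have "dist (X n) (Abs_bounded_op L) = dist (Rep_bounded_op (X n)) L" for n
    using nrm[of "X n" "Abs_bounded_op L"] by (simp add: dist_norm)
  then have "X \<longlonglongrightarrow> Abs_bounded_op L"
    using L by (simp add: tendsto_iff)
  then show "convergent X"
    by (auto simp: convergent_def)
qed

lemma discriminant_le:
  fixes a b c :: real
  assumes "\<And>t. 0 \<le> a + 2 * t * b + t\<^sup>2 * c" and "0 \<le> c"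
  shows "b\<^sup>2 \<le> a * c"
proof (cases "c = 0")
  case True
  have "b = 0"
  proof (rule ccontr)
    assume "b \<noteq> 0"
    \<comment> \<open>With c = 0 the chosen t gives the expression the value -1.\<close>
    then show False
      using assms(1)[of "- (a + 1) / (2 * b)"] True by (simp add: field_simps)
  qed
  then show ?thesis using True by simp
next
  case False
  then have "0 < c" using assms(2) by simp
  have "0 \<le> (a + 2 * (- b / c) * b + (- b / c)\<^sup>2 * c) * c"
    using assms(1)[of "- b / c"] \<open>0 < c\<close> by simp
  also have "\<dots> = a * c - b\<^sup>2"
    using \<open>0 < c\<close> by (simp add: field_simps power2_eq_square)
  finally show ?thesis by simp
qed

subsection \<open>Adjoints, norms and positive operators\<close>

lemma inner_scaleC_left: "inner (c *\<^sub>C x) y = inner x (cnj c *\<^sub>C (y::'h::complex_hilbert_space))"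
  by (simp flip: Re_cinner add: cinner_scaleC_left cinner_scaleC_right)

lemma inner_adj: "inner (op_apply (adj T) x) y = inner x (op_apply T y)"
  by (simp flip: Re_cinner add: cinner_adj)

lemma inner_adj': "inner x (op_apply (adj T) y) = inner (op_apply T x) y"
  by (metis inner_adj inner_commute)

lemma op_eqI_inner:
  assumes "\<And>x y. inner (op_apply S x) y = inner (op_apply T x) y"
  shows "S = T"
proof (rule op_eqI)
  fix x
  have "inner (op_apply S x - op_apply T x) (op_apply S x - op_apply T x) = 0"
    by (metis assms inner_diff_left diff_self)
  then show "op_apply S x = op_apply T x" by simp
qed

lemma op_apply_vec [simp]:
  "op_apply T (x + y) = op_apply T x + op_apply T y"
  "op_apply T (x - y) = op_apply T x - op_apply T y"
  "op_apply T (- x) = - op_apply T x"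
  "op_apply T (r *\<^sub>R x) = r *\<^sub>R op_apply T x"
  "op_apply T 0 = 0"
  by (transfer; simp add: blinfun.bilinear_simps)+

lemma adj_simps [simp]:
  "adj 0 = 0" "adj 1 = 1" "adj (adj T) = T" "adj (S + T) = adj S + adj T"
  "adj (S - T) = adj S - adj T" "adj (- T) = - adj T" "adj (r *\<^sub>R T) = r *\<^sub>R adj T"
  "adj (c *\<^sub>C T) = cnj c *\<^sub>C adj T" "adj (S * T) = adj T * adj S"
  by (rule op_eqI_inner; simp add: inner_adj inner_adj' inner_simps inner_scaleC_left op_apply_scaleC)+

lemma scaleC_op_simps:
  fixes S T :: "'h::complex_hilbert_space bounded_op"
  shows "(c *\<^sub>C S) * T = c *\<^sub>C (S * T)" "S * (c *\<^sub>C T) = c *\<^sub>C (S * T)"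
    "c *\<^sub>C (S + T) = c *\<^sub>C S + c *\<^sub>C T" "c *\<^sub>C (d *\<^sub>C T) = (c * d) *\<^sub>C T"
    "(c + d) *\<^sub>C T = c *\<^sub>C T + d *\<^sub>C T"
    "complex_of_real r *\<^sub>C T = r *\<^sub>R T" "1 *\<^sub>C T = T" "0 *\<^sub>C T = 0" "(-1) *\<^sub>C T = - T"
    "c *\<^sub>C (S - T) = c *\<^sub>C S - c *\<^sub>C T"
proof -
  have r: "complex_of_real r *\<^sub>C T = r *\<^sub>R T" for r
    by (rule op_eqI) (simp add: scaleC_of_real)
  show "c *\<^sub>C (S - T) = c *\<^sub>C S - c *\<^sub>C T"
    by (rule op_eqI) (simp add: linear_diff[OF bounded_linear.linear[OF bounded_linear_scaleC]])
  show "(c *\<^sub>C S) * T = c *\<^sub>C (S * T)" "S * (c *\<^sub>C T) = c *\<^sub>C (S * T)"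
    "c *\<^sub>C (S + T) = c *\<^sub>C S + c *\<^sub>C T" "c *\<^sub>C (d *\<^sub>C T) = (c * d) *\<^sub>C T"
    "(c + d) *\<^sub>C T = c *\<^sub>C T + d *\<^sub>C T"
    by (rule op_eqI; simp add: op_apply_scaleC scaleC_add_right scaleC_add_left scaleC_scaleC)+
  show "complex_of_real r *\<^sub>C T = r *\<^sub>R T" "1 *\<^sub>C T = T" "0 *\<^sub>C T = 0" "(-1) *\<^sub>C T = - T"
    using r[of r] r[of 1] r[of 0] r[of "-1"] by simp_all
qed

lemma op_apply_norm_le: "norm (op_apply T x) \<le> norm T * norm x"
  by transfer (rule norm_blinfun)

lemma op_norm_leI:
  assumes "0 \<le> b" "\<And>x. norm (op_apply T x) \<le> b * norm x"
  shows "norm T \<le> b"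
  using assms by transfer (rule norm_blinfun_bound)

lemma op_norm_scaleC: "norm (c *\<^sub>C (T::'h::complex_hilbert_space bounded_op)) \<le> cmod c * norm T"
  by (rule op_norm_leI)
    (auto simp: norm_scaleC mult.assoc intro!: mult_left_mono op_apply_norm_le)

text \<open>The half of the C*-identity that submultiplicativity does not give: |T x|^2 = <adj T T
  x, x> is bounded by Cauchy-Schwarz. Cancelling a factor then shows that \<open>adj\<close> is
  isometric.\<close>

lemma op_norm_sq_le: "(norm T)\<^sup>2 \<le> norm (adj T * T)"
proof -
  have "norm (op_apply T x) \<le> sqrt (norm (adj T * T)) * norm x" for x
  proof -
    have "(norm (op_apply T x))\<^sup>2 = inner (op_apply (adj T * T) x) x"
      by (simp add: inner_adj power2_norm_eq_inner)
    also have "\<dots> \<le> norm (op_apply (adj T * T) x) * norm x" by (rule norm_cauchy_schwarz)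
    also have "\<dots> \<le> (norm (adj T * T) * norm x) * norm x"
      by (intro mult_right_mono op_apply_norm_le) simp
    finally have "(norm (op_apply T x))\<^sup>2 \<le> (sqrt (norm (adj T * T)) * norm x)\<^sup>2"
      by (simp add: power_mult_distrib power2_eq_square algebra_simps)
    then show ?thesis by (rule power2_le_imp_le) simp
  qed
  then have "norm T \<le> sqrt (norm (adj T * T))" by (intro op_norm_leI) auto
  then have "(norm T)\<^sup>2 \<le> (sqrt (norm (adj T * T)))\<^sup>2" by (intro power_mono) auto
  then show ?thesis by simp
qed

lemma op_norm_adj [simp]: "norm (adj T) = norm T"
proof -
  have *: "norm T \<le> norm (adj T)" for T :: "'a bounded_op"
  proof (cases "norm T = 0")
    case False
    have "norm T * norm T \<le> norm (adj T) * norm T"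
      using op_norm_sq_le[of T] norm_mult_ineq[of "adj T" T] by (simp add: power2_eq_square)
    then show ?thesis using False by simp
  qed simp
  show ?thesis using *[of T] *[of "adj T"] by simp
qed

section \<open>Positive operators and their square roots\<close>

definition op_pos :: "'h::complex_hilbert_space bounded_op \<Rightarrow> bool" where
  "op_pos T \<longleftrightarrow> adj T = T \<and> (\<forall>x. 0 \<le> inner (op_apply T x) x)"

lemma op_pos_adj: "op_pos T \<Longrightarrow> adj T = T"
  by (simp add: op_pos_def)

lemma op_pos_zero: "op_pos 0"
  and op_pos_one: "op_pos 1"
  by (simp_all add: op_pos_def)

lemma op_pos_add: "op_pos S \<Longrightarrow> op_pos T \<Longrightarrow> op_pos (S + T)"
  by (simp add: op_pos_def inner_add_left)

lemma op_pos_scaleR: "op_pos T \<Longrightarrow> 0 \<le> r \<Longrightarrow> op_pos (r *\<^sub>R T)"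
  by (simp add: op_pos_def)

lemma op_pos_conj: "op_pos T \<Longrightarrow> op_pos (adj S * T * S)"
  by (simp add: op_pos_def inner_adj mult.assoc)

lemma op_pos_square: "op_pos (adj S * S)"
  using op_pos_conj[OF op_pos_one, of S] by simp

lemma op_pos_norm_diff:
  assumes "adj T = T" "norm T \<le> c"
  shows "op_pos (c *\<^sub>R 1 - T)"
proof -
  have "inner (op_apply T x) x \<le> c * inner x x" for x
  proof -
    have "inner (op_apply T x) x \<le> norm (op_apply T x) * norm x" by (rule norm_cauchy_schwarz)
    also have "\<dots> \<le> (norm T * norm x) * norm x" by (intro mult_right_mono op_apply_norm_le) simp
    also have "\<dots> \<le> (c * norm x) * norm x" using assms by (intro mult_right_mono) auto
    finally show ?thesis by (simp add: mult.assoc flip: power2_norm_eq_inner power2_eq_square)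
  qed
  then show ?thesis using assms by (simp add: op_pos_def inner_diff_left)
qed

text \<open>Cauchy-Schwarz for the positive semidefinite form <T u, v> at u = x and v = y = T x
  gives |y|^4 <= <T x, x> <T y, y> <= c^2 |x|^2 |y|^2, and a factor |y|^2 cancels. The first
  inequality is the discriminant of \<open>?q\<close> on the line x + t y.\<close>

lemma op_pos_norm_le:
  assumes T: "op_pos T" and cT: "op_pos (c *\<^sub>R 1 - T)" and c: "0 \<le> c"
  shows "norm T \<le> c"
proof (rule op_norm_leI[OF c])
  fix x
  let ?q = "\<lambda>x. inner (op_apply T x) x"
  have q: "0 \<le> ?q x" "?q x \<le> c * (norm x)\<^sup>2" for x
    using T cT by (auto simp: op_pos_def inner_diff_left power2_norm_eq_inner)
  define y where "y = op_apply T x"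
  have sym: "inner (op_apply T y) x = (norm y)\<^sup>2"
    using inner_adj[of T y x] T by (simp add: op_pos_def y_def power2_norm_eq_inner)
  have "((norm y)\<^sup>2)\<^sup>2 \<le> ?q x * ?q y"
  proof (rule discriminant_le)
    fix t
    have "0 \<le> ?q (x + t *\<^sub>R y)" by (rule q)
    also have "\<dots> = ?q x + 2 * t * (norm y)\<^sup>2 + t\<^sup>2 * ?q y"
      using sym by (simp add: inner_simps power2_eq_square dot_square_norm algebra_simps flip: y_def)
    finally show "0 \<le> ?q x + 2 * t * (norm y)\<^sup>2 + t\<^sup>2 * ?q y" .
  qed (rule q)
  also have "\<dots> \<le> (c * (norm x)\<^sup>2) * (c * (norm y)\<^sup>2)"
    using q c by (intro mult_mono) auto
  finally have "(norm y)\<^sup>2 * (norm y)\<^sup>2 \<le> (c * norm x)\<^sup>2 * (norm y)\<^sup>2"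
    by (simp add: power2_eq_square algebra_simps)
  then have "norm y = 0 \<or> (norm y)\<^sup>2 \<le> (c * norm x)\<^sup>2"
    by (metis mult_right_le_imp_le zero_less_norm_iff zero_less_power norm_eq_zero)
  then have "norm y \<le> c * norm x"
    using c by (auto intro: power2_le_imp_le simp: zero_le_mult_iff)
  then show "norm (op_apply T x) \<le> c * norm x" by (simp add: y_def)
qed

text \<open>The iteration \<open>X \<mapsto> (Y + X\<^sup>2) / 2\<close> with \<open>Y = 1 - T\<close> converges to \<open>1 - \<surd>T\<close>;
  the same iteration started from the scalar \<open>Y = 1\<close> majorises its increments.\<close>

lemma op_sqrt_unit:
  fixes Y :: "'h::complex_hilbert_space bounded_op"
  assumes Y: "adj Y = Y" "norm Y \<le> 1"
  shows "\<exists>X. adj X = X \<and> norm X \<le> 1 \<and> (1 - X) * (1 - X) = 1 - Y \<and> (\<forall>R. R * Y = Y * R \<longrightarrow> R * X = X * R)"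
proof -
  define X where "X = rec_nat (0::'h bounded_op) (\<lambda>_ Z. (1/2) *\<^sub>R (Y + Z * Z))"
  define r where "r = rec_nat (0::real) (\<lambda>_ z. (1/2) * (1 + z * z))"
  have X0: "X 0 = 0" and XS: "X (Suc n) = (1/2) *\<^sub>R (Y + X n * X n)" for n
    by (simp_all add: X_def)
  have r0: "r 0 = 0" and rS: "r (Suc n) = (1/2) * (1 + r n * r n)" for n
    by (simp_all add: r_def)
  have comm: "R * X n = X n * R" if "R * Y = Y * R" for R n
  proof (induction n)
    case (Suc n)
    have "R * (X n * X n) = (X n * X n) * R"
      by (metis Suc mult.assoc)
    then show ?case using that by (simp add: XS distrib_left distrib_right)
  qed (simp add: X0)
  have XY: "X n * X m = X m * X n" for n m
    using comm[of "X m" n] comm[of Y m] by simp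
  have adjX: "adj (X n) = X n" for n
    by (induction n) (simp_all add: X0 XS Y)
  have r_bd: "0 \<le> r n \<and> r n \<le> 1" for n
  proof (induction n)
    case (Suc n)
    then have "r n * r n \<le> 1" by (simp add: mult_le_one)
    then show ?case using Suc by (simp add: rS)
  qed (simp add: r0)
  have nX: "norm (X n) \<le> r n" for n
  proof (induction n)
    case (Suc n)
    have "norm (X n * X n) \<le> r n * r n"
      using norm_mult_ineq[of "X n" "X n"] mult_mono[OF Suc Suc] r_bd[of n] by simp
    then show ?case
      using norm_triangle_ineq[of Y "X n * X n"] Y by (simp add: XS rS)
  qed (simp add: X0 r0)
  have step: "norm (X (Suc n) - X n) \<le> r (Suc n) - r n" for n
  proof (induction n)
    case 0
    then show ?case using nX[of "Suc 0"] by (simp add: X0 r0)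
  next
    case (Suc n)
    have "X (Suc (Suc n)) - X (Suc n) = (1/2) *\<^sub>R (X (Suc n) * X (Suc n) - X n * X n)"
      by (simp only: XS[of "Suc n"] XS[of n]) (simp add: algebra_simps)
    also have "X (Suc n) * X (Suc n) - X n * X n = (X (Suc n) - X n) * (X (Suc n) + X n)"
      using XY[of n "Suc n"] by (simp add: algebra_simps)
    finally have "norm (X (Suc (Suc n)) - X (Suc n))
        \<le> (1/2) * (norm (X (Suc n) - X n) * norm (X (Suc n) + X n))"
      using norm_mult_ineq[of "X (Suc n) - X n" "X (Suc n) + X n"] by simp
    also have "norm (X (Suc n) - X n) * norm (X (Suc n) + X n)
        \<le> (r (Suc n) - r n) * (r (Suc n) + r n)"
      using norm_triangle_ineq[of "X (Suc n)" "X n"] nX[of n] nX[of "Suc n"] r_bd[of n] r_bd[of "Suc n"]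
        order_trans[OF norm_ge_zero Suc]
      by (intro mult_mono Suc) auto
    also have "(1/2) * ((r (Suc n) - r n) * (r (Suc n) + r n)) = r (Suc (Suc n)) - r (Suc n)"
      by (simp only: rS[of "Suc n"] rS[of n]) (simp add: algebra_simps)
    finally show ?case by simp
  qed
  have diff: "norm (X (n + k) - X n) \<le> r (n + k) - r n" for n k
  proof (induction k)
    case (Suc k)
    then show ?case
      using norm_triangle_ineq[of "X (Suc (n + k)) - X (n + k)" "X (n + k) - X n"] step[of "n + k"]
      by simp
  qed simp
  have incr: "incseq r"
    by (rule incseq_SucI) (metis diff_ge_0_iff_ge norm_ge_zero order_trans step)
  have "convergent r"
    using incr r_bd by (metis incseq_convergent convergentI)
  then have "Cauchy r" by (rule convergent_Cauchy)
  have "Cauchy X"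
  proof (rule metric_CauchyI)
    fix e :: real assume "0 < e"
    then obtain N where N: "\<And>m n. m \<ge> N \<Longrightarrow> n \<ge> N \<Longrightarrow> dist (r m) (r n) < e"
      using metric_CauchyD[OF \<open>Cauchy r\<close>] by blast
    have *: "dist (X m) (X n) < e" if "N \<le> n" "n \<le> m" for m n
      using diff[of n "m - n"] N[of m n] that by (simp add: dist_norm)
    show "\<exists>N. \<forall>m\<ge>N. \<forall>n\<ge>N. dist (X m) (X n) < e"
      using * by (metis dist_commute nle_le)
  qed
  then obtain L where L: "X \<longlonglongrightarrow> L"
    using Cauchy_convergent convergent_def by blast
  have "(\<lambda>n. X (Suc n)) \<longlonglongrightarrow> (1/2) *\<^sub>R (Y + L * L)"
    unfolding XS by (intro tendsto_intros L)
  then have L_eq: "L = (1/2) *\<^sub>R (Y + L * L)"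
    using LIMSEQ_Suc[OF L] LIMSEQ_unique by blast
  have "2 *\<^sub>R L = Y + L * L"
    by (subst L_eq) simp
  then have "(1 - L) * (1 - L) = 1 - Y"
    by (simp add: algebra_simps scaleR_2)
  moreover have "norm L \<le> 1"
    by (rule LIMSEQ_le_const2[OF tendsto_norm[OF L]]) (meson nX r_bd order_trans)
  moreover have "R * L = L * R" if "R * Y = Y * R" for R
  proof (rule LIMSEQ_unique)
    show "(\<lambda>n. R * X n) \<longlonglongrightarrow> R * L" by (intro tendsto_intros L)
    show "(\<lambda>n. R * X n) \<longlonglongrightarrow> L * R" unfolding comm[OF that] by (intro tendsto_intros L)
  qed
  moreover have "adj L = L"
  proof -
    have "(\<lambda>n. adj (X n)) \<longlonglongrightarrow> adj L"
    proof (rule tendstoI)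
      fix e :: real assume "0 < e"
      have "dist (adj (X n)) (adj L) = dist (X n) L" for n
        by (simp add: dist_norm flip: adj_simps)
      then show "\<forall>\<^sub>F n in sequentially. dist (adj (X n)) (adj L) < e"
        using tendstoD[OF L \<open>0 < e\<close>] by simp
    qed
    then show ?thesis using L LIMSEQ_unique by (simp add: adjX)
  qed
  ultimately show ?thesis by blast
qed

text \<open>\<open>op_sqrt_unit\<close> needs a contraction, hence the rescaling by the norm. The
  commutation clause stands in for functional calculus: through the double commutant it puts the
  root into every von Neumann algebra containing T (\<open>vna_sqrt\<close>).\<close>

lemma op_pos_sqrt:
  fixes T :: "'h::complex_hilbert_space bounded_op"
  assumes T: "op_pos T"
  obtains S where "op_pos S" "S * S = T" "\<And>R. R * T = T * R \<Longrightarrow> R * S = S * R"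
proof (cases "T = 0")
  case True
  then show ?thesis using that[of 0] by (simp add: op_pos_zero)
next
  case False
  define c where "c = norm T"
  have c: "0 < c" using False by (simp add: c_def)
  define Y where "Y = 1 - (1/c) *\<^sub>R T"
  have T1: "op_pos ((1/c) *\<^sub>R T)" using T c by (intro op_pos_scaleR) auto
  have "op_pos (1 *\<^sub>R 1 - (1/c) *\<^sub>R T)"
    using T c by (intro op_pos_norm_diff) (auto simp: op_pos_adj c_def)
  then have Y1: "op_pos Y" by (simp add: Y_def)
  have "norm Y \<le> 1"
    using T1 by (intro op_pos_norm_le[OF Y1]) (auto simp: Y_def)
  then obtain X where X: "adj X = X" "norm X \<le> 1" "(1 - X) * (1 - X) = 1 - Y"
    "\<And>R. R * Y = Y * R \<Longrightarrow> R * X = X * R"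
    using op_sqrt_unit[of Y] Y1 by (auto simp: op_pos_adj)
  have "op_pos (1 - X)" using op_pos_norm_diff[OF X(1,2)] by simp
  then have "op_pos (sqrt c *\<^sub>R (1 - X))" using c by (intro op_pos_scaleR) auto
  moreover have "(sqrt c *\<^sub>R (1 - X)) * (sqrt c *\<^sub>R (1 - X)) = T"
    using X(3) c by (simp add: Y_def)
  moreover have "R * (sqrt c *\<^sub>R (1 - X)) = (sqrt c *\<^sub>R (1 - X)) * R" if "R * T = T * R" for R
  proof -
    have "R * Y = Y * R" using that by (simp add: Y_def algebra_simps)
    then show ?thesis using X(4)[of R] by (simp add: algebra_simps)
  qed
  ultimately show ?thesis by (rule that)
qed

text \<open>The root Q of T still commutes with S, so the product is Q S Q.\<close>

lemma op_pos_mult: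
  assumes S: "op_pos S" and T: "op_pos T" and "S * T = T * S"
  shows "op_pos (S * T)"
proof -
  obtain Q where Q: "op_pos Q" "Q * Q = T" "\<And>R. R * T = T * R \<Longrightarrow> R * Q = Q * R"
    using op_pos_sqrt[OF T] by blast
  have "S * T = adj Q * S * Q"
    using Q(3)[OF assms(3)] Q(1) by (simp add: op_pos_adj mult.assoc flip: Q(2)) (metis mult.assoc)
  then show ?thesis using op_pos_conj[OF S] by simp
qed

subsection \<open>Von Neumann algebras and weak limits\<close>

lemma vna_double_commutant: "von_neumann_algebra M \<Longrightarrow> T \<in> M \<longleftrightarrow> (\<forall>S\<in>commutant M. S * T = T * S)"
  by (auto simp: von_neumann_algebra_def commutant_def)

lemma vna_closed:
  assumes "von_neumann_algebra M"
  shows "0 \<in> M" "1 \<in> M" "S \<in> M \<Longrightarrow> T \<in> M \<Longrightarrow> S + T \<in> M" "S \<in> M \<Longrightarrow> T \<in> M \<Longrightarrow> S - T \<in> M"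
    "S \<in> M \<Longrightarrow> T \<in> M \<Longrightarrow> S * T \<in> M" "T \<in> M \<Longrightarrow> - T \<in> M" "T \<in> M \<Longrightarrow> r *\<^sub>R T \<in> M"
    "T \<in> M \<Longrightarrow> c *\<^sub>C T \<in> M" "T \<in> M \<Longrightarrow> adj T \<in> M"
proof -
  note iff = vna_double_commutant[OF assms]
  show "0 \<in> M" "1 \<in> M" "S \<in> M \<Longrightarrow> T \<in> M \<Longrightarrow> S + T \<in> M" "S \<in> M \<Longrightarrow> T \<in> M \<Longrightarrow> S - T \<in> M"
    "T \<in> M \<Longrightarrow> - T \<in> M" "T \<in> M \<Longrightarrow> r *\<^sub>R T \<in> M" "T \<in> M \<Longrightarrow> c *\<^sub>C T \<in> M"
    by (simp_all add: iff algebra_simps scaleC_op_simps)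
  show "S \<in> M \<Longrightarrow> T \<in> M \<Longrightarrow> S * T \<in> M"
    by (simp add: iff) (metis mult.assoc)
  show "T \<in> M \<Longrightarrow> adj T \<in> M" using assms by (simp add: von_neumann_algebra_def)
qed

lemma vna_power: "von_neumann_algebra M \<Longrightarrow> T \<in> M \<Longrightarrow> T ^ n \<in> M"
  by (induction n) (simp_all add: vna_closed)

lemma vna_sqrt:
  assumes "von_neumann_algebra M" "T \<in> M" "op_pos T"
  obtains S where "S \<in> M" "op_pos S" "S * S = T" "\<And>R. R * T = T * R \<Longrightarrow> R * S = S * R"
proof -
  obtain S where S: "op_pos S" "S * S = T" "\<And>R. R * T = T * R \<Longrightarrow> R * S = S * R"
    using op_pos_sqrt[OF assms(3)] by blast
  have "S \<in> M"
    using S(3) assms(2) by (simp add: vna_double_commutant[OF assms(1)])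
  with S show ?thesis using that by blast
qed

text \<open>The weak operator topology along a filter. Real inner products suffice, because
  replacing y by its multiple with \<i> recovers the imaginary parts
  (\<open>weak_tendsto_cinner\<close>). Multiplication by a fixed operator is continuous on either
  side; multiplication of two sequences is not.\<close>

definition weak_tendsto ::
  "('i \<Rightarrow> 'h::complex_hilbert_space bounded_op) \<Rightarrow> 'h bounded_op \<Rightarrow> 'i filter \<Rightarrow> bool" where
  "weak_tendsto T L F \<longleftrightarrow>
     (\<forall>x y. ((\<lambda>n. inner (op_apply (T n) x) y) \<longlongrightarrow> inner (op_apply L x) y) F)"

lemma weak_tendstoD:
  "weak_tendsto T L F \<Longrightarrow> ((\<lambda>n. inner (op_apply (T n) x) y) \<longlongrightarrow> inner (op_apply L x) y) F"
  by (simp add: weak_tendsto_def)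

lemma weak_tendsto_const: "weak_tendsto (\<lambda>_. T) T F"
  by (simp add: weak_tendsto_def)

lemma weak_tendsto_diff:
  "weak_tendsto S K F \<Longrightarrow> weak_tendsto T L F \<Longrightarrow> weak_tendsto (\<lambda>n. S n - T n) (K - L) F"
  by (simp add: weak_tendsto_def inner_diff_left tendsto_diff)

lemma weak_tendsto_mult_left:
  "weak_tendsto T L F \<Longrightarrow> weak_tendsto (\<lambda>n. S * T n) (S * L) F"
  unfolding weak_tendsto_def by (simp flip: inner_adj')

lemma weak_tendsto_mult_right:
  "weak_tendsto T L F \<Longrightarrow> weak_tendsto (\<lambda>n. T n * S) (L * S) F"
  by (simp add: weak_tendsto_def)

lemma weak_tendsto_unique:
  assumes "F \<noteq> bot" "weak_tendsto T K F" "weak_tendsto T L F"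
  shows "K = L"
  by (rule op_eqI_inner) (meson assms tendsto_unique weak_tendstoD)

lemma weak_tendsto_adj: "weak_tendsto T L F \<Longrightarrow> weak_tendsto (\<lambda>n. adj (T n)) (adj L) F"
  by (simp add: weak_tendsto_def inner_adj) (simp add: inner_commute)

lemma weak_tendsto_op_pos:
  assumes "F \<noteq> bot" "weak_tendsto T L F" "\<And>n. op_pos (T n)"
  shows "op_pos L"
proof -
  have "adj L = L"
    using weak_tendsto_adj[OF assms(2)] assms by (auto intro: weak_tendsto_unique simp: op_pos_adj)
  moreover have "0 \<le> inner (op_apply L x) x" for x
    using assms by (intro tendsto_lowerbound[OF weak_tendstoD[OF assms(2)]]) (auto simp: op_pos_def)
  ultimately show ?thesis by (simp add: op_pos_def)
qed

text \<open>M is the commutant of its commutant, and commuting with a fixed S survives weak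
  limits.\<close>

lemma vna_weak_limit:
  assumes "von_neumann_algebra M" "F \<noteq> bot" "weak_tendsto T L F" "\<And>n. T n \<in> M"
  shows "L \<in> M"
proof -
  have "S * L = L * S" if "S \<in> commutant M" for S
  proof (rule weak_tendsto_unique[OF assms(2) weak_tendsto_mult_left[OF assms(3)]])
    have "S * T n = T n * S" for n using that assms(1,4) vna_double_commutant by blast
    then show "weak_tendsto (\<lambda>n. S * T n) (L * S) F"
      using weak_tendsto_mult_right[OF assms(3)] by simp
  qed
  then show ?thesis using vna_double_commutant[OF assms(1)] by simp
qed

subsection \<open>Ultrafilter limits\<close>

lemma free_ultrafilter_not_bot: "free_ultrafilter \<omega> \<Longrightarrow> \<omega> \<noteq> bot"
  by (simp add: free_ultrafilter_def)

text \<open>Compactness provides a cluster point of the image filter. The ultrafilter decides every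
  neighbourhood of that point, and the decision cannot be negative, so the cluster point is a
  limit.\<close>

lemma ultrafilter_compact_limit:
  assumes "free_ultrafilter \<omega>" "compact U" "\<And>n. f n \<in> U"
  obtains l where "l \<in> U" "(f \<longlongrightarrow> l) \<omega>"
proof -
  define F where "F = filtermap f \<omega>"
  have "F \<noteq> bot" using assms(1) by (simp add: F_def filtermap_bot_iff free_ultrafilter_def)
  moreover have "eventually (\<lambda>x. x \<in> U) F" using assms(3) by (simp add: F_def eventually_filtermap)
  ultimately obtain l where l: "l \<in> U" "inf (nhds l) F \<noteq> bot"
    using assms(2) unfolding compact_filter by blast
  have "(f \<longlongrightarrow> l) \<omega>"
  proof (rule topological_tendstoI)
    fix S assume S: "open S" "l \<in> S"
    show "eventually (\<lambda>n. f n \<in> S) \<omega>"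
    proof (rule ccontr)
      assume "\<not> eventually (\<lambda>n. f n \<in> S) \<omega>"
      then have "eventually (\<lambda>x. x \<notin> S) F"
        using assms(1) by (auto simp: free_ultrafilter_def F_def eventually_filtermap)
      moreover have "eventually (\<lambda>x. x \<in> S) (nhds l)" using S by (rule eventually_nhds_in_open)
      ultimately have "eventually (\<lambda>x. False) (inf (nhds l) F)"
        unfolding eventually_inf by blast
      with l(2) show False by (simp add: trivial_limit_def)
    qed
  qed
  with l(1) show ?thesis by (rule that)
qed

text \<open>Riesz representation in the second variable. Real and complex homogeneity of the
  representing map are both extracted from \<open>scaleC\<close>, which moves a scalar across the
  form.\<close>

lemma op_of_bounded_form:
  fixes b :: "'h::complex_hilbert_space \<Rightarrow> 'h \<Rightarrow> real"
  assumes add_l: "\<And>x x' y. b (x + x') y = b x y + b x' y"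
    and add_r: "\<And>x y y'. b x (y + y') = b x y + b x y'"
    and scale_r: "\<And>r x y. b x (r *\<^sub>R y) = r * b x y"
    and scaleC: "\<And>c x y. b (c *\<^sub>C x) y = b x (cnj c *\<^sub>C y)"
    and bound: "\<And>x y. \<bar>b x y\<bar> \<le> K * (norm x * norm y)" and K: "0 \<le> K"
  obtains L where "\<And>x y. inner (op_apply L x) y = b x y" "norm L \<le> K"
proof -
  have "bounded_linear (b x)" for x
    by (rule bounded_linear_intro[where K = "K * norm x"])
      (use bound[of x] in \<open>simp_all add: add_r scale_r algebra_simps\<close>)
  then have "\<exists>v. \<forall>y. b x y = inner v y" for x
    using riesz_representation by metis
  then obtain S where S: "\<And>x y. b x y = inner (S x) y" by metis
  have eqI: "u = v" if "\<And>y. inner u y = inner v y" for u v :: 'h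
    by (metis that inner_diff_left inner_eq_zero_iff right_minus_eq)
  have S_scaleC: "S (c *\<^sub>C x) = c *\<^sub>C S x" for c x
    by (rule eqI) (simp flip: S add: scaleC inner_scaleC_left)
  have nS: "norm (S x) \<le> norm x * K" for x
  proof (cases "S x = 0")
    case False
    have "norm (S x) * norm (S x) = b x (S x)" by (simp add: S dot_square_norm power2_eq_square)
    also have "\<dots> \<le> K * (norm x * norm (S x))" using bound[of x "S x"] by simp
    finally show ?thesis using False by (simp add: algebra_simps)
  qed (simp add: K)
  have "bounded_linear S"
  proof (rule bounded_linear_intro[OF _ _ nS])
    show "S (x + y) = S x + S y" for x y
      by (rule eqI) (simp flip: S add: add_l inner_add_left)
    show "S (r *\<^sub>R x) = r *\<^sub>R S x" for r x
      using S_scaleC[of "complex_of_real r" x] by (simp add: scaleC_of_real)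
  qed
  then have ap: "op_apply (Abs_bounded_op (Blinfun S)) = S"
    by (simp add: op_apply.rep_eq Abs_bounded_op_inverse bounded_linear_Blinfun_apply S_scaleC)
  show ?thesis
  proof (rule that)
    show "inner (op_apply (Abs_bounded_op (Blinfun S)) x) y = b x y" for x y
      by (simp add: ap S)
    show "norm (Abs_bounded_op (Blinfun S)) \<le> K"
      by (rule op_norm_leI) (use nS in \<open>simp_all add: ap K mult.commute\<close>)
  qed
qed

text \<open>Weak compactness of norm balls along \<omega>: each matrix coefficient has an
  ultralimit, and these limits inherit linearity and the bound, so they come from an
  operator.\<close>

lemma weak_limit_exists:
  fixes T :: "nat \<Rightarrow> 'h::complex_hilbert_space bounded_op"
  assumes \<omega>: "free_ultrafilter \<omega>" and T: "\<And>n. norm (T n) \<le> B"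
  obtains L where "weak_tendsto T L \<omega>" "norm L \<le> B"
proof -
  have B: "0 \<le> B" using T norm_ge_zero order_trans by blast
  have bd: "\<bar>inner (op_apply (T n) x) y\<bar> \<le> B * (norm x * norm y)" for n x y
  proof -
    have "\<bar>inner (op_apply (T n) x) y\<bar> \<le> norm (op_apply (T n) x) * norm y"
      by (rule Cauchy_Schwarz_ineq2)
    also have "\<dots> \<le> (B * norm x) * norm y"
      using T[of n] by (intro mult_right_mono order_trans[OF op_apply_norm_le]) auto
    finally show ?thesis by (simp add: mult.assoc)
  qed
  have "\<exists>l. ((\<lambda>n. inner (op_apply (T n) x) y) \<longlongrightarrow> l) \<omega>" for x y
  proof -
    have "inner (op_apply (T n) x) y \<in> cball 0 (B * (norm x * norm y))" for n
      using bd[of n x y] by simp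
    then show ?thesis using ultrafilter_compact_limit[OF \<omega> compact_cball] by metis
  qed
  then obtain b where b: "\<And>x y. ((\<lambda>n. inner (op_apply (T n) x) y) \<longlongrightarrow> b x y) \<omega>" by metis
  note uniq = tendsto_unique[OF free_ultrafilter_not_bot[OF \<omega>]]
  obtain L where L: "\<And>x y. inner (op_apply L x) y = b x y" "norm L \<le> B"
  proof (rule op_of_bounded_form)
    show "b (x + x') y = b x y + b x' y" for x x' y
      using uniq[OF b[of "x + x'" y]] tendsto_add[OF b[of x y] b[of x' y]]
      by (simp add: inner_add_left)
    show "b x (y + y') = b x y + b x y'" for x y y'
      using uniq[OF b[of x "y + y'"]] tendsto_add[OF b[of x y] b[of x y']]
      by (simp add: inner_add_right)
    show "b x (r *\<^sub>R y) = r * b x y" for r x y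
      using uniq[OF b[of x "r *\<^sub>R y"]] tendsto_mult_left[OF b[of x y], of r] by simp
    show "b (c *\<^sub>C x) y = b x (cnj c *\<^sub>C y)" for c x y
      using uniq[OF b[of "c *\<^sub>C x" y]] b[of x "cnj c *\<^sub>C y"]
      by (simp add: op_apply_scaleC inner_scaleC_left)
    show "\<bar>b x y\<bar> \<le> B * (norm x * norm y)" for x y
      by (rule tendsto_upperbound[OF tendsto_rabs[OF b]])
        (use bd free_ultrafilter_not_bot[OF \<omega>] in auto)
  qed (use B in auto)
  show ?thesis
    by (rule that[of L]) (simp_all add: weak_tendsto_def L b)
qed

section \<open>Weak and ultraweak convergence of norm-bounded families\<close>

lemma weak_tendsto_cinner:
  fixes T :: "'i \<Rightarrow> 'h::complex_hilbert_space bounded_op"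
  assumes "weak_tendsto T L F"
  shows "((\<lambda>n. cinner (op_apply (T n) x) y) \<longlongrightarrow> cinner (op_apply L x) y) F"
proof -
  have Im: "Im (cinner u v) = inner u (\<i> *\<^sub>C v)" for u v :: 'h
    by (simp flip: Re_cinner add: cinner_scaleC_right)
  show ?thesis
    using weak_tendstoD[OF assms] by (simp add: tendsto_complex_iff Im Re_cinner)
qed

lemma norm_cinner_le: "cmod (cinner x y) \<le> 2 * (norm x * norm (y::'h::complex_hilbert_space))"
proof -
  have "Im (cinner x y) = inner x (\<i> *\<^sub>C y)"
    by (simp flip: Re_cinner add: cinner_scaleC_right)
  then have "\<bar>Im (cinner x y)\<bar> \<le> norm x * norm y"
    using Cauchy_Schwarz_ineq2[of x "\<i> *\<^sub>C y"] by (simp add: norm_scaleC)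
  moreover have "\<bar>Re (cinner x y)\<bar> \<le> norm x * norm y"
    using Cauchy_Schwarz_ineq2[of x y] by (simp add: Re_cinner)
  ultimately show ?thesis using cmod_le[of "cinner x y"] by linarith
qed

text \<open>Weak convergence controls each term of the series defining an ultraweak functional. The
  norm bound yields a summable majorant independent of the index i, so Tannery's theorem exchanges
  limit and sum. Induction passes from the generating sets to all open sets.\<close>

lemma weak_tendsto_ultraweak:
  fixes T :: "'i \<Rightarrow> 'h::complex_hilbert_space bounded_op"
  assumes F: "F \<noteq> bot" and T: "weak_tendsto T L F" and B: "\<And>n. norm (T n) \<le> B"
  shows "limitin ultraweak_topology T L F"
proof -
  define \<S> where "\<S> = {{T :: 'h bounded_op. (\<Sum>n. cinner (op_apply T (\<xi> n)) (\<eta> n)) \<in> U} | \<xi> \<eta> U.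
        summable (\<lambda>n. (norm (\<xi> n))\<^sup>2) \<and> summable (\<lambda>n. (norm (\<eta> n))\<^sup>2) \<and> open (U :: complex set)}"
  have uw: "ultraweak_topology = topology_generated_by \<S>"
    by (simp add: ultraweak_topology_def \<S>_def)
  have lim: "((\<lambda>i. \<Sum>n. cinner (op_apply (T i) (\<xi> n)) (\<eta> n)) \<longlongrightarrow>
      (\<Sum>n. cinner (op_apply L (\<xi> n)) (\<eta> n))) F"
    if s: "summable (\<lambda>n. (norm (\<xi> n))\<^sup>2)" "summable (\<lambda>n. (norm (\<eta> n))\<^sup>2)" for \<xi> \<eta> :: "nat \<Rightarrow> 'h"
  proof -
    \<comment> \<open>The factor 2 of \<open>norm_cinner_le\<close> is absorbed by 2 s t <= s^2 +
      t^2.\<close>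
    define W where "W n = \<bar>B\<bar> * ((norm (\<xi> n))\<^sup>2 + (norm (\<eta> n))\<^sup>2)" for n
    have "norm (cinner (op_apply (T i) (\<xi> n)) (\<eta> n)) \<le> W n" for n i
    proof -
      have "norm (op_apply (T i) (\<xi> n)) \<le> \<bar>B\<bar> * norm (\<xi> n)"
        using B[of i] by (intro order_trans[OF op_apply_norm_le] mult_right_mono) auto
      then have "norm (op_apply (T i) (\<xi> n)) * norm (\<eta> n) \<le> \<bar>B\<bar> * norm (\<xi> n) * norm (\<eta> n)"
        by (intro mult_right_mono) auto
      then have "cmod (cinner (op_apply (T i) (\<xi> n)) (\<eta> n)) \<le> \<bar>B\<bar> * (2 * norm (\<xi> n) * norm (\<eta> n))"
        using norm_cinner_le[of "op_apply (T i) (\<xi> n)" "\<eta> n"] by simp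
      also have "\<dots> \<le> W n"
        unfolding W_def by (intro mult_left_mono sum_squares_bound) simp
      finally show ?thesis .
    qed
    then have "eventually (\<lambda>(n, i). norm (cinner (op_apply (T i) (\<xi> n)) (\<eta> n)) \<le> W n) (at_top \<times>\<^sub>F F)"
      by (intro always_eventually) auto
    moreover have "summable W"
      unfolding W_def by (intro summable_mult summable_add s)
    ultimately show ?thesis
      using tannerys_theorem[OF weak_tendsto_cinner[OF T] _ _ F] by blast
  qed
  have "eventually (\<lambda>i. T i \<in> U) F" if "generate_topology_on \<S> U" "L \<in> U" for U
    using that
  proof (induction rule: generate_topology_on.induct)
    case (Basis s)
    then obtain \<xi> \<eta> U where s: "s = {T. (\<Sum>n. cinner (op_apply T (\<xi> n)) (\<eta> n)) \<in> U}" "open U"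
      "summable (\<lambda>n. (norm (\<xi> n))\<^sup>2)" "summable (\<lambda>n. (norm (\<eta> n))\<^sup>2)"
      unfolding \<S>_def by blast
    then show ?case using topological_tendstoD[OF lim[of \<xi> \<eta>], of U] Basis(2) by simp
  next
    case (UN K)
    then show ?case by (metis (mono_tags, lifting) UnionE UnionI eventually_mono)
  qed (auto simp: eventually_conj)
  moreover have "L \<in> topspace ultraweak_topology"
  proof -
    have "UNIV = {T :: 'h bounded_op. (\<Sum>n. cinner (op_apply T 0) 0) \<in> UNIV}" by simp
    then have "UNIV \<in> \<S>"
      unfolding \<S>_def by (intro CollectI exI[of _ "\<lambda>_. 0"] exI[of _ UNIV]) simp
    then show ?thesis unfolding uw by auto
  qed
  ultimately show ?thesis
    by (simp add: limitin_def uw openin_topology_generated_by_iff)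
qed

subsection \<open>Faithful normal tracial states\<close>

lemma vna_self_adjoint_comb:
  fixes z :: "'h::complex_hilbert_space bounded_op"
  shows "z = (1/2) *\<^sub>R (z + adj z) + \<i> *\<^sub>C ((1/2) *\<^sub>R (\<i> *\<^sub>C (adj z - z)))"
    "adj (\<i> *\<^sub>C (adj z - z)) = \<i> *\<^sub>C (adj z - z)"
proof -
  have c: "\<i> *\<^sub>C (r *\<^sub>R T) = r *\<^sub>R (\<i> *\<^sub>C T)" for r and T :: "'h bounded_op"
    by (simp flip: scaleC_op_simps(6) add: scaleC_op_simps(4) mult.commute)
  show "z = (1/2) *\<^sub>R (z + adj z) + \<i> *\<^sub>C ((1/2) *\<^sub>R (\<i> *\<^sub>C (adj z - z)))"
    unfolding c scaleC_op_simps(4) using scaleC_op_simps(9)[of "adj z - z"]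
    by (simp flip: scaleR_add_right add: scaleR_2 flip: scaleR_right_distrib)
  have "- \<i> *\<^sub>C (z - adj z) = \<i> *\<^sub>C (adj z - z)"
    using scaleC_op_simps(4)[of "- \<i>" "-1" "adj z - z"] scaleC_op_simps(9)[of "adj z - z"] by simp
  then show "adj (\<i> *\<^sub>C (adj z - z)) = \<i> *\<^sub>C (adj z - z)"
    by simp
qed

locale tracial =
  fixes M :: "'h::complex_hilbert_space bounded_op set" and \<tau> :: "'h bounded_op \<Rightarrow> complex"
  assumes vna: "von_neumann_algebra M" and trace: "faithful_normal_tracial_state M \<tau>"
begin

lemmas closed [simp] = vna_closed[OF vna]

lemma power_closed [simp]: "x \<in> M \<Longrightarrow> x ^ n \<in> M"
  by (rule vna_power[OF vna])

lemma tau_add: "x \<in> M \<Longrightarrow> y \<in> M \<Longrightarrow> \<tau> (x + y) = \<tau> x + \<tau> y"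
  and tau_scaleC: "x \<in> M \<Longrightarrow> \<tau> (c *\<^sub>C x) = c * \<tau> x"
  and tau_one [simp]: "\<tau> 1 = 1"
  and tau_commute: "x \<in> M \<Longrightarrow> y \<in> M \<Longrightarrow> \<tau> (x * y) = \<tau> (y * x)"
  and tau_faithful_star: "x \<in> M \<Longrightarrow> \<tau> (adj x * x) = 0 \<Longrightarrow> x = 0"
  and tau_star: "x \<in> M \<Longrightarrow> \<tau> (adj x * x) \<in> \<real>\<^sub>\<ge>\<^sub>0"
  using trace
  by (auto simp: faithful_normal_tracial_state_def state_on_def linear_functional_on_def)

lemma tau_scaleR: "x \<in> M \<Longrightarrow> \<tau> (r *\<^sub>R x) = r * \<tau> x"
  using tau_scaleC[of x "of_real r"] by (simp add: scaleC_op_simps)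

lemma tau_minus: "x \<in> M \<Longrightarrow> \<tau> (- x) = - \<tau> x"
  using tau_scaleR[of x "-1"] by simp

lemma tau_zero [simp]: "\<tau> 0 = 0"
  using tau_minus[of 0] by simp

lemma tau_diff: "x \<in> M \<Longrightarrow> y \<in> M \<Longrightarrow> \<tau> (x - y) = \<tau> x - \<tau> y"
  using tau_add[of x "- y"] by (simp add: tau_minus)

lemma tau_star_Re: "x \<in> M \<Longrightarrow> 0 \<le> Re (\<tau> (adj x * x))"
  and tau_star_Im: "x \<in> M \<Longrightarrow> Im (\<tau> (adj x * x)) = 0"
  using tau_star by (simp_all add: complex_nonneg_Reals_iff)

text \<open>The trace of adj(x + c) (x + c) is real for every scalar c. The choices c = 1 and c =
  \<i> compare the imaginary and the real parts of \<tau>(x) and \<tau>(adj x).\<close>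

lemma tau_adj: assumes x: "x \<in> M" shows "\<tau> (adj x) = cnj (\<tau> x)"
proof -
  have *: "Im (cnj c * \<tau> x + c * \<tau> (adj x)) = 0" for c
  proof -
    have "adj (x + c *\<^sub>C 1) * (x + c *\<^sub>C 1)
        = adj x * x + (c *\<^sub>C adj x + (cnj c *\<^sub>C x + (c * cnj c) *\<^sub>C 1))"
      by (simp add: algebra_simps scaleC_op_simps)
    then have "\<tau> (adj (x + c *\<^sub>C 1) * (x + c *\<^sub>C 1))
        = \<tau> (adj x * x) + (c * \<tau> (adj x) + (cnj c * \<tau> x + c * cnj c))"
      using x by (simp add: tau_add tau_scaleC)
    then show ?thesis
      using tau_star_Im[OF x] tau_star_Im[of "x + c *\<^sub>C 1"] x by simp
  qed
  show ?thesis using *[of 1] *[of \<i>] by (simp add: complex_eq_iff)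
qed

text \<open>Without commutation x y need not be positive, but traciality turns its trace into that
  of adj(t s) (t s), with s and t the roots of x and y.\<close>

lemma tau_pos_mult:
  assumes "x \<in> M" "op_pos x" "y \<in> M" "op_pos y"
  shows "0 \<le> Re (\<tau> (x * y))" "Im (\<tau> (x * y)) = 0"
proof -
  obtain s where s: "s \<in> M" "op_pos s" "s * s = x" using vna_sqrt[OF vna assms(1,2)] by metis
  obtain t where t: "t \<in> M" "op_pos t" "t * t = y" using vna_sqrt[OF vna assms(3,4)] by metis
  have "\<tau> (x * y) = \<tau> (s * (s * t * t))" by (simp only: mult.assoc flip: s(3) t(3))
  also have "\<dots> = \<tau> ((s * t * t) * s)" using s t by (intro tau_commute) auto
  also have "\<dots> = \<tau> (adj (t * s) * (t * s))"
    using s(2) t(2) by (simp add: op_pos_adj mult.assoc)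
  finally show "0 \<le> Re (\<tau> (x * y))" "Im (\<tau> (x * y)) = 0"
    using tau_star_Re[of "t * s"] tau_star_Im[of "t * s"] s t by simp_all
qed

lemma tau_pos: "x \<in> M \<Longrightarrow> op_pos x \<Longrightarrow> 0 \<le> Re (\<tau> x)"
  using tau_pos_mult(1)[of x 1] by (simp add: op_pos_one)

lemma tau_faithful:
  assumes "x \<in> M" "op_pos x" "Re (\<tau> x) = 0"
  shows "x = 0"
proof -
  obtain s where s: "s \<in> M" "op_pos s" "s * s = x" using vna_sqrt[OF vna assms(1,2)] by metis
  have "s = 0"
  proof (rule tau_faithful_star)
    show "\<tau> (adj s * s) = 0"
      using tau_star_Im[of s] s assms(3) by (simp add: op_pos_adj complex_eq_iff)
  qed (rule s)
  then show ?thesis using s by simp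
qed

lemma tau_Cauchy_Schwarz:
  assumes x: "x \<in> M" and y: "y \<in> M"
  shows "(Re (\<tau> (adj y * x)))\<^sup>2 \<le> Re (\<tau> (adj x * x)) * Re (\<tau> (adj y * y))"
proof (rule discriminant_le)
  fix t :: real
  have sym: "Re (\<tau> (adj x * y)) = Re (\<tau> (adj y * x))"
    using tau_adj[of "adj y * x"] x y by simp
  have "adj (x + t *\<^sub>R y) * (x + t *\<^sub>R y)
      = adj x * x + (t *\<^sub>R (adj x * y) + (t *\<^sub>R (adj y * x) + t\<^sup>2 *\<^sub>R (adj y * y)))"
    by (simp add: algebra_simps power2_eq_square)
  then have "Re (\<tau> (adj (x + t *\<^sub>R y) * (x + t *\<^sub>R y)))
      = Re (\<tau> (adj x * x)) + 2 * t * Re (\<tau> (adj y * x)) + t\<^sup>2 * Re (\<tau> (adj y * y))"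
    using x y by (simp add: tau_add tau_scaleR sym)
  then show "0 \<le> Re (\<tau> (adj x * x)) + 2 * t * Re (\<tau> (adj y * x)) + t\<^sup>2 * Re (\<tau> (adj y * y))"
    using tau_star_Re[of "x + t *\<^sub>R y"] x y by simp
qed (rule tau_star_Re[OF y])

text \<open>Conjugate the positive operator |y|^2 - adj y y by x and take the trace. This bound
  makes the null sequences a left ideal.\<close>

lemma tau_star_le:
  assumes x: "x \<in> M" and y: "y \<in> M"
  shows "Re (\<tau> (adj (y * x) * (y * x))) \<le> (norm y)\<^sup>2 * Re (\<tau> (adj x * x))"
proof -
  let ?z = "(norm y)\<^sup>2 *\<^sub>R 1 - adj y * y"
  have "op_pos ?z"
    using norm_mult_ineq[of "adj y" y] by (intro op_pos_norm_diff) (auto simp: power2_eq_square)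
  then have "0 \<le> Re (\<tau> (adj x * ?z * x))"
    using x y by (intro tau_pos op_pos_conj) auto
  also have "adj x * ?z * x = (norm y)\<^sup>2 *\<^sub>R (adj x * x) - adj (y * x) * (y * x)"
    by (simp add: algebra_simps)
  finally show ?thesis using x y by (simp add: tau_diff tau_scaleR)
qed

lemma tau_star_norm_le: "x \<in> M \<Longrightarrow> Re (\<tau> (adj x * x)) \<le> (norm x)\<^sup>2"
  using tau_star_le[of 1 x] by simp

text \<open>The variance of x, the squared 2-norm of x - \<tau>(x), is nonnegative.\<close>

lemma cmod_tau_le: assumes x: "x \<in> M" shows "(cmod (\<tau> x))\<^sup>2 \<le> Re (\<tau> (adj x * x))"
proof -
  let ?c = "\<tau> x"
  have "adj (x - ?c *\<^sub>C 1) * (x - ?c *\<^sub>C 1)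
      = adj x * x - (?c *\<^sub>C adj x + (cnj ?c *\<^sub>C x - (?c * cnj ?c) *\<^sub>C 1))"
    by (simp add: algebra_simps scaleC_op_simps)
  then have "Re (\<tau> (adj (x - ?c *\<^sub>C 1) * (x - ?c *\<^sub>C 1))) = Re (\<tau> (adj x * x)) - Re (?c * cnj ?c)"
    using x by (simp add: tau_add tau_diff tau_scaleC tau_adj)
  then show ?thesis
    using tau_star_Re[of "x - ?c *\<^sub>C 1"] x by (simp add: complex_mult_cnj cmod_power2)
qed

lemma cmod_tau_norm_le: "x \<in> M \<Longrightarrow> cmod (\<tau> x) \<le> norm x"
  using cmod_tau_le tau_star_norm_le by (meson norm_ge_zero order_trans power2_le_imp_le)

text \<open>Normality enters here: the norm bound upgrades weak to ultraweak convergence, for which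
  \<tau> is continuous on M.\<close>

lemma tau_weak_limit:
  assumes F: "F \<noteq> bot" and T: "weak_tendsto T L F" "\<And>n. norm (T n) \<le> B" "\<And>n. T n \<in> M"
  shows "((\<lambda>n. \<tau> (T n)) \<longlongrightarrow> \<tau> L) F"
proof -
  have L: "L \<in> M" using vna_weak_limit[OF vna F T(1,3)] .
  have "continuous_map (subtopology ultraweak_topology M) euclidean \<tau>"
    using trace by (simp add: faithful_normal_tracial_state_def normal_functional_def)
  moreover have "limitin (subtopology ultraweak_topology M) T L F"
    using weak_tendsto_ultraweak[OF F T(1,2)] L T(3) by (simp add: limitin_subtopology)
  ultimately show ?thesis
    using continuous_map_limit[of _ euclidean \<tau>] by (fastforce simp: o_def)
qed

end

subsection \<open>The unit interval of an abelian subalgebra\<close>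

lemma free_ultrafilter_le_sequentially:
  assumes "free_ultrafilter \<omega>" shows "\<omega> \<le> sequentially"
proof (rule filter_leI)
  fix P assume "eventually P sequentially"
  then obtain N where N: "\<And>n. n \<ge> N \<Longrightarrow> P n" by (auto simp: eventually_sequentially)
  have "eventually (\<lambda>n. \<forall>k\<in>{..<N}. n \<noteq> k) \<omega>"
    using assms by (intro eventually_ball_finite) (auto simp: free_ultrafilter_def)
  then show "eventually P \<omega>"
    by eventually_elim (use N not_le in blast)
qed

text \<open>A self-adjoint a of norm c > 0 equals c (2k - 1) with k = (1 + a/c)/2 between 0 and 1,
  and every operator is a complex combination of two self-adjoint ones. Linear claims thus reduce to
  the case 0 <= a <= 1.\<close>

lemma vna_unit_induct [consumes 2, case_names unit add scaleC]:
  assumes B: "von_neumann_algebra B" and z: "z \<in> B"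
    and unit: "\<And>a. a \<in> B \<Longrightarrow> op_pos a \<Longrightarrow> op_pos (1 - a) \<Longrightarrow> P a"
    and add: "\<And>x y. x \<in> B \<Longrightarrow> y \<in> B \<Longrightarrow> P x \<Longrightarrow> P y \<Longrightarrow> P (x + y)"
    and scaleC: "\<And>c x. x \<in> B \<Longrightarrow> P x \<Longrightarrow> P (c *\<^sub>C x)"
  shows "P z"
proof -
  note cl = vna_closed[OF B]
  have scaleR: "P (r *\<^sub>R x)" if "x \<in> B" "P x" for r x
    using scaleC[OF that, of "of_real r"] by (simp add: scaleC_op_simps)
  have sa: "P a" if a: "a \<in> B" "adj a = a" for a
  proof (cases "a = 0")
    case True
    then show ?thesis using unit[of 0] cl by (simp add: op_pos_zero op_pos_one)
  next
    case False
    define c where "c = norm a"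
    have c: "0 < c" using False by (simp add: c_def)
    define b where "b = (1/c) *\<^sub>R a"
    have b: "b \<in> B" "adj b = b" "norm b \<le> 1" using a c cl by (auto simp: b_def c_def)
    define k where "k = (1/2) *\<^sub>R (1 + b)"
    have "op_pos k"
      using op_pos_norm_diff[of "- b" 1] b by (auto simp: k_def intro!: op_pos_scaleR)
    moreover have "1 - k = (1/2) *\<^sub>R (1 - b)"
      using scaleR_left.add[of "1/2" "1/2" "1 :: 'a bounded_op"] by (simp add: k_def algebra_simps)
    then have "op_pos (1 - k)"
      using op_pos_norm_diff[of b 1] b by (auto intro!: op_pos_scaleR)
    ultimately have "P k" using b cl by (intro unit) (auto simp: k_def)
    moreover have "P 1" using unit[of 1] cl by (simp add: op_pos_zero op_pos_one)
    moreover have "k \<in> B" using b cl by (simp add: k_def)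
    ultimately have "P (c *\<^sub>R (2 *\<^sub>R k + (-1) *\<^sub>R 1))"
      by (intro scaleR add cl)
    then show ?thesis using c by (simp add: k_def b_def)
  qed
  have "P ((1/2) *\<^sub>R (z + adj z) + \<i> *\<^sub>C ((1/2) *\<^sub>R (\<i> *\<^sub>C (adj z - z))))"
    using z vna_self_adjoint_comb(2)[of z]
    by (intro add scaleR scaleC sa cl) (auto simp: add.commute)
  then show ?thesis by (simp flip: vna_self_adjoint_comb(1))
qed

locale tracial_abelian = tracial M \<tau>
  for M :: "'h::complex_hilbert_space bounded_op set" and \<tau> +
  fixes A :: "'h bounded_op set" and \<omega> :: "nat filter"
  assumes subalgebra: "von_neumann_subalgebra A M" and abelian_A: "abelian A"
    and ultra: "free_ultrafilter \<omega>"
begin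

lemma vna_A: "von_neumann_algebra A" and A_subset: "A \<subseteq> M"
  using subalgebra by (auto simp: von_neumann_subalgebra_def)

lemmas A_closed [simp] = vna_closed[OF vna_A]

lemma A_power [simp]: "a \<in> A \<Longrightarrow> a ^ n \<in> A"
  by (rule vna_power[OF vna_A])

lemma A_M [simp]: "a \<in> A \<Longrightarrow> a \<in> M"
  using A_subset by blast

lemma A_commute: "a \<in> A \<Longrightarrow> b \<in> A \<Longrightarrow> a * b = b * a"
  using abelian_A by (auto simp: abelian_def)

lemma A_left_commute: "a \<in> A \<Longrightarrow> b \<in> A \<Longrightarrow> a * (b * c) = b * (a * c)"
  by (metis A_commute mult.assoc)

lemma \<omega>_nontrivial [simp]: "\<omega> \<noteq> bot"
  using ultra by (rule free_ultrafilter_not_bot)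

lemma A_pos_mult: "a \<in> A \<Longrightarrow> b \<in> A \<Longrightarrow> op_pos a \<Longrightarrow> op_pos b \<Longrightarrow> op_pos (a * b)"
  by (rule op_pos_mult) (auto simp: A_commute)

definition unit_interval :: "'h bounded_op set" where
  "unit_interval = {a \<in> A. op_pos a \<and> op_pos (1 - a)}"

lemma unit_interval_A: "a \<in> unit_interval \<Longrightarrow> a \<in> A"
  and unit_interval_pos: "a \<in> unit_interval \<Longrightarrow> op_pos a"
  and unit_interval_compl: "a \<in> unit_interval \<Longrightarrow> 1 - a \<in> unit_interval"
  and unit_interval_one: "1 \<in> unit_interval"
  by (auto simp: unit_interval_def op_pos_one op_pos_zero)

lemma unit_interval_mult:
  assumes "a \<in> unit_interval" "b \<in> unit_interval" shows "a * b \<in> unit_interval"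
proof -
  have "op_pos (a * b)" "op_pos (a * (1 - b))"
    using assms by (auto simp: unit_interval_def intro!: A_pos_mult)
  moreover have "op_pos ((1 - a) + a * (1 - b))"
    using assms calculation by (auto simp: unit_interval_def intro: op_pos_add)
  then have "op_pos (1 - a * b)" by (simp add: right_diff_distrib)
  ultimately show ?thesis using assms by (auto simp: unit_interval_def)
qed

lemma unit_interval_power: "a \<in> unit_interval \<Longrightarrow> a ^ n \<in> unit_interval"
  by (induction n) (auto intro: unit_interval_mult unit_interval_one)

lemma unit_interval_norm: "a \<in> unit_interval \<Longrightarrow> norm a \<le> 1"
  by (rule op_pos_norm_le) (auto simp: unit_interval_def)

lemma unit_interval_weak_limit:
  assumes "\<And>n. a n \<in> unit_interval"
  obtains b where "b \<in> unit_interval" "weak_tendsto a b \<omega>"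
proof -
  obtain b where b: "weak_tendsto a b \<omega>"
    using weak_limit_exists[OF ultra] unit_interval_norm[OF assms] by blast
  have "b \<in> A" using assms by (intro vna_weak_limit[OF vna_A _ b]) (auto simp: unit_interval_A)
  moreover have "op_pos b"
    using assms by (intro weak_tendsto_op_pos[OF _ b]) (auto simp: unit_interval_pos)
  moreover have "op_pos (1 - b)"
    using assms by (intro weak_tendsto_op_pos[OF _ weak_tendsto_diff[OF weak_tendsto_const b]])
      (auto simp: unit_interval_def)
  ultimately show ?thesis using b that by (auto simp: unit_interval_def)
qed

text \<open>The terms \<open>\<tau>(a(1-a)\<^sup>k c)\<close> decrease in \<open>k\<close>, and the sum of the first \<open>n + 1\<close> of them
  telescopes to at most \<open>\<tau>(c) \<le> 1\<close>.\<close>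

lemma tau_decay:
  assumes a: "a \<in> unit_interval" and c: "c \<in> unit_interval"
  shows "Re (\<tau> (a * (1 - a) ^ n * c)) \<le> 1 / (real n + 1)"
proof -
  let ?b = "1 - a"
  note [simp] = unit_interval_A
  have [simp]: "?b \<in> unit_interval" "?b ^ n \<in> unit_interval" for n
    using a by (auto intro: unit_interval_power unit_interval_compl)
  define t where "t k = Re (\<tau> (a * ?b ^ k * c))" for k
  have dec: "t (Suc k) \<le> t k" for k
  proof -
    have "op_pos (a * ?b ^ k * c * a)"
      using a c by (intro unit_interval_pos unit_interval_mult) auto
    then have "0 \<le> Re (\<tau> (a * ?b ^ k * c * a))" using a c by (intro tau_pos) auto
    also have "a * ?b ^ k * c * a = a * ?b ^ k * c - a * ?b ^ Suc k * c"
    proof -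
      have "a * ?b ^ k * c * a = (a * ?b ^ k) * a * c"
        using a c by (simp add: mult.assoc A_commute[of c a])
      also have "a * ?b ^ k * a = a * ?b ^ k - a * ?b ^ k * ?b" by (simp add: algebra_simps)
      finally show ?thesis by (simp add: left_diff_distrib power_commutes mult.assoc)
    qed
    finally show ?thesis using a c by (simp add: t_def tau_diff)
  qed
  have t_ge: "t n \<le> t k" if "k \<le> n" for k n
    using that by (induction rule: dec_induct) (auto intro: order_trans[OF dec])
  have sum: "(\<Sum>k<m. t k) = Re (\<tau> c) - Re (\<tau> (?b ^ m * c))" for m
  proof (induction m)
    case (Suc m)
    have "?b ^ m * c - ?b ^ Suc m * c = a * ?b ^ m * c" by (simp add: algebra_simps)
    then have "t m = Re (\<tau> (?b ^ m * c - ?b ^ Suc m * c))" by (simp only: t_def)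
    also have "\<dots> = Re (\<tau> (?b ^ m * c)) - Re (\<tau> (?b ^ Suc m * c))"
      using a c by (subst tau_diff) auto
    finally show ?case using Suc by simp
  qed simp
  have "real (Suc n) * t n = (\<Sum>k<Suc n. t n)" by simp
  also have "\<dots> \<le> (\<Sum>k<Suc n. t k)" by (intro sum_mono t_ge) auto
  also have "\<dots> \<le> Re (\<tau> c)"
    using tau_pos[of "?b ^ Suc n * c"] unit_interval_mult[of "?b ^ Suc n" c] c
    unfolding sum by (simp add: unit_interval_pos del: power_Suc)
  also have "\<dots> \<le> 1"
    using tau_pos[of "1 - c"] unit_interval_pos[OF unit_interval_compl[OF c]] c by (simp add: tau_diff)
  finally show ?thesis by (simp add: t_def field_simps)
qed

section \<open>Projections of \<open>A\<close> and binary digits\<close>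

text \<open>On [0,1] the powers (1 - t)^n tend to the indicator of {0}, so e projects onto the
  kernel of y. \<open>tau_decay\<close> and faithfulness give y e = 0; an operator z with y z = 0 is
  fixed by every power of 1 - y, hence by e.\<close>

lemma kernel_projection:
  assumes y: "y \<in> unit_interval"
  obtains e where "e \<in> projections A" "y * e = 0" "\<And>z. y * z = 0 \<Longrightarrow> e * z = z"
proof -
  let ?b = "1 - y"
  have bn: "?b ^ n \<in> unit_interval" for n
    using y by (intro unit_interval_power unit_interval_compl)
  obtain e where e: "e \<in> unit_interval" and lim: "weak_tendsto (\<lambda>n. ?b ^ n) e \<omega>"
    by (rule unit_interval_weak_limit[of "\<lambda>n. ?b ^ n"]) (auto intro: bn)
  note [simp] = unit_interval_A[OF y] unit_interval_A[OF e] unit_interval_A[OF bn]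
  have lim_y: "weak_tendsto (\<lambda>n. y * ?b ^ n) (y * e) \<omega>" by (rule weak_tendsto_mult_left[OF lim])
  have pos: "op_pos (y * ?b ^ n)" "norm (y * ?b ^ n) \<le> 1" for n
    using unit_interval_mult[OF y bn] by (auto simp: unit_interval_pos unit_interval_norm)
  have "y * e = 0"
  proof (rule tau_faithful)
    have "((\<lambda>n. Re (\<tau> (y * ?b ^ n))) \<longlongrightarrow> Re (\<tau> (y * e))) \<omega>"
      by (intro tendsto_Re tau_weak_limit[OF _ lim_y pos(2)]) auto
    moreover have "((\<lambda>n. Re (\<tau> (y * ?b ^ n))) \<longlongrightarrow> 0) \<omega>"
    proof (rule tendsto_sandwich[where f = "\<lambda>_. 0"])
      show "((\<lambda>n. 1 / (real n + 1)) \<longlongrightarrow> 0) \<omega>"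
        using LIMSEQ_inverse_real_of_nat free_ultrafilter_le_sequentially[OF ultra]
        by (auto simp: inverse_eq_divide add.commute intro: tendsto_mono)
    qed (use tau_decay[OF y unit_interval_one] pos in \<open>auto intro!: tau_pos always_eventually\<close>)
    ultimately show "Re (\<tau> (y * e)) = 0" using tendsto_unique[OF \<omega>_nontrivial] by blast
    show "op_pos (y * e)" by (rule unit_interval_pos[OF unit_interval_mult[OF y e]])
  qed simp
  moreover have "e * z = z" if "y * z = 0" for z
  proof -
    have "?b ^ n * z = z" for n
      by (induction n) (simp_all add: mult.assoc left_diff_distrib that)
    then have "weak_tendsto (\<lambda>n. z) (e * z) \<omega>"
      using weak_tendsto_mult_right[OF lim, of z] by simp
    then show ?thesis using weak_tendsto_unique[OF \<omega>_nontrivial _ weak_tendsto_const] by blast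
  qed
  \<comment> \<open>Idempotence is the case z = e of the preceding claim.\<close>
  moreover from calculation have "e \<in> projections A"
    by (simp add: projections_def op_pos_adj unit_interval_pos[OF e])
  ultimately show ?thesis using that by blast
qed

lemma projection_pos: "p \<in> projections A \<Longrightarrow> op_pos p"
  using op_pos_square[of p] by (simp add: projections_def)

lemma projection_compl: "p \<in> projections A \<Longrightarrow> 1 - p \<in> projections A"
  by (simp add: projections_def algebra_simps)

text \<open>p is the first binary digit of h. With k = h - 1/2 and s = |k|, the operator d = s + k
  is twice the positive part of k, e projects onto the kernel of d, and p = 1 - e. Under p one has k
  = s, so the remainder 2h - 1 equals 2s >= 0; under e one has k = -s, so the remainder 2h satisfies
  1 - 2h = 2s >= 0.\<close>

lemma dyadic_step:
  assumes h: "h \<in> unit_interval"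
  obtains p where "p \<in> projections A" "2 *\<^sub>R h - p \<in> unit_interval"
proof -
  define k where "k = h - (1/2) *\<^sub>R 1"
  have hA [simp]: "h \<in> A" using h by (rule unit_interval_A)
  have k [simp]: "k \<in> A" by (simp add: k_def)
  have adjk: "adj k = k" using h by (simp add: k_def op_pos_adj unit_interval_pos)
  obtain s where s: "s \<in> A" "op_pos s" "s * s = k * k"
    using vna_sqrt[OF vna_A _ op_pos_square[of k]] adjk by (metis A_closed(5) k)
  note [simp] = s(1)
  define d where "d = s + k"
  have d [simp]: "d \<in> A" "adj d = d" using s by (simp_all add: d_def op_pos_adj adjk)
  have prod: "d * (s - k) = 0"
    using s(3) A_commute[of k s] by (simp add: d_def algebra_simps)
  \<comment> \<open>The summand 1 keeps c positive when d = 0. Dividing by c moves the square of d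
    into the unit interval without changing its kernel.\<close>
  define c where "c = norm (d * d) + 1"
  have c: "0 < c" "norm (d * d) \<le> c" by (simp_all add: c_def add_nonneg_pos)
  define y where "y = (1/c) *\<^sub>R (d * d)"
  have "y \<in> unit_interval"
  proof -
    have "op_pos y" using op_pos_square[of d] c by (auto simp: y_def intro: op_pos_scaleR)
    moreover have "op_pos ((1/c) *\<^sub>R (c *\<^sub>R 1 - d * d))"
      using c by (intro op_pos_scaleR op_pos_norm_diff) auto
    moreover have "(1/c) *\<^sub>R (c *\<^sub>R 1 - d * d) = 1 - y" using c by (simp add: y_def algebra_simps)
    ultimately show ?thesis by (simp add: unit_interval_def y_def)
  qed
  then obtain e where e: "e \<in> projections A" "y * e = 0" "\<And>z. y * z = 0 \<Longrightarrow> e * z = z"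
    using kernel_projection by metis
  then have eA [simp]: "e \<in> A" by (simp add: projections_def)
  have "d * d * e = 0" using e(2) c by (simp add: y_def)
  \<comment> \<open>adj(d e) (d e) = e d d e = 0.\<close>
  then have "d * e = 0"
    using e(1) by (intro tau_faithful_star)
      (simp_all add: projections_def mult.assoc)
  then have ke: "k * e = - (s * e)" by (simp add: d_def distrib_right add_eq_0_iff)
  \<comment> \<open>s - k is twice the negative part of k; d annihilates it, so it lives under
    e.\<close>
  have "e * (s - k) = s - k"
    using prod by (intro e(3)) (simp add: y_def mult.assoc)
  then have kp: "k * (1 - e) = s * (1 - e)"
    using A_commute[of e s] A_commute[of e k] by (simp add: algebra_simps)
  define p where "p = 1 - e"
  have p: "p \<in> projections A" and pA [simp]: "p \<in> A"
    using e(1) projection_compl by (auto simp: p_def)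
  have pos: "op_pos p" "op_pos e" using p e(1) projection_pos by auto
  have hk: "2 *\<^sub>R h = 2 *\<^sub>R k + 1" by (simp add: k_def algebra_simps)
  have h_mult: "2 *\<^sub>R (h * z) = 2 *\<^sub>R (k * z) + z" for z
    using arg_cong[OF hk, of "\<lambda>u. u * z"] by (simp add: distrib_right)
  have split: "2 *\<^sub>R h = 2 *\<^sub>R (h * p) + 2 *\<^sub>R (h * e)"
    by (simp add: p_def right_diff_distrib scaleR_diff_right)
  have hp: "2 *\<^sub>R (h * p) = 2 *\<^sub>R (s * p) + p" using kp by (simp add: h_mult p_def)
  have he: "2 *\<^sub>R (h * e) = e - 2 *\<^sub>R (s * e)" by (simp add: h_mult ke)
  have pe: "1 = p + e" by (simp add: p_def)
  have "2 *\<^sub>R h - p = 2 *\<^sub>R (s * p) + 2 *\<^sub>R (h * e)"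
    unfolding split hp by simp
  moreover have "op_pos (2 *\<^sub>R (s * p) + 2 *\<^sub>R (h * e))"
    using pos s h by (intro op_pos_add op_pos_scaleR A_pos_mult) (auto simp: unit_interval_pos)
  moreover have "1 - (2 *\<^sub>R h - p) = 2 *\<^sub>R ((1 - h) * p) + 2 *\<^sub>R (s * e)"
  proof -
    have "2 *\<^sub>R ((1 - h) * p) = p + p - 2 *\<^sub>R (h * p)"
      by (simp add: left_diff_distrib scaleR_diff_right scaleR_2)
    then show ?thesis unfolding split he by (subst pe) (simp add: algebra_simps)
  qed
  moreover have "op_pos (2 *\<^sub>R ((1 - h) * p) + 2 *\<^sub>R (s * e))"
    using pos s unit_interval_pos[OF unit_interval_compl[OF h]]
    by (intro op_pos_add op_pos_scaleR A_pos_mult) auto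
  ultimately have "2 *\<^sub>R h - p \<in> unit_interval" by (simp add: unit_interval_def)
  with p show ?thesis by (rule that)
qed

text \<open>Passing from h to 2h - p doubles the commutator with w, because w commutes with the
  digit p, while on the unit interval every commutator with w has norm at most 2 |w|. After n digits
  the commutator of w and h is bounded by 2 |w| / 2^n.\<close>

lemma commute_projections_imp_commute:
  assumes w: "\<And>p. p \<in> projections A \<Longrightarrow> w * p = p * w" and "a \<in> A"
  shows "w * a = a * w"
  using vna_A assms(2)
proof (induction rule: vna_unit_induct)
  case (unit a)
  have *: "norm (w * h - h * w) \<le> (2 * norm w) / 2 ^ n" if "h \<in> unit_interval" for h n
    using that
  proof (induction n arbitrary: h)
    case 0
    have "norm (w * h) \<le> norm w" "norm (h * w) \<le> norm w"
      using norm_mult_ineq[of w h] norm_mult_ineq[of h w] unit_interval_norm[OF 0]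
        mult_left_le[of "norm h" "norm w"] by (auto simp: mult.commute)
    then show ?case using norm_triangle_ineq4[of "w * h" "h * w"] by simp
  next
    case (Suc n)
    obtain p where p: "p \<in> projections A" "2 *\<^sub>R h - p \<in> unit_interval"
      using dyadic_step[OF Suc.prems] .
    let ?h = "2 *\<^sub>R h - p"
    have "2 *\<^sub>R (w * h - h * w) = w * ?h - ?h * w"
      using w[OF p(1)] by (simp add: algebra_simps)
    then have "2 * norm (w * h - h * w) = norm (w * ?h - ?h * w)"
      by (metis abs_numeral norm_scaleR)
    then show ?case using Suc.IH[OF p(2)] by simp
  qed
  have "(\<lambda>n. (2 * norm w) / 2 ^ n) \<longlonglongrightarrow> 0"
    by (rule LIMSEQ_divide_realpow_zero) simp
  then have "norm (w * a - a * w) \<le> 0"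
    by (rule LIMSEQ_le_const) (use *[of a] unit in \<open>simp add: unit_interval_def\<close>)
  then show ?case by simp
next
  case (add x y)
  then show ?case by (simp add: distrib_left distrib_right)
next
  case (scaleC c x)
  then show ?case by (simp only: scaleC_op_simps(1,2))
qed

end

subsection \<open>The conditional expectation onto an abelian subalgebra\<close>

context tracial_abelian
begin

lemma unit_intervalI: "a \<in> A \<Longrightarrow> op_pos a \<Longrightarrow> op_pos (1 - a) \<Longrightarrow> a \<in> unit_interval"
  by (simp add: unit_interval_def)

text \<open>The expectation of \<open>x\<close> with \<open>0 \<le> x \<le> 1\<close> is the point of the unit interval of \<open>A\<close>
  nearest to \<open>x\<close> in the 2-norm. Weak compactness provides it, and the variational inequality in the
  directions \<open>-ac\<close> and \<open>(1-a)c\<close> characterises it.\<close>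

lemma nearest_point_exists:
  assumes x: "x \<in> M"
  obtains a where "a \<in> unit_interval"
    "\<And>b. b \<in> unit_interval \<Longrightarrow> Re (\<tau> (adj (x - a) * (x - a))) \<le> Re (\<tau> (adj (x - b) * (x - b)))"
proof -
  define f where "f a = Re (\<tau> (adj (x - a) * (x - a)))" for a
  define m where "m = Inf (f ` unit_interval)"
  have f_nonneg: "0 \<le> f b" if "b \<in> unit_interval" for b
    unfolding f_def using that x by (intro tau_star_Re) (auto simp: unit_interval_A)
  have bdd: "bdd_below (f ` unit_interval)"
    using f_nonneg by (intro bdd_belowI[of _ 0]) auto
  have m: "m \<le> f b" if "b \<in> unit_interval" for b
    unfolding m_def using bdd that by (intro cInf_lower) auto
  have "\<exists>b\<in>unit_interval. f b < m + inverse (real (Suc n))" for n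
    using cInf_lessD[of "f ` unit_interval" "m + inverse (real (Suc n))"] unit_interval_one
    by (auto simp: m_def)
  then obtain X where X: "\<And>n. X n \<in> unit_interval" "\<And>n. f (X n) < m + inverse (real (Suc n))"
    by metis
  obtain a where a: "a \<in> unit_interval" "weak_tendsto X a \<omega>"
    by (rule unit_interval_weak_limit[of X]) (auto intro: X)
  note [simp] = unit_interval_A[OF X(1)] unit_interval_A[OF a(1)] x
  \<comment> \<open>The 2-norm is only lower semicontinuous under weak limits. Pairing with the
    fixed x - a is continuous, and Cauchy-Schwarz then gives f(a)^2 <= f(a) m.\<close>
  have lim: "((\<lambda>n. Re (\<tau> (adj (x - a) * (x - X n)))) \<longlongrightarrow> f a) \<omega>"
    unfolding f_def
  proof (intro tendsto_Re tau_weak_limit)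
    show "weak_tendsto (\<lambda>n. adj (x - a) * (x - X n)) (adj (x - a) * (x - a)) \<omega>"
      by (intro weak_tendsto_mult_left weak_tendsto_diff weak_tendsto_const a)
    show "norm (adj (x - a) * (x - X n)) \<le> norm (x - a) * (norm x + 1)" for n
    proof -
      have "norm (x - X n) \<le> norm x + 1"
        using norm_triangle_ineq4[of x "X n"] unit_interval_norm[OF X(1), of n] by simp
      then have "norm (adj (x - a)) * norm (x - X n) \<le> norm (x - a) * (norm x + 1)"
        unfolding op_norm_adj by (rule mult_left_mono) simp
      then show ?thesis using norm_mult_ineq order_trans by blast
    qed
  qed auto
  have "((\<lambda>n. m + inverse (real (Suc n))) \<longlongrightarrow> m + 0) \<omega>"
    using LIMSEQ_inverse_real_of_nat free_ultrafilter_le_sequentially[OF ultra]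
    by (intro tendsto_intros) (auto intro: tendsto_mono)
  then have "((\<lambda>n. f a * (m + inverse (real (Suc n)))) \<longlongrightarrow> f a * m) \<omega>"
    by (intro tendsto_mult_left) simp
  moreover have "(Re (\<tau> (adj (x - a) * (x - X n))))\<^sup>2 \<le> f a * (m + inverse (real (Suc n)))" for n
  proof -
    have "(Re (\<tau> (adj (x - a) * (x - X n))))\<^sup>2 \<le> f (X n) * f a"
      unfolding f_def by (rule tau_Cauchy_Schwarz) auto
    also have "\<dots> \<le> (m + inverse (real (Suc n))) * f a"
      using X(2)[of n] f_nonneg[OF a(1)] by (intro mult_right_mono) auto
    finally show ?thesis by (simp only: mult.commute)
  qed
  ultimately have "(f a)\<^sup>2 \<le> f a * m"
    using tendsto_le[OF \<omega>_nontrivial _ tendsto_power[OF lim, of 2]] by simp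
  moreover have "0 \<le> f a" by (rule f_nonneg[OF a(1)])
  moreover have "0 \<le> m"
    unfolding m_def using f_nonneg unit_interval_one by (intro cInf_greatest) auto
  ultimately have "f a \<le> m"
    by (metis antisym_conv2 less_eq_real_def mult_le_cancel_left_pos power2_eq_square)
  then show ?thesis using that[OF a(1)] m order_trans unfolding f_def by blast
qed

text \<open>First-order condition: along the segment a + t c the squared distance changes by -2 t p
  + t^2 g, so p > 0 would decrease it for small t.\<close>

lemma nearest_point_variational:
  assumes x: "x \<in> M" "adj x = x" and a: "a \<in> unit_interval" and c: "c \<in> A" "adj c = c"
    and min: "\<And>t. 0 \<le> t \<Longrightarrow> t \<le> 1 \<Longrightarrow>
      Re (\<tau> (adj (x - a) * (x - a))) \<le> Re (\<tau> (adj (x - (a + t *\<^sub>R c)) * (x - (a + t *\<^sub>R c))))"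
  shows "Re (\<tau> ((x - a) * c)) \<le> 0"
proof (rule ccontr)
  define p where "p = Re (\<tau> ((x - a) * c))"
  define g where "g = Re (\<tau> (c * c))"
  note [simp] = unit_interval_A[OF a] op_pos_adj[OF unit_interval_pos[OF a]]
  have main: "2 * t * p \<le> t\<^sup>2 * g" if t: "0 \<le> t" "t \<le> 1" for t
  proof -
    let ?y = "x - a"
    have "(?y - t *\<^sub>R c) * (?y - t *\<^sub>R c) = ?y * ?y - t *\<^sub>R (?y * c) - t *\<^sub>R (c * ?y) + t\<^sup>2 *\<^sub>R (c * c)"
      by (simp add: algebra_simps power2_eq_square)
    moreover have "\<tau> (c * ?y) = \<tau> (?y * c)" using x c by (intro tau_commute) auto
    ultimately have "Re (\<tau> ((?y - t *\<^sub>R c) * (?y - t *\<^sub>R c))) = Re (\<tau> (?y * ?y)) - 2 * t * p + t\<^sup>2 * g"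
      using x c by (simp add: p_def g_def tau_add tau_diff tau_scaleR)
    then show ?thesis using min[OF t] x c by (simp add: diff_diff_eq)
  qed
  assume "\<not> Re (\<tau> ((x - a) * c)) \<le> 0"
  then have p: "0 < p" by (simp add: p_def)
  \<comment> \<open>With this t one has t g <= p, against the inequality 2 p <= t g that minimality
    gives.\<close>
  define t where "t = min 1 (p / (\<bar>g\<bar> + 1))"
  have "t \<le> p / (\<bar>g\<bar> + 1)" by (simp add: t_def)
  moreover have "0 < \<bar>g\<bar> + 1" by simp
  ultimately have "t * (\<bar>g\<bar> + 1) \<le> p" by (simp only: pos_le_divide_eq)
  moreover have "0 < t" "t \<le> 1" using p by (auto simp: t_def)
  ultimately have t: "0 < t" "t \<le> 1" "t * (\<bar>g\<bar> + 1) \<le> p" by simp_all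
  have "2 * p \<le> t * g"
    using main[of t] t by (simp add: power2_eq_square)
  also have "\<dots> \<le> t * (\<bar>g\<bar> + 1)" using t by (intro mult_left_mono) auto
  finally show False using t p by simp
qed

text \<open>The two admissible directions give \<phi>(a c) >= 0 and \<phi>((1 - a) c) <= 0, so
  \<phi> vanishes on a (1 - a) c. What remains lives where a is 0 or 1; there x - a is nonnegative
  or nonpositive respectively, which gives the two reverse signs. High powers of 1 - a and of a
  approximate these two pieces, with the error controlled by \<open>tau_decay\<close>.\<close>

lemma nearest_point_represents:
  assumes x: "x \<in> M" "op_pos x" "op_pos (1 - x)" and a: "a \<in> unit_interval"
    and min: "\<And>b. b \<in> unit_interval \<Longrightarrow>
      Re (\<tau> (adj (x - a) * (x - a))) \<le> Re (\<tau> (adj (x - b) * (x - b)))"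
    and c: "c \<in> unit_interval"
  shows "\<tau> (x * c) = \<tau> (a * c)"
proof -
  define \<phi> where "\<phi> c = Re (\<tau> ((x - a) * c))" for c
  let ?b = "1 - a"
  have b: "?b \<in> unit_interval" by (rule unit_interval_compl[OF a])
  note [simp] = unit_interval_A op_pos_adj[OF unit_interval_pos] op_pos_adj[OF x(2)] x(1)
  have \<phi>_add: "\<phi> (c + d) = \<phi> c + \<phi> d" if "c \<in> A" "d \<in> A" for c d
    using that a by (simp add: \<phi>_def distrib_left tau_add)
  \<comment> \<open>Both perturbed points have this shape up to complement: a - t a c is a (1 - t
    c), and a + t (1 - a) c is 1 - (1 - a) (1 - t c).\<close>
  have convex: "u * (1 - t *\<^sub>R v) \<in> unit_interval"
    if uv: "u \<in> unit_interval" "v \<in> unit_interval" and t: "0 \<le> t" "t \<le> 1" for u v t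
  proof -
    have "t *\<^sub>R v \<in> unit_interval"
    proof -
      have "1 - t *\<^sub>R v = (1 - t) *\<^sub>R 1 + t *\<^sub>R (1 - v)" by (simp add: algebra_simps)
      moreover have "op_pos ((1 - t) *\<^sub>R 1 + t *\<^sub>R (1 - v))"
        using t uv unit_interval_pos[OF unit_interval_compl[OF uv(2)]]
        by (intro op_pos_add op_pos_scaleR op_pos_one) auto
      moreover have "op_pos (t *\<^sub>R v)" using t uv by (intro op_pos_scaleR unit_interval_pos)
      ultimately show ?thesis using uv(2) by (intro unit_intervalI) auto
    qed
    then show ?thesis using uv by (intro unit_interval_mult unit_interval_compl)
  qed
  have down: "0 \<le> \<phi> (a * c)" if c: "c \<in> unit_interval" for c
  proof -
    have "Re (\<tau> ((x - a) * (- (a * c)))) \<le> 0"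
    proof (rule nearest_point_variational[OF _ _ a])
      fix t :: real assume t: "0 \<le> t" "t \<le> 1"
      have "a + t *\<^sub>R (- (a * c)) = a * (1 - t *\<^sub>R c)" by (simp add: algebra_simps)
      then show "Re (\<tau> (adj (x - a) * (x - a)))
          \<le> Re (\<tau> (adj (x - (a + t *\<^sub>R (- (a * c)))) * (x - (a + t *\<^sub>R (- (a * c))))))"
        using min[OF convex[OF a c t]] by (simp only:)
    qed (use a c A_commute[of a c] in auto)
    then show ?thesis using a c by (simp add: \<phi>_def tau_minus)
  qed
  have up: "\<phi> (?b * c) \<le> 0" if c: "c \<in> unit_interval" for c
    unfolding \<phi>_def
  proof (rule nearest_point_variational[OF _ _ a])
    fix t :: real assume t: "0 \<le> t" "t \<le> 1"
    have "a + t *\<^sub>R (?b * c) = 1 - ?b * (1 - t *\<^sub>R c)" by (simp add: algebra_simps)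
    then show "Re (\<tau> (adj (x - a) * (x - a)))
        \<le> Re (\<tau> (adj (x - (a + t *\<^sub>R (?b * c))) * (x - (a + t *\<^sub>R (?b * c)))))"
      using min[OF unit_interval_compl[OF convex[OF b c t]]] by (simp only:)
  qed (use a b c A_commute[of a c] in \<open>auto simp: algebra_simps\<close>)
  have mid: "\<phi> (a * (?b * c)) = 0" if c: "c \<in> unit_interval" for c
  proof -
    have "a * (?b * c) = ?b * (a * c)" using a c by (intro A_left_commute) auto
    then show ?thesis
      using down[OF unit_interval_mult[OF b c]] up[OF unit_interval_mult[OF a c]] by simp
  qed
  \<comment> \<open>u agrees with each of its positive powers modulo multiples of (1 - u) u, on
    which \<phi> vanishes.\<close>
  have pow: "\<phi> (u * c) = \<phi> (u ^ Suc n * c)"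
    if u: "u \<in> unit_interval" and z: "\<And>c. c \<in> unit_interval \<Longrightarrow> \<phi> ((1 - u) * (u * c)) = 0" for u n
  proof (induction n)
    case (Suc n)
    have d: "u ^ n * c \<in> unit_interval" by (intro unit_interval_mult unit_interval_power u c)
    have "u ^ Suc n * c = u ^ Suc (Suc n) * c + (1 - u) * (u * (u ^ n * c))"
      by (simp add: algebra_simps)
    then have "\<phi> (u ^ Suc n * c) = \<phi> (u ^ Suc (Suc n) * c) + \<phi> ((1 - u) * (u * (u ^ n * c)))"
      using u c d by (metis \<phi>_add unit_interval_A unit_interval_mult unit_interval_power unit_interval_compl)
    then show ?case using Suc z[OF d] by simp
  qed simp
  have null: "(\<lambda>n. 1 / (real (Suc n) + 1)) \<longlonglongrightarrow> 0"
    using LIMSEQ_Suc[OF LIMSEQ_inverse_real_of_nat] by (simp add: inverse_eq_divide add.commute)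
  \<comment> \<open>Of the two terms of \<phi>(d), the trace of x d is nonnegative, and that of a d,
    where d carries the factor (1 - a)^(n+1), is small by \<open>tau_decay\<close>.\<close>
  have "- \<phi> (?b * c) \<le> 1 / (real (Suc n) + 1)" for n
  proof -
    define d where "d = ?b ^ Suc n * c"
    have d: "d \<in> unit_interval" unfolding d_def by (intro unit_interval_mult unit_interval_power b c)
    have "\<phi> (?b * c) = \<phi> d" unfolding d_def using a by (intro pow b) (simp add: mid)
    moreover have "\<phi> d = Re (\<tau> (x * d)) - Re (\<tau> (a * d))"
      using a d by (simp add: \<phi>_def left_diff_distrib tau_diff)
    moreover have "0 \<le> Re (\<tau> (x * d))"
      using x d by (intro tau_pos_mult) (auto simp: unit_interval_pos)
    moreover have "Re (\<tau> (a * d)) \<le> 1 / (real (Suc n) + 1)"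
      using tau_decay[OF a c, of "Suc n"] by (simp only: d_def mult.assoc)
    ultimately show ?thesis by simp
  qed
  then have "- \<phi> (?b * c) \<le> 0" by (intro LIMSEQ_le_const[OF null]) auto
  moreover have "\<phi> (a * c) \<le> 1 / (real (Suc n) + 1)" for n
  proof -
    define d where "d = a ^ Suc n * c"
    have d: "d \<in> unit_interval" unfolding d_def by (intro unit_interval_mult unit_interval_power a c)
    have "\<phi> ((1 - a) * (a * c)) = 0" if "c \<in> unit_interval" for c
      using mid[OF that] A_left_commute[of ?b a c] a by simp
    then have "\<phi> (a * c) = \<phi> d" unfolding d_def by (intro pow a) auto
    moreover have "\<phi> d = Re (\<tau> (?b * d)) - Re (\<tau> ((1 - x) * d))"
      using a d by (simp add: \<phi>_def left_diff_distrib tau_diff)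
    moreover have "0 \<le> Re (\<tau> ((1 - x) * d))"
      using x d by (intro tau_pos_mult) (auto simp: unit_interval_pos)
    moreover have "Re (\<tau> (?b * d)) \<le> 1 / (real (Suc n) + 1)"
      using tau_decay[OF b c, of "Suc n"] by (simp only: d_def mult.assoc diff_diff_eq2 add_diff_cancel_left')
    ultimately show ?thesis by simp
  qed
  then have "\<phi> (a * c) \<le> 0" by (intro LIMSEQ_le_const[OF null]) auto
  moreover have "\<phi> c = \<phi> (?b * c) + \<phi> (a * c)"
    using \<phi>_add[of "?b * c" "a * c"] a c by (simp add: algebra_simps)
  ultimately have "\<phi> c = 0" using up[OF c] down[OF c] by simp
  then have "Re (\<tau> (x * c)) = Re (\<tau> (a * c))"
    using a c by (simp add: \<phi>_def left_diff_distrib tau_diff)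
  moreover have "Im (\<tau> (x * c)) = 0" "Im (\<tau> (a * c)) = 0"
    using x a c by (auto intro!: tau_pos_mult unit_interval_pos)
  ultimately show ?thesis by (simp add: complex_eq_iff)
qed

lemma expectation_exists_unit:
  assumes x: "x \<in> M" "op_pos x" "op_pos (1 - x)"
  obtains a where "a \<in> unit_interval" "\<And>c. c \<in> A \<Longrightarrow> \<tau> (x * c) = \<tau> (a * c)"
proof -
  obtain a where a: "a \<in> unit_interval" and min: "\<And>b. b \<in> unit_interval \<Longrightarrow>
      Re (\<tau> (adj (x - a) * (x - a))) \<le> Re (\<tau> (adj (x - b) * (x - b)))"
    using nearest_point_exists[OF x(1)] by metis
  have aA: "a \<in> A" using a by (rule unit_interval_A)
  have "\<tau> (x * c) = \<tau> (a * c)" if "c \<in> A" for c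
    using vna_A that
  proof (induction rule: vna_unit_induct)
    case (unit c)
    then show ?case
      by (intro nearest_point_represents[OF x a min]) (auto simp: unit_interval_def)
  next
    case (add c d)
    then show ?case using x aA by (simp add: distrib_left tau_add)
  next
    case (scaleC r c)
    then show ?case using x aA by (simp add: scaleC_op_simps(2) tau_scaleC)
  qed
  with a show ?thesis by (rule that)
qed

end

section \<open>Uniqueness of trace-preserving conditional expectations\<close>

text \<open>Trace preservation and the module property give tr(E(x) b) = tr(E(x b)) = tr(x b), so
  E(x) is determined by its pairings with B. The abstract N covers both M and its ultrapower;
  extensionality settles the values outside N.\<close>

lemma trace_preserving_cond_exp_unique:
  assumes E: "is_trace_preserving_cond_exp N B E" and F: "is_trace_preserving_cond_exp N B F"
    and one: "\<one>\<^bsub>N\<^esub> \<in> B" "\<And>x. x \<in> carrier N \<Longrightarrow> \<one>\<^bsub>N\<^esub> \<otimes>\<^bsub>N\<^esub> x = x"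
    and closed: "B \<subseteq> carrier N" "\<And>x y. x \<in> carrier N \<Longrightarrow> y \<in> carrier N \<Longrightarrow> x \<otimes>\<^bsub>N\<^esub> y \<in> carrier N"
    and separating: "\<And>x y. x \<in> B \<Longrightarrow> y \<in> B \<Longrightarrow>
      (\<And>b. b \<in> B \<Longrightarrow> tr N (x \<otimes>\<^bsub>N\<^esub> b) = tr N (y \<otimes>\<^bsub>N\<^esub> b)) \<Longrightarrow> x = y"
  shows "E = F"
proof (rule PiE_ext)
  show EB: "E \<in> carrier N \<rightarrow>\<^sub>E B" and FB: "F \<in> carrier N \<rightarrow>\<^sub>E B"
    using E F by (simp_all add: is_trace_preserving_cond_exp_def)
  fix x assume x: "x \<in> carrier N"
  have *: "tr N (G x \<otimes>\<^bsub>N\<^esub> b) = tr N (x \<otimes>\<^bsub>N\<^esub> b)"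
    if G: "is_trace_preserving_cond_exp N B G" and b: "b \<in> B" for G b
  proof -
    have "G x \<in> B" using G x by (auto simp: is_trace_preserving_cond_exp_def)
    then have c: "G x \<in> carrier N" "b \<in> carrier N" using b closed by auto
    \<comment> \<open>The module clause is two-sided, so the unit is inserted on the left.\<close>
    have "G (\<one>\<^bsub>N\<^esub> \<otimes>\<^bsub>N\<^esub> x \<otimes>\<^bsub>N\<^esub> b) = \<one>\<^bsub>N\<^esub> \<otimes>\<^bsub>N\<^esub> G x \<otimes>\<^bsub>N\<^esub> b"
      using G x b one(1) unfolding is_trace_preserving_cond_exp_def by blast
    then have "G (x \<otimes>\<^bsub>N\<^esub> b) = G x \<otimes>\<^bsub>N\<^esub> b" using x c by (simp add: one)
    then show ?thesis
      using G x c closed(2) unfolding is_trace_preserving_cond_exp_def by metis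
  qed
  show "E x = F x"
    using EB FB x by (intro separating) (auto simp: *[OF E] *[OF F])
qed

lemma cond_exp_eqI:
  assumes "is_trace_preserving_cond_exp N B E"
    and "\<one>\<^bsub>N\<^esub> \<in> B" "\<And>x. x \<in> carrier N \<Longrightarrow> \<one>\<^bsub>N\<^esub> \<otimes>\<^bsub>N\<^esub> x = x"
    and "B \<subseteq> carrier N" "\<And>x y. x \<in> carrier N \<Longrightarrow> y \<in> carrier N \<Longrightarrow> x \<otimes>\<^bsub>N\<^esub> y \<in> carrier N"
    and "\<And>x y. x \<in> B \<Longrightarrow> y \<in> B \<Longrightarrow>
      (\<And>b. b \<in> B \<Longrightarrow> tr N (x \<otimes>\<^bsub>N\<^esub> b) = tr N (y \<otimes>\<^bsub>N\<^esub> b)) \<Longrightarrow> x = y"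
  shows "cond_exp N B = E"
  unfolding cond_exp_def
proof (rule the_equality)
  show "F = E" if "is_trace_preserving_cond_exp N B F" for F
    using that assms by (rule trace_preserving_cond_exp_unique)
qed (rule assms(1))

text \<open>c^2 - T^2 is the product of the commuting positive operators c - T and c + T.\<close>

lemma self_adjoint_norm_le:
  assumes "adj T = T" "op_pos (c *\<^sub>R 1 - T)" "op_pos (c *\<^sub>R 1 + T)" "0 \<le> c"
  shows "norm (T :: 'h::complex_hilbert_space bounded_op) \<le> c"
proof -
  have "op_pos ((c *\<^sub>R 1 - T) * (c *\<^sub>R 1 + T))"
    by (rule op_pos_mult[OF assms(2,3)]) (simp add: algebra_simps)
  then have "op_pos (c\<^sup>2 *\<^sub>R 1 - adj T * T)"
    by (simp add: algebra_simps power2_eq_square assms(1))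
  then have "norm (adj T * T) \<le> c\<^sup>2" by (intro op_pos_norm_le op_pos_square) auto
  then have "(norm T)\<^sup>2 \<le> c\<^sup>2" using op_norm_sq_le order_trans by blast
  then show ?thesis using assms(4) by (rule power2_le_imp_le)
qed

section \<open>The expectation onto \<open>A\<close> on all of \<open>M\<close>\<close>

context tracial_abelian
begin

text \<open>Defined by the pairing with \<open>A\<close> and not as a nearest point, which
  represents the pairing only for 0 <= x <= 1. Linearity, the module property and compatibility with
  adjoints then follow from \<open>expect_eqI\<close>.\<close>

definition expect :: "'h bounded_op \<Rightarrow> 'h bounded_op" where
  "expect x = (THE a. a \<in> A \<and> (\<forall>c\<in>A. \<tau> (x * c) = \<tau> (a * c)))"

lemma A_separating:
  assumes ab: "a \<in> A" "b \<in> A" and eq: "\<And>c. c \<in> A \<Longrightarrow> \<tau> (a * c) = \<tau> (b * c)"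
  shows "a = b"
proof -
  have "\<tau> (adj (a - b) * (a - b)) = \<tau> ((a - b) * adj (a - b))"
    using ab by (intro tau_commute) auto
  also have "\<dots> = \<tau> (a * adj (a - b)) - \<tau> (b * adj (a - b))"
    unfolding left_diff_distrib using ab by (intro tau_diff) auto
  also have "\<dots> = 0" using eq[of "adj (a - b)"] ab by simp
  finally have "a - b = 0" using ab by (intro tau_faithful_star) auto
  then show ?thesis by simp
qed

lemma expect_eqI:
  assumes "a \<in> A" "\<And>c. c \<in> A \<Longrightarrow> \<tau> (x * c) = \<tau> (a * c)"
  shows "expect x = a"
  unfolding expect_def
proof (rule the_equality)
  show "b = a" if "b \<in> A \<and> (\<forall>c\<in>A. \<tau> (x * c) = \<tau> (b * c))" for b
    using that assms by (intro A_separating) auto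
qed (use assms in auto)

lemma expect_exists: "x \<in> M \<Longrightarrow> \<exists>a\<in>A. \<forall>c\<in>A. \<tau> (x * c) = \<tau> (a * c)"
  using vna
proof (induction rule: vna_unit_induct)
  case (unit x)
  then show ?case using expectation_exists_unit[of x] unit_interval_A by metis
next
  case (add x y)
  then obtain a b where "a \<in> A" "b \<in> A" "\<forall>c\<in>A. \<tau> (x * c) = \<tau> (a * c)" "\<forall>c\<in>A. \<tau> (y * c) = \<tau> (b * c)"
    by blast
  then show ?case using add(1,2)
    by (intro bexI[of _ "a + b"]) (auto simp: distrib_right tau_add)
next
  case (scaleC r x)
  then obtain a where "a \<in> A" "\<forall>c\<in>A. \<tau> (x * c) = \<tau> (a * c)" by blast
  then show ?case using scaleC(1)
    by (intro bexI[of _ "r *\<^sub>C a"]) (auto simp: scaleC_op_simps(1) tau_scaleC)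
qed

lemma expect_A [simp]: "x \<in> M \<Longrightarrow> expect x \<in> A"
  and tau_expect_mult: "x \<in> M \<Longrightarrow> c \<in> A \<Longrightarrow> \<tau> (expect x * c) = \<tau> (x * c)"
  using expect_exists[of x] expect_eqI[of _ x] by metis+

lemma expect_ident: "a \<in> A \<Longrightarrow> expect a = a"
  by (rule expect_eqI) auto

lemma expect_add: "x \<in> M \<Longrightarrow> y \<in> M \<Longrightarrow> expect (x + y) = expect x + expect y"
  by (rule expect_eqI) (auto simp: distrib_right tau_add tau_expect_mult)

lemma expect_scaleC: "x \<in> M \<Longrightarrow> expect (r *\<^sub>C x) = r *\<^sub>C expect x"
  by (rule expect_eqI) (auto simp: scaleC_op_simps(1) tau_scaleC tau_expect_mult)

lemma expect_scaleR: "x \<in> M \<Longrightarrow> expect (r *\<^sub>R x) = r *\<^sub>R expect x"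
  using expect_scaleC[of x "of_real r"] by (simp add: scaleC_op_simps)

lemma expect_diff: "x \<in> M \<Longrightarrow> y \<in> M \<Longrightarrow> expect (x - y) = expect x - expect y"
  using expect_add[of x "- y"] expect_scaleR[of y "-1"] by simp

lemma tau_expect: "x \<in> M \<Longrightarrow> \<tau> (expect x) = \<tau> x"
  using tau_expect_mult[of x 1] by simp

text \<open>Traciality cycles a to the right end, \<tau>(a y b c) = \<tau>(y (b c a)), and b c a is
  again a test element of \<open>A\<close>.\<close>

lemma expect_bimodule:
  assumes "x \<in> M" "a \<in> A" "b \<in> A"
  shows "expect (a * x * b) = a * expect x * b"
proof (rule expect_eqI)
  fix c assume c: "c \<in> A"
  have *: "\<tau> (a * y * b * c) = \<tau> (y * (b * c * a))" if "y \<in> M" for y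
    using tau_commute[of a "y * b * c"] assms that c by (simp add: mult.assoc)
  show "\<tau> (a * x * b * c) = \<tau> (a * expect x * b * c)"
    using assms c tau_expect_mult[of x "b * c * a"] by (simp add: *)
qed (use assms in auto)

lemma expect_adj: assumes x: "x \<in> M" shows "expect (adj x) = adj (expect x)"
proof (rule expect_eqI)
  fix c assume c: "c \<in> A"
  have *: "\<tau> (adj y * c) = cnj (\<tau> (y * adj c))" if "y \<in> M" for y
    using tau_adj[of "adj c * y"] tau_commute[of "adj c" y] c that by simp
  show "\<tau> (adj x * c) = \<tau> (adj (expect x) * c)"
    using x c tau_expect_mult[of x "adj c"] by (simp add: *)
qed (use x in auto)

text \<open>After rescaling, the nearest-point construction represents x by an element of the unit
  interval of \<open>A\<close>.\<close>

lemma expect_pos: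
  assumes x: "x \<in> M" "op_pos x" shows "op_pos (expect x)"
proof (cases "x = 0")
  case True
  then show ?thesis using expect_ident[of 0] by (simp add: op_pos_zero)
next
  case False
  define c where "c = norm x"
  have c: "0 < c" using False by (simp add: c_def)
  have y: "(1/c) *\<^sub>R x \<in> M" "op_pos ((1/c) *\<^sub>R x)" using x c by (auto intro: op_pos_scaleR)
  have "op_pos (1 *\<^sub>R 1 - (1/c) *\<^sub>R x)"
    using y c by (intro op_pos_norm_diff op_pos_adj) (auto simp: c_def)
  then have "op_pos (1 - (1/c) *\<^sub>R x)" by simp
  then obtain a where "a \<in> unit_interval" "\<And>b. b \<in> A \<Longrightarrow> \<tau> ((1/c) *\<^sub>R x * b) = \<tau> (a * b)"
    using expectation_exists_unit[OF y] by metis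
  then have "op_pos (expect ((1/c) *\<^sub>R x))"
    using expect_eqI[of a] by (simp add: unit_interval_A unit_interval_pos)
  then have "op_pos (c *\<^sub>R expect ((1/c) *\<^sub>R x))" using c by (intro op_pos_scaleR) auto
  then show ?thesis using x c by (simp add: expect_scaleR)
qed

text \<open>Positivity gives the constant 1 on self-adjoint elements; splitting into real and
  imaginary parts costs the factor 2. Any constant serves the purpose, which is to keep sequences
  norm-bounded when the expectation is applied termwise.\<close>

lemma expect_norm_le:
  assumes x: "x \<in> M" shows "norm (expect x) \<le> 2 * norm x"
proof -
  have sa: "norm (expect h) \<le> norm h" if h: "h \<in> M" "adj h = h" for h
  proof (rule self_adjoint_norm_le)
    have e: "expect (norm h *\<^sub>R 1) = norm h *\<^sub>R 1" by (rule expect_ident) simp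
    show "op_pos (norm h *\<^sub>R 1 - expect h)"
      using expect_pos[OF _ op_pos_norm_diff[OF h(2) order_refl]] h e by (simp add: expect_diff)
    show "op_pos (norm h *\<^sub>R 1 + expect h)"
      using expect_pos[of "norm h *\<^sub>R 1 + h"] op_pos_norm_diff[of "- h" "norm h"] h e
      by (simp add: expect_add)
  qed (use h in \<open>simp_all flip: expect_adj\<close>)
  define u where "u = (1/2) *\<^sub>R (x + adj x)"
  define v where "v = (1/2) *\<^sub>R (\<i> *\<^sub>C (adj x - x))"
  have uv: "u \<in> M" "v \<in> M" "adj u = u" "adj v = v"
    using x vna_self_adjoint_comb(2)[of x] by (auto simp: u_def v_def add.commute)
  have eq: "x = u + \<i> *\<^sub>C v" unfolding u_def v_def by (rule vna_self_adjoint_comb)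
  have "norm u \<le> norm x"
    using norm_triangle_ineq[of x "adj x"] by (simp add: u_def)
  moreover have "norm v \<le> norm x"
    using op_norm_scaleC[of \<i> "adj x - x"] norm_triangle_ineq4[of "adj x" x] by (simp add: v_def)
  moreover have "norm (expect x) \<le> norm (expect u) + norm (expect v)"
  proof -
    have "expect x = expect u + \<i> *\<^sub>C expect v"
      by (subst eq) (use uv in \<open>simp add: expect_add expect_scaleC\<close>)
    then show ?thesis
      using norm_triangle_ineq[of "expect u" "\<i> *\<^sub>C expect v"] op_norm_scaleC[of \<i> "expect v"] by simp
  qed
  ultimately show ?thesis using sa[OF uv(1,3)] sa[OF uv(2,4)] by linarith
qed

text \<open>Pythagoras: x - E(x) is orthogonal to \<open>A\<close>. The contraction makes the
  termwise expectation independent of the representing sequence.\<close>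

lemma expect_contraction:
  assumes x: "x \<in> M"
  shows "Re (\<tau> (adj (expect x) * expect x)) \<le> Re (\<tau> (adj x * x))"
proof -
  let ?e = "expect x"
  have e: "?e \<in> A" using x by simp
  have 1: "\<tau> (adj ?e * x) = \<tau> (adj ?e * ?e)"
    using tau_expect_mult[OF x, of "adj ?e"] tau_commute[of "adj ?e"] x e by simp
  have 2: "Re (\<tau> (adj x * ?e)) = Re (\<tau> (adj ?e * x))"
    using tau_adj[of "adj ?e * x"] x e by simp
  have "adj (x - ?e) * (x - ?e) = adj x * x - adj x * ?e - (adj ?e * x - adj ?e * ?e)"
    by (simp add: algebra_simps)
  then have "Re (\<tau> (adj (x - ?e) * (x - ?e))) = Re (\<tau> (adj x * x)) - Re (\<tau> (adj ?e * ?e))"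
    using x e by (simp add: tau_diff 1 2)
  then show ?thesis using tau_star_Re[of "x - ?e"] x e by simp
qed

lemma cond_exp_tracial_vna: "cond_exp (tracial_vna M \<tau>) A = restrict expect M"
proof (rule cond_exp_eqI)
  \<comment> \<open>\<open>positives\<close> consists of elements of the form adj z z, so a positive
    expectation must be rewritten as the square of its root.\<close>
  have "\<exists>z. expect (adj y * y) = adj z * z \<and> z \<in> M" if y: "y \<in> M" for y
  proof -
    obtain s where s: "s \<in> A" "op_pos s" "s * s = expect (adj y * y)"
      using vna_sqrt[OF vna_A, of "expect (adj y * y)"] expect_pos[OF _ op_pos_square[of y]] y
      by (metis closed(5,9) expect_A)
    then show ?thesis by (intro exI[of _ s]) (simp add: op_pos_adj)
  qed
  then show "is_trace_preserving_cond_exp (tracial_vna M \<tau>) A (restrict expect M)"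
    by (auto simp: is_trace_preserving_cond_exp_def tracial_vna_def positives_def
        expect_add expect_scaleC expect_ident expect_bimodule tau_expect)
qed (auto simp: tracial_vna_def intro: A_separating)

lemma ortho_minus_tracial_vna: "ortho_minus (tracial_vna M \<tau>) A = {x \<in> M. expect x = 0}"
  by (auto simp: ortho_minus_def cond_exp_tracial_vna) (simp_all add: tracial_vna_def)

end

subsection \<open>The tracial ultrapower\<close>

lemma tendsto_zero_dominated:
  fixes f g :: "'i \<Rightarrow> real"
  assumes "\<And>n. 0 \<le> f n" "\<And>n. f n \<le> g n" "(g \<longlongrightarrow> 0) F"
  shows "(f \<longlongrightarrow> 0) F"
  by (rule tendsto_sandwich[OF always_eventually always_eventually tendsto_const assms(3)])
    (simp_all add: assms)

context tracial_abelian
begin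

abbreviation bounded_seqs :: "'h bounded_op set \<Rightarrow> (nat \<Rightarrow> 'h bounded_op) set" where
  "bounded_seqs B \<equiv> carrier (l_infinity B)"

abbreviation null_seqs :: "(nat \<Rightarrow> 'h bounded_op) set" where
  "null_seqs \<equiv> null_sequences \<omega> M \<tau>"

abbreviation cls :: "(nat \<Rightarrow> 'h bounded_op) \<Rightarrow> (nat \<Rightarrow> 'h bounded_op) set" where
  "cls \<equiv> ultrapower_class \<omega> M \<tau>"

abbreviation U :: "(nat \<Rightarrow> 'h bounded_op) set tracial_algebra" where
  "U \<equiv> ultrapower \<omega> M \<tau>"

lemma bounded_seqs_iff:
  "x \<in> bounded_seqs B \<longleftrightarrow> (\<forall>n. x n \<in> B) \<and> (\<exists>K. \<forall>n. norm (x n) \<le> K)"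
  by (auto simp: l_infinity_def bounded_iff)

lemma bounded_seqsI: "(\<And>n. x n \<in> B) \<Longrightarrow> (\<And>n. norm (x n) \<le> K) \<Longrightarrow> x \<in> bounded_seqs B"
  by (auto simp: bounded_seqs_iff)

lemma bounded_seqsE:
  assumes "x \<in> bounded_seqs B"
  obtains K where "0 \<le> K" "\<And>n. norm (x n) \<le> K" "\<And>n. x n \<in> B"
  using assms by (auto simp: bounded_seqs_iff) (meson norm_ge_zero order_trans)

lemma bounded_seqs_mem: "x \<in> bounded_seqs B \<Longrightarrow> x n \<in> B"
  by (simp add: bounded_seqs_iff)

lemma bounded_seqs_A: "x \<in> bounded_seqs A \<Longrightarrow> x \<in> bounded_seqs M"
  by (auto simp: bounded_seqs_iff)

lemma bounded_seqs_closed: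
  assumes B: "von_neumann_algebra B" and x: "x \<in> bounded_seqs B"
  shows "y \<in> bounded_seqs B \<Longrightarrow> (\<lambda>n. x n + y n) \<in> bounded_seqs B"
    "y \<in> bounded_seqs B \<Longrightarrow> (\<lambda>n. x n - y n) \<in> bounded_seqs B"
    "y \<in> bounded_seqs B \<Longrightarrow> (\<lambda>n. x n * y n) \<in> bounded_seqs B"
    "(\<lambda>n. c *\<^sub>C x n) \<in> bounded_seqs B" "(\<lambda>n. adj (x n)) \<in> bounded_seqs B"
proof -
  note cl = vna_closed[OF B]
  obtain K where K: "0 \<le> K" "\<And>n. norm (x n) \<le> K" "\<And>n. x n \<in> B" using bounded_seqsE[OF x] by metis
  show "(\<lambda>n. adj (x n)) \<in> bounded_seqs B" using K cl by (intro bounded_seqsI[of _ _ K]) auto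
  show "(\<lambda>n. c *\<^sub>C x n) \<in> bounded_seqs B"
    using K cl by (intro bounded_seqsI[of _ _ "cmod c * K"])
      (auto intro!: order_trans[OF op_norm_scaleC] mult_left_mono)
  assume y: "y \<in> bounded_seqs B"
  obtain L where L: "0 \<le> L" "\<And>n. norm (y n) \<le> L" "\<And>n. y n \<in> B" using bounded_seqsE[OF y] by metis
  show "(\<lambda>n. x n + y n) \<in> bounded_seqs B"
    using K L cl by (intro bounded_seqsI[of _ _ "K + L"]) (auto intro: norm_triangle_mono)
  show "(\<lambda>n. x n - y n) \<in> bounded_seqs B"
    using K L cl by (intro bounded_seqsI[of _ _ "K + L"])
      (auto intro!: order_trans[OF norm_triangle_ineq4] add_mono)
  show "(\<lambda>n. x n * y n) \<in> bounded_seqs B"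
    using K L cl by (intro bounded_seqsI[of _ _ "K * L"])
      (auto intro!: order_trans[OF norm_mult_ineq] mult_mono)
qed

lemmas seqs_closed = bounded_seqs_closed[OF vna]

lemma const_seq: "b \<in> B \<Longrightarrow> (\<lambda>n. b) \<in> bounded_seqs B"
  by (rule bounded_seqsI[of _ _ "norm b"]) auto

lemma expect_seq: "x \<in> bounded_seqs M \<Longrightarrow> (\<lambda>n. expect (x n)) \<in> bounded_seqs A"
proof -
  assume "x \<in> bounded_seqs M"
  then obtain K where K: "\<And>n. norm (x n) \<le> K" "\<And>n. x n \<in> M" using bounded_seqsE by metis
  have "norm (expect (x n)) \<le> 2 * K" for n
    using expect_norm_le[OF K(2), of n] K(1)[of n] by simp
  then show ?thesis using K(2) by (intro bounded_seqsI) auto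
qed

lemma null_seqs_iff:
  "x \<in> null_seqs \<longleftrightarrow> x \<in> bounded_seqs M \<and> ((\<lambda>n. Re (\<tau> (adj (x n) * x n))) \<longlongrightarrow> 0) \<omega>"
proof -
  have "((\<lambda>n. norm_2 \<tau> (x n)) \<longlongrightarrow> 0) \<omega> \<longleftrightarrow> ((\<lambda>n. Re (\<tau> (adj (x n) * x n))) \<longlongrightarrow> 0) \<omega>"
    if x: "x \<in> bounded_seqs M"
  proof
    assume "((\<lambda>n. norm_2 \<tau> (x n)) \<longlongrightarrow> 0) \<omega>"
    from tendsto_power[OF this, of 2] show "((\<lambda>n. Re (\<tau> (adj (x n) * x n))) \<longlongrightarrow> 0) \<omega>"
      using tau_star_Re bounded_seqs_mem[OF x] by (simp add: norm_2_def)
  next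
    assume "((\<lambda>n. Re (\<tau> (adj (x n) * x n))) \<longlongrightarrow> 0) \<omega>"
    from tendsto_real_sqrt[OF this] show "((\<lambda>n. norm_2 \<tau> (x n)) \<longlongrightarrow> 0) \<omega>"
      by (simp add: norm_2_def)
  qed
  then show ?thesis by (auto simp: null_sequences_def)
qed

lemma null_seqs_dominated:
  assumes x: "x \<in> bounded_seqs M" and y: "y \<in> null_seqs"
    and le: "\<And>n. Re (\<tau> (adj (x n) * x n)) \<le> K * Re (\<tau> (adj (y n) * y n))"
  shows "x \<in> null_seqs"
proof -
  have "((\<lambda>n. K * Re (\<tau> (adj (y n) * y n))) \<longlongrightarrow> 0) \<omega>"
    using y tendsto_mult_right_zero by (auto simp: null_seqs_iff)
  then have "((\<lambda>n. Re (\<tau> (adj (x n) * x n))) \<longlongrightarrow> 0) \<omega>"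
    by (rule tendsto_zero_dominated[OF tau_star_Re[OF bounded_seqs_mem[OF x]] le])
  with x show ?thesis by (simp add: null_seqs_iff)
qed

lemma null_seqs_zero: "(\<lambda>n. 0) \<in> null_seqs"
  by (auto simp: null_seqs_iff intro: const_seq)

lemma null_seqs_scaleC:
  assumes x: "x \<in> null_seqs" shows "(\<lambda>n. c *\<^sub>C x n) \<in> null_seqs"
proof (rule null_seqs_dominated[OF _ x])
  have x': "x \<in> bounded_seqs M" using x by (simp add: null_seqs_iff)
  then show "(\<lambda>n. c *\<^sub>C x n) \<in> bounded_seqs M" by (rule seqs_closed)
  show "Re (\<tau> (adj (c *\<^sub>C x n) * (c *\<^sub>C x n))) \<le> (cmod c)\<^sup>2 * Re (\<tau> (adj (x n) * x n))" for n
  proof -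
    have "adj (c *\<^sub>C x n) * (c *\<^sub>C x n) = (c * cnj c) *\<^sub>C (adj (x n) * x n)"
      by (simp add: scaleC_op_simps(1,2,4))
    then have "\<tau> (adj (c *\<^sub>C x n) * (c *\<^sub>C x n)) = complex_of_real ((cmod c)\<^sup>2) * \<tau> (adj (x n) * x n)"
      using bounded_seqs_mem[OF x'] by (simp only: complex_norm_square tau_scaleC closed)
    then show ?thesis by simp
  qed
qed

lemma null_seqs_uminus: "x \<in> null_seqs \<Longrightarrow> (\<lambda>n. - x n) \<in> null_seqs"
  using null_seqs_scaleC[of x "-1"] by (simp add: scaleC_op_simps(9))

lemma null_seqs_add:
  assumes x: "x \<in> null_seqs" and y: "y \<in> null_seqs" shows "(\<lambda>n. x n + y n) \<in> null_seqs"
proof -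
  have xy: "x \<in> bounded_seqs M" "y \<in> bounded_seqs M" using x y by (auto simp: null_seqs_iff)
  have le: "Re (\<tau> (adj (x n + y n) * (x n + y n)))
      \<le> 2 * Re (\<tau> (adj (x n) * x n)) + 2 * Re (\<tau> (adj (y n) * y n))" for n
  proof -
    have m: "x n \<in> M" "y n \<in> M" using xy bounded_seqs_mem by auto
    \<comment> \<open>Parallelogram identity; the square of the difference is then dropped.\<close>
    have "adj (x n + y n) * (x n + y n) + adj (x n - y n) * (x n - y n)
        = (adj (x n) * x n + adj (x n) * x n) + (adj (y n) * y n + adj (y n) * y n)"
      by (simp add: algebra_simps)
    then have "\<tau> (adj (x n + y n) * (x n + y n)) + \<tau> (adj (x n - y n) * (x n - y n))
        = (\<tau> (adj (x n) * x n) + \<tau> (adj (x n) * x n)) + (\<tau> (adj (y n) * y n) + \<tau> (adj (y n) * y n))"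
      using m by (metis closed(3,4,5,9) tau_add)
    then show ?thesis
      using tau_star_Re[of "x n - y n"] m by (simp add: complex_eq_iff)
  qed
  have "((\<lambda>n. 2 * Re (\<tau> (adj (x n) * x n)) + 2 * Re (\<tau> (adj (y n) * y n))) \<longlongrightarrow> 2 * 0 + 2 * 0) \<omega>"
    using x y by (intro tendsto_intros) (auto simp: null_seqs_iff)
  then have "((\<lambda>n. Re (\<tau> (adj (x n + y n) * (x n + y n)))) \<longlongrightarrow> 0) \<omega>"
    by (intro tendsto_zero_dominated[OF tau_star_Re[OF bounded_seqs_mem[OF seqs_closed(1)[OF xy]]] le])
      simp
  then show ?thesis using seqs_closed(1)[OF xy] by (simp add: null_seqs_iff)
qed

lemma null_seqs_diff:
  "x \<in> null_seqs \<Longrightarrow> y \<in> null_seqs \<Longrightarrow> (\<lambda>n. x n - y n) \<in> null_seqs"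
  using null_seqs_add[of x "\<lambda>n. - y n"] null_seqs_uminus[of y] by simp

text \<open>Traciality makes the 2-norm invariant under adjoints. This is how the ideal property on
  the left transfers to the right.\<close>

lemma null_seqs_adj:
  assumes x: "x \<in> null_seqs" shows "(\<lambda>n. adj (x n)) \<in> null_seqs"
proof (rule null_seqs_dominated[OF _ x, of _ 1])
  have x': "x \<in> bounded_seqs M" using x by (simp add: null_seqs_iff)
  then show "(\<lambda>n. adj (x n)) \<in> bounded_seqs M" by (rule seqs_closed)
  show "Re (\<tau> (adj (adj (x n)) * adj (x n))) \<le> 1 * Re (\<tau> (adj (x n) * x n))" for n
    using tau_commute[of "x n" "adj (x n)"] bounded_seqs_mem[OF x'] by simp
qed

lemma null_seqs_mult_left:
  assumes x: "x \<in> bounded_seqs M" and y: "y \<in> null_seqs" shows "(\<lambda>n. x n * y n) \<in> null_seqs"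
proof -
  have y': "y \<in> bounded_seqs M" using y by (simp add: null_seqs_iff)
  obtain K where K: "0 \<le> K" "\<And>n. norm (x n) \<le> K" "\<And>n. x n \<in> M" using bounded_seqsE[OF x] by metis
  show ?thesis
  proof (rule null_seqs_dominated[OF seqs_closed(3)[OF x y'] y, of "K\<^sup>2"])
    fix n
    have "Re (\<tau> (adj (x n * y n) * (x n * y n))) \<le> (norm (x n))\<^sup>2 * Re (\<tau> (adj (y n) * y n))"
      using K bounded_seqs_mem[OF y'] by (intro tau_star_le) auto
    also have "\<dots> \<le> K\<^sup>2 * Re (\<tau> (adj (y n) * y n))"
      using K tau_star_Re[OF bounded_seqs_mem[OF y']] by (intro mult_right_mono power_mono) auto
    finally show "Re (\<tau> (adj (x n * y n) * (x n * y n))) \<le> K\<^sup>2 * Re (\<tau> (adj (y n) * y n))" .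
  qed
qed

lemma null_seqs_mult_right:
  assumes x: "x \<in> null_seqs" and y: "y \<in> bounded_seqs M" shows "(\<lambda>n. x n * y n) \<in> null_seqs"
proof -
  have "(\<lambda>n. adj (y n) * adj (x n)) \<in> null_seqs"
    by (rule null_seqs_mult_left[OF seqs_closed(5)[OF y] null_seqs_adj[OF x]])
  then have "(\<lambda>n. adj (adj (y n) * adj (x n))) \<in> null_seqs"
    by (rule null_seqs_adj)
  then show ?thesis by simp
qed

section \<open>Cosets of null sequences and the operations on them\<close>

lemma cls_eq:
  assumes x: "x \<in> bounded_seqs M"
  shows "cls x = {y \<in> bounded_seqs M. (\<lambda>n. y n - x n) \<in> null_seqs}"
proof -
  have "cls x = (\<Union>h\<in>null_seqs. {\<lambda>n. h n + x n})"
    by (simp add: ultrapower_class_def a_r_coset_def' l_infinity_def)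
  moreover have "y \<in> (\<Union>h\<in>null_seqs. {\<lambda>n. h n + x n})"
    if "(\<lambda>n. y n - x n) \<in> null_seqs" for y
    using that by (intro UN_I[of "\<lambda>n. y n - x n"]) auto
  moreover have "(\<lambda>n. h n + x n) \<in> bounded_seqs M" if "h \<in> null_seqs" for h
    using that x by (intro seqs_closed(1)) (auto simp: null_seqs_iff)
  ultimately show ?thesis by auto
qed

lemma cls_mem: "x \<in> bounded_seqs M \<Longrightarrow> x \<in> cls x"
  by (simp add: cls_eq null_seqs_zero)

lemma cls_eq_iff:
  assumes x: "x \<in> bounded_seqs M" and y: "y \<in> bounded_seqs M"
  shows "cls x = cls y \<longleftrightarrow> (\<lambda>n. x n - y n) \<in> null_seqs"
proof
  assume "cls x = cls y"
  then show "(\<lambda>n. x n - y n) \<in> null_seqs"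
    using cls_mem[OF x] y by (simp add: cls_eq)
next
  assume d: "(\<lambda>n. x n - y n) \<in> null_seqs"
  have "(\<lambda>n. z n - x n) \<in> null_seqs \<longleftrightarrow> (\<lambda>n. z n - y n) \<in> null_seqs" for z
    using null_seqs_add[OF _ d, of "\<lambda>n. z n - x n"] null_seqs_diff[OF _ d, of "\<lambda>n. z n - y n"]
    by auto
  then show "cls x = cls y" using x y by (simp add: cls_eq)
qed

lemma cls_memD:
  assumes "x \<in> bounded_seqs M" "y \<in> cls x"
  shows "y \<in> bounded_seqs M" "(\<lambda>n. y n - x n) \<in> null_seqs" "cls y = cls x"
  using assms cls_eq_iff by (auto simp: cls_eq)

lemma U_carrier: "carrier U = cls ` bounded_seqs M"
  by (auto simp: ultrapower_def Let_def FactRing_def A_RCOSETS_def' ultrapower_class_def)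

lemma U_one: "\<one>\<^bsub>U\<^esub> = cls (\<lambda>n. 1)"
  by (simp add: ultrapower_def Let_def FactRing_def ultrapower_class_def) (simp add: l_infinity_def)

lemma U_zero: "\<zero>\<^bsub>U\<^esub> = cls (\<lambda>n. 0)"
proof -
  have "cls (\<lambda>n. 0) = null_seqs"
    unfolding cls_eq[OF const_seq[OF closed(1)]] using null_seqs_iff by simp blast
  then show ?thesis by (simp add: ultrapower_def Let_def FactRing_def)
qed

lemma U_mult:
  assumes x: "x \<in> bounded_seqs M" and y: "y \<in> bounded_seqs M"
  shows "cls x \<otimes>\<^bsub>U\<^esub> cls y = cls (\<lambda>n. x n * y n)"
proof -
  have "cls (\<lambda>n. a n * b n) = cls (\<lambda>n. x n * y n)" if a: "a \<in> cls x" and b: "b \<in> cls y" for a b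
  proof -
    note a' = cls_memD[OF x a] and b' = cls_memD[OF y b]
    \<comment> \<open>a b - x y = a (b - y) + (a - x) y, so every pair of representatives
      contributes the same coset to the union.\<close>
    have "(\<lambda>n. a n * (b n - y n) + (a n - x n) * y n) \<in> null_seqs"
      by (intro null_seqs_add null_seqs_mult_left null_seqs_mult_right a' b' y)
    then show ?thesis
      using cls_eq_iff[OF seqs_closed(3)[OF a'(1) b'(1)] seqs_closed(3)[OF x y]]
      by (simp add: algebra_simps)
  qed
  then have "(\<Union>a\<in>cls x. \<Union>b\<in>cls y. cls (\<lambda>n. a n * b n)) = cls (\<lambda>n. x n * y n)"
    by (intro UN_constant_eq[OF cls_mem[OF x]] UN_constant_eq[OF cls_mem[OF y]] ballI)
  moreover have "cls x \<otimes>\<^bsub>U\<^esub> cls y = (\<Union>a\<in>cls x. \<Union>b\<in>cls y. cls (\<lambda>n. a n * b n))"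
    by (simp add: ultrapower_def Let_def FactRing_def rcoset_mult_def flip: ultrapower_class_def)
      (simp add: l_infinity_def)
  ultimately show ?thesis by simp
qed

lemma U_add:
  assumes x: "x \<in> bounded_seqs M" and y: "y \<in> bounded_seqs M"
  shows "cls x \<oplus>\<^bsub>U\<^esub> cls y = cls (\<lambda>n. x n + y n)"
proof -
  \<comment> \<open>Addition of cosets is the sumset and not a union of cosets, so two inclusions
    are needed; in the second, z is written as (z - y) + y.\<close>
  have "cls x \<oplus>\<^bsub>U\<^esub> cls y = (\<Union>a\<in>cls x. \<Union>b\<in>cls y. {\<lambda>n. a n + b n})"
    by (simp add: ultrapower_def Let_def FactRing_def set_add_def' l_infinity_def)
  also have "\<dots> = cls (\<lambda>n. x n + y n)"
  proof (intro equalityI subsetI)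
    fix z assume "z \<in> (\<Union>a\<in>cls x. \<Union>b\<in>cls y. {\<lambda>n. a n + b n})"
    then obtain a b where ab: "a \<in> cls x" "b \<in> cls y" "z = (\<lambda>n. a n + b n)" by blast
    note a' = cls_memD[OF x ab(1)] and b' = cls_memD[OF y ab(2)]
    have "(\<lambda>n. (a n - x n) + (b n - y n)) \<in> null_seqs" by (intro null_seqs_add a' b')
    then show "z \<in> cls (\<lambda>n. x n + y n)"
      using seqs_closed(1)[OF x y] seqs_closed(1)[OF a'(1) b'(1)]
      by (simp add: cls_eq ab(3) algebra_simps)
  next
    fix z assume "z \<in> cls (\<lambda>n. x n + y n)"
    note z = cls_memD[OF seqs_closed(1)[OF x y] this]
    have "(\<lambda>n. z n - y n) \<in> cls x"
      using z seqs_closed(2)[OF z(1) y] by (simp add: cls_eq[OF x] algebra_simps)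
    then show "z \<in> (\<Union>a\<in>cls x. \<Union>b\<in>cls y. {\<lambda>n. a n + b n})"
      using cls_mem[OF y] by force
  qed
  finally show ?thesis .
qed

lemma U_smult:
  assumes x: "x \<in> bounded_seqs M" shows "c \<odot>\<^bsub>U\<^esub> cls x = cls (\<lambda>n. c *\<^sub>C x n)"
proof -
  have "cls (\<lambda>n. c *\<^sub>C a n) = cls (\<lambda>n. c *\<^sub>C x n)" if "a \<in> cls x" for a
  proof -
    note a' = cls_memD[OF x that]
    show ?thesis
      using null_seqs_scaleC[OF a'(2), of c] cls_eq_iff[OF seqs_closed(4)[OF a'(1)] seqs_closed(4)[OF x]]
      by (simp add: scaleC_op_simps(10))
  qed
  then have "(\<Union>a\<in>cls x. cls (\<lambda>n. c *\<^sub>C a n)) = cls (\<lambda>n. c *\<^sub>C x n)"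
    by (intro UN_constant_eq[OF cls_mem[OF x]] ballI)
  moreover have "c \<odot>\<^bsub>U\<^esub> cls x = (\<Union>a\<in>cls x. cls (\<lambda>n. c *\<^sub>C a n))"
    by (simp add: ultrapower_def Let_def flip: ultrapower_class_def) (simp add: l_infinity_def)
  ultimately show ?thesis by simp
qed

lemma U_star:
  assumes x: "x \<in> bounded_seqs M" shows "star U (cls x) = cls (\<lambda>n. adj (x n))"
proof -
  have "cls (\<lambda>n. adj (a n)) = cls (\<lambda>n. adj (x n))" if "a \<in> cls x" for a
  proof -
    note a' = cls_memD[OF x that]
    show ?thesis
      using null_seqs_adj[OF a'(2)] cls_eq_iff[OF seqs_closed(5)[OF a'(1)] seqs_closed(5)[OF x]]
      by simp
  qed
  then have "(\<Union>a\<in>cls x. cls (\<lambda>n. adj (a n))) = cls (\<lambda>n. adj (x n))"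
    by (intro UN_constant_eq[OF cls_mem[OF x]] ballI)
  moreover have "star U (cls x) = (\<Union>a\<in>cls x. cls (\<lambda>n. adj (a n)))"
    by (simp add: ultrapower_def Let_def flip: ultrapower_class_def)
  ultimately show ?thesis by simp
qed

lemma null_seqs_tau: assumes "x \<in> null_seqs" shows "((\<lambda>n. \<tau> (x n)) \<longlongrightarrow> 0) \<omega>"
proof -
  have lim: "((\<lambda>n. sqrt (Re (\<tau> (adj (x n) * x n)))) \<longlongrightarrow> sqrt 0) \<omega>"
    using assms by (intro tendsto_real_sqrt) (simp add: null_seqs_iff)
  have le: "cmod (\<tau> (x n)) \<le> sqrt (Re (\<tau> (adj (x n) * x n)))" for n
    using assms cmod_tau_le[of "x n"] by (intro real_le_rsqrt) (simp add: null_seqs_iff bounded_seqs_mem)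
  show ?thesis
    by (rule Lim_null_comparison[OF always_eventually lim[unfolded real_sqrt_zero]]) (simp add: le)
qed

lemma U_tr:
  assumes x: "x \<in> bounded_seqs M" and t: "((\<lambda>n. \<tau> (x n)) \<longlongrightarrow> t) \<omega>"
  shows "tr U (cls x) = t"
proof -
  have "((\<lambda>n. \<tau> (a n)) \<longlongrightarrow> t) \<omega>" if "a \<in> cls x" for a
  proof -
    note a' = cls_memD[OF x that]
    have "\<tau> (a n) = \<tau> (a n - x n) + \<tau> (x n)" for n
      using bounded_seqs_mem[OF x] bounded_seqs_mem[OF a'(1)] by (simp add: tau_diff)
    then show ?thesis using tendsto_add[OF null_seqs_tau[OF a'(2)] t] by simp
  qed
  then have "(THE t. \<forall>a\<in>cls x. ((\<lambda>n. \<tau> (a n)) \<longlongrightarrow> t) \<omega>) = t"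
    using cls_mem[OF x] by (intro the_equality) (auto intro: tendsto_unique[OF \<omega>_nontrivial])
  then show ?thesis by (simp add: ultrapower_def Let_def)
qed

lemma tau_ultralimit:
  assumes "x \<in> bounded_seqs M"
  obtains t where "((\<lambda>n. \<tau> (x n)) \<longlongrightarrow> t) \<omega>"
proof -
  obtain K where K: "\<And>n. norm (x n) \<le> K" "\<And>n. x n \<in> M" using bounded_seqsE[OF assms] by metis
  have "\<tau> (x n) \<in> cball 0 K" for n
    using cmod_tau_norm_le[OF K(2)] K(1) order_trans by (simp add: dist_norm) blast
  then show ?thesis using ultrafilter_compact_limit[OF ultra compact_cball] that by metis
qed

text \<open>The representative picked by \<open>SOME\<close> is immaterial by
  \<open>expect_U_cls\<close>. The restriction to the carrier is forced, because conditional
  expectations are extensional functions here.\<close>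

definition expect_U :: "(nat \<Rightarrow> 'h bounded_op) set \<Rightarrow> (nat \<Rightarrow> 'h bounded_op) set" where
  "expect_U = restrict (\<lambda>X. cls (\<lambda>n. expect ((SOME x. x \<in> bounded_seqs M \<and> X = cls x) n))) (carrier U)"

lemma expect_U_cls:
  assumes x: "x \<in> bounded_seqs M" shows "expect_U (cls x) = cls (\<lambda>n. expect (x n))"
proof -
  define y where "y = (SOME y. y \<in> bounded_seqs M \<and> cls x = cls y)"
  have "y \<in> bounded_seqs M \<and> cls x = cls y" unfolding y_def by (rule someI[of _ x]) (simp add: x)
  then have y: "y \<in> bounded_seqs M" "(\<lambda>n. y n - x n) \<in> null_seqs"
    using cls_eq_iff[OF _ x] by auto
  have m: "x n \<in> M" "y n \<in> M" for n using x y(1) bounded_seqs_mem by auto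
  have "(\<lambda>n. expect (y n) - expect (x n)) \<in> null_seqs"
  proof (rule null_seqs_dominated[OF _ y(2), of _ 1])
    show "(\<lambda>n. expect (y n) - expect (x n)) \<in> bounded_seqs M"
      by (intro seqs_closed(2) bounded_seqs_A expect_seq x y)
    show "Re (\<tau> (adj (expect (y n) - expect (x n)) * (expect (y n) - expect (x n))))
        \<le> 1 * Re (\<tau> (adj (y n - x n) * (y n - x n)))" for n
      using expect_contraction[of "y n - x n"] m by (simp only: expect_diff closed mult_1)
  qed
  then have "cls (\<lambda>n. expect (y n)) = cls (\<lambda>n. expect (x n))"
    by (subst cls_eq_iff) (auto intro: bounded_seqs_A expect_seq x y)
  then show ?thesis using x by (simp add: expect_U_def U_carrier flip: y_def)
qed

lemma sub_ultrapower_eq: "sub_ultrapower \<omega> M \<tau> A = cls ` bounded_seqs A"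
  by (simp add: sub_ultrapower_def)

lemma cond_exp_ultrapower: "cond_exp U (sub_ultrapower \<omega> M \<tau> A) = expect_U"
  unfolding sub_ultrapower_eq
proof (rule cond_exp_eqI)
  note m = bounded_seqs_mem
  show "is_trace_preserving_cond_exp U (cls ` bounded_seqs A) expect_U"
    unfolding is_trace_preserving_cond_exp_def
  proof (intro conjI ballI allI)
    show "expect_U \<in> carrier U \<rightarrow>\<^sub>E cls ` bounded_seqs A"
    proof (rule PiE_I)
      show "expect_U X \<in> cls ` bounded_seqs A" if "X \<in> carrier U" for X
        using that by (auto simp: U_carrier expect_U_cls expect_seq)
    qed (simp add: expect_U_def)
  next
    fix X Y assume "X \<in> carrier U" "Y \<in> carrier U"
    then obtain x y where xy: "x \<in> bounded_seqs M" "X = cls x" "y \<in> bounded_seqs M" "Y = cls y"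
      by (auto simp: U_carrier)
    then show "expect_U (X \<oplus>\<^bsub>U\<^esub> Y) = expect_U X \<oplus>\<^bsub>U\<^esub> expect_U Y"
      by (simp add: U_add expect_U_cls seqs_closed expect_seq bounded_seqs_A expect_add m)
  next
    fix c X assume "X \<in> carrier U"
    then show "expect_U (c \<odot>\<^bsub>U\<^esub> X) = c \<odot>\<^bsub>U\<^esub> expect_U X"
      by (auto simp: U_carrier U_smult expect_U_cls seqs_closed expect_seq bounded_seqs_A expect_scaleC m)
  next
    fix X assume "X \<in> positives U"
    then obtain y where y: "y \<in> bounded_seqs M" "X = star U (cls y) \<otimes>\<^bsub>U\<^esub> cls y"
      by (auto simp: positives_def U_carrier)
    define z where "z n = expect (adj (y n) * y n)" for n
    have yy: "(\<lambda>n. adj (y n) * y n) \<in> bounded_seqs M" by (intro seqs_closed y)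
    have z: "z \<in> bounded_seqs A" unfolding z_def by (rule expect_seq[OF yy])
    have X: "expect_U X = cls z"
      unfolding y(2) z_def using y yy by (simp add: U_star U_mult seqs_closed expect_U_cls)
    \<comment> \<open>The square root of a positive class is taken termwise; |s n|^2 <= |z n| keeps
      the roots bounded.\<close>
    have "\<exists>s\<in>A. op_pos s \<and> s * s = z n" for n
      using vna_sqrt[OF vna_A m[OF z]] expect_pos[OF m[OF yy] op_pos_square] unfolding z_def by metis
    then obtain s where s: "\<And>n. s n \<in> A" "\<And>n. op_pos (s n)" "\<And>n. s n * s n = z n" by metis
    obtain K where K: "\<And>n. norm (z n) \<le> K" using bounded_seqsE[OF z] by metis
    have "s \<in> bounded_seqs A"
    proof (rule bounded_seqsI[OF s(1)])
      fix n
      have "(norm (s n))\<^sup>2 \<le> K"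
        using op_norm_sq_le[of "s n"] s(2,3)[of n] K[of n] by (simp add: op_pos_adj)
      then show "norm (s n) \<le> sqrt K" by (rule real_le_rsqrt)
    qed
    then have "s \<in> bounded_seqs M" by (rule bounded_seqs_A)
    moreover from this have "expect_U X = star U (cls s) \<otimes>\<^bsub>U\<^esub> cls s"
      using s by (simp add: X U_star U_mult seqs_closed op_pos_adj)
    ultimately show "expect_U X \<in> positives U" by (auto simp: positives_def U_carrier)
  next
    fix b assume "b \<in> cls ` bounded_seqs A"
    then show "expect_U b = b" by (auto simp: expect_U_cls bounded_seqs_A expect_ident m)
  next
    fix b b' X assume "b \<in> cls ` bounded_seqs A" "b' \<in> cls ` bounded_seqs A" "X \<in> carrier U"
    then obtain a a' x where "a \<in> bounded_seqs A" "b = cls a" "a' \<in> bounded_seqs A" "b' = cls a'"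
      "x \<in> bounded_seqs M" "X = cls x" by (auto simp: U_carrier)
    then show "expect_U (b \<otimes>\<^bsub>U\<^esub> X \<otimes>\<^bsub>U\<^esub> b') = b \<otimes>\<^bsub>U\<^esub> expect_U X \<otimes>\<^bsub>U\<^esub> b'"
      by (simp add: U_mult expect_U_cls seqs_closed expect_seq bounded_seqs_A expect_bimodule m)
  next
    fix X assume "X \<in> carrier U"
    then obtain x where x: "x \<in> bounded_seqs M" "X = cls x" by (auto simp: U_carrier)
    obtain t where t: "((\<lambda>n. \<tau> (x n)) \<longlongrightarrow> t) \<omega>" using tau_ultralimit[OF x(1)] by metis
    have "((\<lambda>n. \<tau> (expect (x n))) \<longlongrightarrow> t) \<omega>" using t m[OF x(1)] by (simp add: tau_expect)
    then show "tr U (expect_U X) = tr U X"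
      using U_tr[OF x(1) t] U_tr[OF bounded_seqs_A[OF expect_seq[OF x(1)]]] x
      by (simp add: expect_U_cls)
  qed
  show "\<one>\<^bsub>U\<^esub> \<in> cls ` bounded_seqs A" unfolding U_one by (intro imageI const_seq A_closed)
  show "\<one>\<^bsub>U\<^esub> \<otimes>\<^bsub>U\<^esub> X = X" if "X \<in> carrier U" for X
    using that by (auto simp: U_carrier U_one U_mult const_seq)
  show "cls ` bounded_seqs A \<subseteq> carrier U" by (auto simp: U_carrier intro: bounded_seqs_A)
  show "X \<otimes>\<^bsub>U\<^esub> Y \<in> carrier U" if "X \<in> carrier U" "Y \<in> carrier U" for X Y
    using that by (auto simp: U_carrier U_mult intro: seqs_closed)
next
  fix X Y assume "X \<in> cls ` bounded_seqs A" "Y \<in> cls ` bounded_seqs A"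
    and eq: "\<And>b. b \<in> cls ` bounded_seqs A \<Longrightarrow> tr U (X \<otimes>\<^bsub>U\<^esub> b) = tr U (Y \<otimes>\<^bsub>U\<^esub> b)"
  then obtain x y where x: "x \<in> bounded_seqs A" "X = cls x" and y: "y \<in> bounded_seqs A" "Y = cls y"
    by auto
  \<comment> \<open>Testing against the class of the adjoint of d shows that d tends to 0 in 2-norm
    along \<omega>, which is equality of the two cosets.\<close>
  define d where "d n = x n - y n" for n
  have d: "d \<in> bounded_seqs A" unfolding d_def by (intro bounded_seqs_closed[OF vna_A] x y)
  have d': "(\<lambda>n. adj (d n)) \<in> bounded_seqs A" by (intro bounded_seqs_closed[OF vna_A] d)
  have xd: "(\<lambda>n. x n * adj (d n)) \<in> bounded_seqs M" and yd: "(\<lambda>n. y n * adj (d n)) \<in> bounded_seqs M"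
    by (intro bounded_seqs_A bounded_seqs_closed[OF vna_A] d' x y)+
  obtain s where s: "((\<lambda>n. \<tau> (x n * adj (d n))) \<longlongrightarrow> s) \<omega>" using tau_ultralimit[OF xd] by metis
  obtain t where t: "((\<lambda>n. \<tau> (y n * adj (d n))) \<longlongrightarrow> t) \<omega>" using tau_ultralimit[OF yd] by metis
  have "s = t"
    using eq[of "cls (\<lambda>n. adj (d n))"] U_tr[OF xd s] U_tr[OF yd t] x y d'
    by (simp add: U_mult bounded_seqs_A)
  have "\<tau> (adj (d n) * d n) = \<tau> (x n * adj (d n)) - \<tau> (y n * adj (d n))" for n
  proof -
    have "x n \<in> A" "y n \<in> A" "d n \<in> A" using x y d bounded_seqs_mem by auto
    then show ?thesis
      using tau_commute[of "d n" "adj (d n)"]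
        tau_diff[of "x n * adj (d n)" "y n * adj (d n)"] by (simp add: left_diff_distrib d_def)
  qed
  then have "((\<lambda>n. \<tau> (adj (d n) * d n)) \<longlongrightarrow> 0) \<omega>"
    using tendsto_diff[OF s t] \<open>s = t\<close> by simp
  from tendsto_Re[OF this] have "d \<in> null_seqs"
    using bounded_seqs_A[OF d] by (simp add: null_seqs_iff)
  then show "X = Y"
    using x y by (simp add: cls_eq_iff bounded_seqs_A d_def[abs_def])
qed

lemma const_embedding_eq: "const_embedding \<omega> M \<tau> a = cls (\<lambda>n. a)"
  by (simp add: const_embedding_def)

lemma const_embedding_ortho_minus:
  assumes "x \<in> M" "expect x = 0"
  shows "const_embedding \<omega> M \<tau> x \<in> ortho_minus U (sub_ultrapower \<omega> M \<tau> A)"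
  using assms by (auto simp: ortho_minus_def cond_exp_ultrapower const_embedding_eq U_carrier
      expect_U_cls const_seq U_zero)

end

subsection \<open>Singularity\<close>

lemma commutant_triple: "commutant (commutant (commutant S)) = commutant S"
  by (auto simp: commutant_def)

lemma diffuse_split:
  assumes "diffuse A" "p \<in> projections A" "p \<noteq> 0"
  obtains e where "e \<in> projections A" "p * e = e" "e \<noteq> 0" "e \<noteq> p"
  using assms by (auto simp: diffuse_def minimal_projection_def)

lemma scaleC_zero_op: "c *\<^sub>C (0 :: 'h::complex_hilbert_space bounded_op) = 0"
  using scaleC_op_simps(10)[of c 0 "0 :: 'h bounded_op"] by simp

context tracial_abelian
begin

text \<open>The set is itself a commutant, namely of the commutant of \<open>A\<close> together with
  x, hence it equals its double commutant. Self-adjointness of x gives closure under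
  adjoints.\<close>

lemma relative_commutant_subalgebra:
  assumes "adj x = x"
  shows "von_neumann_subalgebra {a \<in> A. a * x = x * a} A"
proof -
  let ?C = "{a \<in> A. a * x = x * a}"
  have C: "?C = commutant (commutant A \<union> {x})"
  proof (rule Set.set_eqI)
    show "a \<in> ?C \<longleftrightarrow> a \<in> commutant (commutant A \<union> {x})" for a
      using vna_double_commutant[OF vna_A, of a] commutant_def[of "commutant A \<union> {x}"] by auto
  qed
  have "commutant (commutant ?C) = ?C"
    unfolding C by (rule commutant_triple)
  moreover have "adj a \<in> ?C" if "a \<in> ?C" for a
  proof -
    have "adj (a * x) = adj (x * a)" using that by simp
    then show ?thesis using that assms by simp
  qed
  ultimately show ?thesis
    by (simp add: von_neumann_subalgebra_def von_neumann_algebra_def)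
qed

lemma strong_asymptotic_orthogonality_vanish:
  assumes saop: "strong_asymptotic_orthogonality \<omega> M \<tau> A"
    and x: "x \<in> M" "adj x = x" "expect x = 0"
    and diff: "diffuse {a \<in> A. a * x = x * a}"
  shows "x = 0"
proof -
  let ?C = "{a \<in> A. a * x = x * a}" and ?\<iota> = "const_embedding \<omega> M \<tau>"
  have o: "x \<in> ortho_minus (tracial_vna M \<tau>) A"
    using x by (simp add: ortho_minus_tracial_vna)
  have cm: "?\<iota> a \<otimes>\<^bsub>U\<^esub> ?\<iota> b = ?\<iota> (a * b)" if "a \<in> M" "b \<in> M" for a b
    using that by (simp add: const_embedding_eq U_mult const_seq)
  have "\<forall>c\<in>?C. ?\<iota> c \<otimes>\<^bsub>U\<^esub> ?\<iota> x = ?\<iota> x \<otimes>\<^bsub>U\<^esub> ?\<iota> c"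
    using x by (simp add: cm)
  then have "L2_inner U (?\<iota> x \<otimes>\<^bsub>U\<^esub> ?\<iota> x) (?\<iota> x \<otimes>\<^bsub>U\<^esub> ?\<iota> x) = 0"
    using saop relative_commutant_subalgebra[OF x(2)] diff o
      const_embedding_ortho_minus[OF x(1,3)]
    unfolding strong_asymptotic_orthogonality_def Let_def by blast
  moreover have "L2_inner U (?\<iota> x \<otimes>\<^bsub>U\<^esub> ?\<iota> x) (?\<iota> x \<otimes>\<^bsub>U\<^esub> ?\<iota> x) = \<tau> (adj (x * x) * (x * x))"
  proof -
    have "star U (?\<iota> (x * x)) \<otimes>\<^bsub>U\<^esub> ?\<iota> (x * x) = cls (\<lambda>n. adj (x * x) * (x * x))"
      using x(1) by (simp add: const_embedding_eq U_star U_mult const_seq del: adj_simps)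
    moreover have "tr U (cls (\<lambda>n. adj (x * x) * (x * x))) = \<tau> (adj (x * x) * (x * x))"
      using x(1) by (intro U_tr const_seq tendsto_const) simp
    ultimately show ?thesis using x(1) by (simp add: L2_inner_def cm)
  qed
  \<comment> \<open>Faithfulness is applied first to x x and then to x, where adj x x = x x.\<close>
  ultimately have "x * x = 0" using x(1) by (intro tau_faithful_star) auto
  then show "x = 0" using x by (intro tau_faithful_star) auto
qed

lemma commuting_unitary_in_A:
  assumes saop: "strong_asymptotic_orthogonality \<omega> M \<tau> A" and "diffuse A"
    and w: "w \<in> M" "\<And>a. a \<in> A \<Longrightarrow> w * a = a * w"
  shows "w \<in> A"
proof -
  define u where "u = w - expect w"
  have u: "u \<in> M" "expect u = 0"
    using w by (auto simp: u_def expect_diff expect_ident)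
  have uA: "a * u = u * a" if "a \<in> A" for a
    using that w A_commute[of a "expect w"] by (simp add: u_def algebra_simps)
  have uA': "a * adj u = adj u * a" if a: "a \<in> A" for a
  proof -
    have "adj (adj a * u) = adj (u * adj a)" using uA[of "adj a"] a by simp
    then show ?thesis by simp
  qed
  have *: "h = 0" if "h \<in> M" "adj h = h" "expect h = 0" "\<And>a. a \<in> A \<Longrightarrow> a * h = h * a" for h
  proof -
    have "{a \<in> A. a * h = h * a} = A" using that(4) by auto
    then show ?thesis
      using strong_asymptotic_orthogonality_vanish[OF saop that(1-3)] assms(2) by simp
  qed
  have "u + adj u = 0"
  proof (rule *)
    show "u + adj u \<in> M" "adj (u + adj u) = u + adj u" using u by (simp_all add: add.commute)
    show "expect (u + adj u) = 0" using u by (simp add: expect_add expect_adj)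
    show "a * (u + adj u) = (u + adj u) * a" if "a \<in> A" for a
      by (simp only: distrib_left distrib_right uA[OF that] uA'[OF that])
  qed
  moreover have "\<i> *\<^sub>C (adj u - u) = 0"
  proof (rule *)
    show "\<i> *\<^sub>C (adj u - u) \<in> M" using u by simp
    show "adj (\<i> *\<^sub>C (adj u - u)) = \<i> *\<^sub>C (adj u - u)" by (rule vna_self_adjoint_comb)
    show "expect (\<i> *\<^sub>C (adj u - u)) = 0"
      using u by (simp add: expect_scaleC expect_diff expect_adj scaleC_op_simps(10))
    show "a * (\<i> *\<^sub>C (adj u - u)) = (\<i> *\<^sub>C (adj u - u)) * a" if "a \<in> A" for a
      by (simp only: scaleC_op_simps(1,2) left_diff_distrib right_diff_distrib uA[OF that] uA'[OF that])
  qed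
  ultimately have "u = 0"
    using vna_self_adjoint_comb(1)[of u] by (simp add: scaleC_zero_op)
  then show ?thesis using expect_A[OF w(1)] by (simp add: u_def)
qed

text \<open>q = p (1 - \<theta>(p)) is the part of p outside its image. If it were 0, then p would
  lie below \<theta>(p), which has the same trace, and faithfulness would give \<theta>(p) = p, so
  that w commutes with p. Since \<theta>(q) lies below \<theta>(p), it is orthogonal to q.\<close>

lemma displaced_projection:
  assumes w: "w \<in> M" "unitary w" "\<And>a. a \<in> A \<Longrightarrow> w * a * adj w \<in> A"
    and p: "p \<in> projections A" "w * p \<noteq> p * w"
  obtains q where "q \<in> projections A" "q \<noteq> 0" "q * (w * q * adj w) = 0"
proof -
  define \<theta> where "\<theta> a = w * a * adj w" for a
  have ww: "adj w * w = 1" using w(2) by (simp add: unitary_def)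
  have ww': "adj w * (w * c) = c" for c using ww by (simp flip: mult.assoc)
  have \<theta>_mult: "\<theta> (a * b) = \<theta> a * \<theta> b" for a b
    by (simp add: \<theta>_def mult.assoc ww')
  have \<theta>_A [simp]: "\<theta> a \<in> A" if "a \<in> A" for a using w(3)[OF that] by (simp add: \<theta>_def)
  have pA [simp]: "p \<in> A" and pp: "p * p = p" and ap: "adj p = p"
    using p(1) by (auto simp: projections_def)
  have tp: "\<theta> p * \<theta> p = \<theta> p" using \<theta>_mult[of p p] pp by simp
  have atp: "adj (\<theta> p) = \<theta> p" by (simp add: \<theta>_def ap mult.assoc)
  have ne: "\<theta> p \<noteq> p"
  proof
    assume "\<theta> p = p"
    then have "\<theta> p * w = p * w" by simp
    then show False using p(2) by (simp add: \<theta>_def mult.assoc ww)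
  qed
  define q where "q = p * (1 - \<theta> p)"
  have qA: "q \<in> A" by (simp add: q_def)
  have "q \<in> projections A"
  proof -
    have "adj q = q" using A_commute[of p "\<theta> p"] by (simp add: q_def ap atp algebra_simps)
    moreover have "q * q = (p * p) * ((1 - \<theta> p) * (1 - \<theta> p))"
      using A_left_commute[of "1 - \<theta> p" p "1 - \<theta> p"] by (simp add: q_def mult.assoc)
    then have "q * q = q" by (simp add: pp tp algebra_simps q_def)
    ultimately show ?thesis using qA by (simp add: projections_def)
  qed
  moreover have "q \<noteq> 0"
  proof
    assume "q = 0"
    then have le: "p * \<theta> p = p" by (simp add: q_def right_diff_distrib)
    let ?d = "\<theta> p - p"
    have "adj ?d * ?d = \<theta> p * \<theta> p - \<theta> p * p - (p * \<theta> p - p * p)"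
      by (simp add: ap atp algebra_simps)
    also have "\<dots> = \<theta> p - p"
      using A_commute[of "\<theta> p" p] by (simp add: tp pp le)
    finally have "\<tau> (adj ?d * ?d) = \<tau> (\<theta> p) - \<tau> p" by (simp add: tau_diff)
    also have "\<tau> (\<theta> p) = \<tau> (adj w * (w * p))"
      unfolding \<theta>_def using w(1) by (intro tau_commute) auto
    finally have "\<tau> (adj ?d * ?d) = 0" by (simp add: ww')
    then have "?d = 0" by (intro tau_faithful_star) auto
    then show False using ne by simp
  qed
  moreover have "q * \<theta> q = 0"
  proof -
    have "\<theta> q = \<theta> p * \<theta> (1 - \<theta> p)" unfolding q_def by (rule \<theta>_mult)
    moreover have "(1 - \<theta> p) * \<theta> p = 0" by (simp add: left_diff_distrib tp)
    then have "q * \<theta> p = 0" by (simp add: q_def mult.assoc)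
    ultimately show ?thesis by (metis mult.assoc mult_zero_left)
  qed
  ultimately show ?thesis using that by (simp add: \<theta>_def)
qed

text \<open>If \<open>w\<close> moves a projection \<open>q\<close> of \<open>A\<close> to a disjoint one, then \<open>x = wq + qw\<^sup>*\<close> is
  orthogonal to \<open>A\<close>. It commutes with the copy of the diffuse algebra \<open>Aq\<close> embedded as
  \<open>a \<mapsto> a + waw\<^sup>*\<close> and with \<open>A(1 - q - wqw\<^sup>*)\<close>, so that its relative commutant in \<open>A\<close>
  is diffuse.\<close>

lemma no_displaced_projection:
  assumes saop: "strong_asymptotic_orthogonality \<omega> M \<tau> A" and diff: "diffuse A"
    and w: "w \<in> M" "unitary w" "\<And>a. a \<in> A \<Longrightarrow> w * a * adj w \<in> A"
    and q: "q \<in> projections A" "q * (w * q * adj w) = 0"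
  shows "q = 0"
proof -
  define \<theta> where "\<theta> a = w * a * adj w" for a
  have ww: "adj w * w = 1" using w(2) by (simp add: unitary_def)
  have ww': "adj w * (w * c) = c" for c using ww by (simp flip: mult.assoc)
  have \<theta>_mult: "\<theta> (a * b) = \<theta> a * \<theta> b" for a b
    by (simp add: \<theta>_def mult.assoc ww')
  have \<theta>_w: "\<theta> a * w = w * a" and w_\<theta>: "adj w * \<theta> a = a * adj w" for a
    by (simp_all add: \<theta>_def mult.assoc ww ww')
  have \<theta>_A [simp]: "\<theta> a \<in> A" if "a \<in> A" for a using w(3)[OF that] by (simp add: \<theta>_def)
  have \<theta>_proj: "\<theta> e \<in> projections A" if "e \<in> projections A" for e
    using that \<theta>_mult[of e e] by (simp add: projections_def) (simp add: \<theta>_def mult.assoc)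
  have qA [simp]: "q \<in> A" and qq: "q * q = q" and aq: "adj q = q"
    using q(1) by (auto simp: projections_def)
  have atq: "adj (\<theta> q) = \<theta> q" and tqtq: "\<theta> q * \<theta> q = \<theta> q"
    using \<theta>_proj[OF q(1)] by (auto simp: projections_def)
  have qt: "q * \<theta> q = 0" using q(2) by (simp add: \<theta>_def)
  have tq: "\<theta> q * q = 0" using qt A_commute[of q "\<theta> q"] by simp
  define x where "x = w * q + q * adj w"
  have x: "x \<in> M" "adj x = x" using w(1) by (auto simp: x_def aq)
  have wq: "w * q = \<theta> q * w * q" by (simp only: \<theta>_w mult.assoc qq)
  have qwq: "q * (w * q) = 0"
    by (subst \<theta>_w[symmetric]) (simp add: qt flip: mult.assoc)
  have qwq': "q * (adj w * q) = 0"
    using arg_cong[OF qwq, of adj] by (simp add: aq mult.assoc)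
  have xq: "x * q = w * q"
    by (simp add: x_def distrib_right mult.assoc qq qwq')
  have xtq: "x * \<theta> q = q * adj w"
    by (simp add: x_def distrib_right mult.assoc qt w_\<theta>) (simp add: qq flip: mult.assoc)
  \<comment> \<open>w q = \<theta>(q) w q, so the module property gives E(w q) = \<theta>(q) E(w) q,
    which is 0 because \<open>A\<close> is abelian and \<theta>(q) q = 0.\<close>
  have "expect x = 0"
  proof -
    have "expect (w * q) = \<theta> q * expect w * q"
      unfolding arg_cong[OF wq, of expect] using w(1) by (intro expect_bimodule) auto
    also have "\<dots> = expect w * (\<theta> q * q)"
      using w(1) A_left_commute[of "\<theta> q" "expect w" q] by (simp add: mult.assoc)
    finally have 1: "expect (w * q) = 0" by (simp add: tq)
    have "q * adj w = adj (w * q)" by (simp add: aq)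
    then have "expect (q * adj w) = adj (expect (w * q))"
      using w(1) by (simp only: expect_adj closed A_M qA)
    then show ?thesis using w(1) 1 by (simp add: x_def expect_add)
  qed
  define C where "C = {a \<in> A. a * x = x * a}"
  have C_iff: "a \<in> projections C \<longleftrightarrow> a \<in> projections A \<and> a * x = x * a" for a
    by (auto simp: C_def projections_def)
  \<comment> \<open>For self-adjoint a the adjoint of a x is x a, so commutation becomes
    self-adjointness of a x.\<close>
  have commI: "a * x = x * a" if "adj a = a" "adj (a * x) = a * x" for a
    using that x(2) by simp
  define r where "r = 1 - q - \<theta> q"
  have rA [simp]: "r \<in> A" by (simp add: r_def)
  have ar: "adj r = r" by (simp add: r_def aq atq)
  have rr: "r * r = r" by (simp add: r_def algebra_simps qq qt tq tqtq)
  have xr: "x * r = 0"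
    by (simp add: r_def right_diff_distrib xq xtq) (simp add: x_def)
  have rx: "r * x = 0" using arg_cong[OF xr, of adj] by (simp add: x ar)
  have "diffuse C"
    unfolding diffuse_def
  proof
    assume "\<exists>p. minimal_projection C p"
    then obtain p where p: "p \<in> projections C" "p \<noteq> 0"
      and min: "\<And>e. e \<in> projections C \<Longrightarrow> p * e = e \<Longrightarrow> e = 0 \<or> e = p"
      by (auto simp: minimal_projection_def)
    have pA [simp]: "p \<in> A" and pproj: "p \<in> projections A" and pp: "p * p = p" and ap: "adj p = p"
      and px: "p * x = x * p"
      using p(1) unfolding C_iff by (auto simp: projections_def)
    have prc: "p * r = r * p" and pqc: "p * q = q * p" by (simp_all add: A_commute)
    \<comment> \<open>x vanishes on r from both sides, so p r commutes with x. Minimality then puts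
      p either under r or under q + \<theta>(q).\<close>
    have "p * r \<in> projections C"
    proof -
      have "(p * r) * (p * r) = p * r"
        using A_left_commute[of r p r] by (simp add: mult.assoc rr) (simp add: pp flip: mult.assoc)
      moreover have "p * r * x = x * (p * r)"
        using px xr rx prc by (metis mult.assoc mult_zero_left mult_zero_right)
      ultimately show ?thesis
        unfolding C_iff by (simp add: projections_def ap ar flip: prc)
    qed
    then consider "p * r = p" | "p * r = 0"
      using min[of "p * r"] by (auto simp: pp simp flip: mult.assoc)
    then show False
    proof cases
      case 1
      \<comment> \<open>Everything in \<open>A\<close> under r commutes with x, so a nonzero proper
        subprojection of p in \<open>A\<close> already contradicts minimality in C.\<close>
      obtain e where e: "e \<in> projections A" "p * e = e" "e \<noteq> 0" "e \<noteq> p"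
        using diffuse_split[OF diff pproj p(2)] by metis
      have eA: "e \<in> A" using e(1) by (simp add: projections_def)
      have "r * e = e" using 1 e(2) prc by (metis mult.assoc)
      moreover from this have "e * r = e" using A_commute[of e r] eA by simp
      ultimately have "e * x = x * e" by (metis mult.assoc mult_zero_left mult_zero_right rx xr)
      then show False using min[of e] e by (simp add: C_iff)
    next
      case 2
      have split: "p = p * q + p * \<theta> q"
        using 2 by (simp add: r_def right_diff_distrib diff_diff_eq distrib_left)
      \<comment> \<open>Compressing p x = x p by q shows that the part of p under \<theta>(q) is
        \<theta>(p q). Hence p is determined by p q, which is therefore nonzero and can be split in
        \<open>A\<close>.\<close>
      have "p * (w * q) = w * (q * p)"
        using px xq pqc by (metis mult.assoc)
      then have ptq: "p * \<theta> q = \<theta> (p * q)"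
        by (simp add: \<theta>_def pqc flip: mult.assoc)
      have pq: "p * q \<in> projections A"
        using A_left_commute[of q p q] arg_cong[OF pp, of "\<lambda>z. z * q"] by (simp add: projections_def ap aq mult.assoc qq flip: pqc)
      moreover have "p * q \<noteq> 0"
      proof
        assume "p * q = 0"
        moreover have "\<theta> 0 = 0" by (simp add: \<theta>_def)
        ultimately show False using split ptq p(2) by simp
      qed
      ultimately obtain e where e: "e \<in> projections A" "p * q * e = e" "e \<noteq> 0" "e \<noteq> p * q"
        using diffuse_split[OF diff] by metis
      have eA [simp]: "e \<in> A" and ee: "e * e = e" and ae: "adj e = e"
        using e(1) by (auto simp: projections_def)
      have pe: "p * e = e" using e(2) by (metis mult.assoc pp)
      have qe: "q * e = e" using e(2) A_left_commute[of q p] by (metis mult.assoc qA pA qq pqc)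
      have eq: "e * q = e" using qe A_commute[of e q] by simp
      have te: "\<theta> e * \<theta> e = \<theta> e" "adj (\<theta> e) = \<theta> e"
        using \<theta>_proj[OF e(1)] by (auto simp: projections_def)
      have teq: "\<theta> e * q = 0"
        using \<theta>_mult[of e q] eq tq by (metis mult.assoc mult_zero_right)
      have qte: "q * \<theta> e = 0" using teq A_commute[of q "\<theta> e"] by simp
      have ete: "e * \<theta> e = 0" using eq qte by (metis mult.assoc mult_zero_right)
      have tee: "\<theta> e * e = 0" using ete A_commute[of e "\<theta> e"] by simp
      \<comment> \<open>x exchanges the ranges of q and \<theta>(q), so e alone does not commute
        with x, but its sum with its image does.\<close>
      define f where "f = e + \<theta> e"
      have "f \<in> projections A"
        by (simp add: projections_def f_def ae te algebra_simps ee ete tee)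
      moreover have "f * x = x * f"
      proof (rule commI)
        show "adj f = f" by (simp add: f_def ae te)
        have 1: "e * x = e * adj w"
        proof -
          have "e * (w * q) = 0" using eq qwq by (metis mult.assoc mult_zero_right)
          then show ?thesis by (simp add: x_def distrib_left eq flip: mult.assoc)
        qed
        have 2: "\<theta> e * x = w * e"
        proof -
          have "\<theta> e * (w * q) = w * e" by (metis \<theta>_w eq mult.assoc)
          moreover have "\<theta> e * (q * adj w) = 0" by (simp add: teq flip: mult.assoc)
          ultimately show ?thesis by (simp add: x_def distrib_left)
        qed
        show "adj (f * x) = f * x"
          by (simp add: f_def distrib_right 1 2 ae del: adj_simps(9)) (simp add: ae add.commute)
      qed
      moreover have "p * f = f"
      proof -
        have "\<theta> e = \<theta> q * \<theta> e" by (simp add: qe flip: \<theta>_mult)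
        then have "p * \<theta> e = \<theta> (p * q) * \<theta> e" by (metis mult.assoc ptq)
        also have "\<dots> = \<theta> e" by (simp add: e(2) flip: \<theta>_mult)
        finally show ?thesis by (simp add: f_def distrib_left pe)
      qed
      ultimately have "f = 0 \<or> f = p" using min[of f] by (simp add: C_iff)
      \<comment> \<open>Multiplication by q recovers e: f = 0 would give e = 0, and f = p would give
        e = p q.\<close>
      moreover have "f * q = e" by (simp add: f_def distrib_right eq teq)
      ultimately show False using e(3,4) by auto
    qed
  qed
  then have "x = 0"
    using strong_asymptotic_orthogonality_vanish[OF saop x \<open>expect x = 0\<close>] by (simp add: C_def)
  then have "w * q = 0" using xq by simp
  then show "q = 0" using ww' by (metis mult_zero_right)
qed

end

theorem proposition34:
  fixes M A :: "'h::complex_hilbert_space bounded_op set"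
    and \<tau> :: "'h bounded_op \<Rightarrow> complex"
    and \<omega> :: "nat filter"
  assumes "finite_vna M"
    and "faithful_normal_tracial_state M \<tau>"
    and "free_ultrafilter \<omega>"
    and "von_neumann_subalgebra A M"
    and "abelian A"
    and "diffuse A"
    and "strong_asymptotic_orthogonality \<omega> M \<tau> A"
  shows "singular_in A M"
proof -
  interpret tracial_abelian M \<tau> A \<omega>
    using assms by unfold_locales (auto simp: finite_vna_def)
  show ?thesis
    unfolding singular_in_def
  proof (intro ballI impI, elim conjE)
    fix w assume w: "w \<in> M" "unitary w" and A: "(\<lambda>a. w * a * adj w) ` A = A"
    have wA: "w * a * adj w \<in> A" if "a \<in> A" for a using A that by blast
    have "w * p = p * w" if "p \<in> projections A" for p
      using displaced_projection[OF w wA that]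
        no_displaced_projection[OF assms(7,6) w wA] by metis
    then have "w * a = a * w" if "a \<in> A" for a
      using commute_projections_imp_commute that by blast
    then show "w \<in> A" using commuting_unitary_in_A[OF assms(7,6) w(1)] by blast
  qed
qed

end
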